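(* Fix an integer $d\ge 1$ and $\varepsilon>0$. Let $G_n$ be the $d$-NN tree and let $v$ be a uniformly chosen vertex of $G_n$. Then, with probability tending to $1$ as $n\to\infty$: (i) $(1-\varepsilon)\log n\le h(v,G_n)\le(1+\varepsilon)\log n$; (ii) $(2e-\varepsilon)\log n\le \mathrm{diam}(G_n)\le 2h(G_n)\le(2e+\varepsilon)\log n$.
   Context: Here $\log$ is the natural logarithm and $e$ its base. Let $\mathbb T^d_n$ be the $d$-dimensional torus of volume $n$ (that is, $\mathbb R^d/(n^{1/d}\mathbb Z)^d$) with the metric inherited from the Euclidean metric. The $d$-NN tree $G_n$: vertices $0,1,\dots,n-1$ arrive one by one, vertex $i$ being placed at a uniformly random point of $\mathbb T^d_n$, independently of all others; each vertex $i\ge 1$ is connected upon arrival by an edge to the closest vertex among $\{0,\dots,i-1\}$ in the torus metric (ties have probability $0$). $G_n$ is a tree rooted at $0$. For a rooted tree $T$ and a vertex $v$ of $T$, $h(v,T)$ is the graph distance from $v$ to the root, $h(T)=\max_v h(v,T)$ is the height, and $\mathrm{diam}(T)$ is the graph diameter. *)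

theory Defs
  imports "HOL-Probability.Probability"
begin

subsection \<open>Graphs given by their symmetric edge relation\<close>

text \<open>
  The least number of edges of a walk from u to v. The value is meaningful only when u and v
  are connected, which holds for any two vertices of the trees below (\<open>graph_dist_nn_tree\<close>).
\<close>

definition graph_dist :: "('a \<times> 'a) set \<Rightarrow> 'a \<Rightarrow> 'a \<Rightarrow> nat" where
  "graph_dist E u v = (LEAST k. (u, v) \<in> E ^^ k)"

definition tree_height :: "'a set \<Rightarrow> ('a \<times> 'a) set \<Rightarrow> 'a \<Rightarrow> nat" where
  "tree_height V E r = Max ((\<lambda>v. graph_dist E v r) ` V)"

definition graph_diam :: "'a set \<Rightarrow> ('a \<times> 'a) set \<Rightarrow> nat" where
  "graph_diam V E = Max ((\<lambda>(u, v). graph_dist E u v) ` (V \<times> V))"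


subsection \<open>The torus of volume n\<close>

text \<open>
  The dimension is \<open>CARD('d)\<close>. A point of the torus is represented by its unique representative
  in a half-open cube; the distance is the infimum of the Euclidean distances between
  representatives of the two classes.
\<close>

definition torus_side :: "'d::finite itself \<Rightarrow> nat \<Rightarrow> real" where
  "torus_side _ n = root CARD('d) (real n)"

definition torus :: "nat \<Rightarrow> (real ^ 'd::finite) set" where
  "torus n = {x. \<forall>i. 0 \<le> x $ i \<and> x $ i < torus_side TYPE('d) n}"

definition torus_dist :: "nat \<Rightarrow> real ^ 'd::finite \<Rightarrow> real ^ 'd \<Rightarrow> real" where
  "torus_dist n x y =
     (INF k :: 'd \<Rightarrow> int. dist x (y + torus_side TYPE('d) n *\<^sub>R (\<chi> i. of_int (k i))))"


subsection \<open>The nearest neighbour tree\<close>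

text \<open>
  \<open>x i\<close> is the position of vertex i. Ties, which have probability 0, are broken in favour of
  the smallest index.
\<close>

definition nn_parent :: "nat \<Rightarrow> (nat \<Rightarrow> real ^ 'd::finite) \<Rightarrow> nat \<Rightarrow> nat" where
  "nn_parent n x i =
     (LEAST j. j < i \<and> (\<forall>k<i. torus_dist n (x i) (x j) \<le> torus_dist n (x i) (x k)))"

definition nn_tree :: "nat \<Rightarrow> (nat \<Rightarrow> real ^ 'd::finite) \<Rightarrow> (nat \<times> nat) set" where
  "nn_tree n x = (\<Union>i\<in>{1..<n}. {(i, nn_parent n x i), (nn_parent n x i, i)})"

text \<open>
  The law of the positions of the vertices \<open>0, \<dots>, n - 1\<close> together with an independent, uniformly
  chosen vertex. It is a probability measure for \<open>n \<ge> 1\<close>.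
\<close>

definition nn_space :: "nat \<Rightarrow> ((nat \<Rightarrow> real ^ 'd::finite) \<times> nat) measure" where
  "nn_space n =
     (\<Pi>\<^sub>M i\<in>{..<n}. uniform_measure lborel (torus n)) \<Otimes>\<^sub>M uniform_count_measure {..<n}"


lemma nn_parent:
  assumes "0 < i"
  shows "nn_parent n x i < i"
    and "k < i \<Longrightarrow> torus_dist n (x i) (x (nn_parent n x i)) \<le> torus_dist n (x i) (x k)"
proof -
  have "\<exists>j. j \<in> {..<i} \<and> (\<forall>k\<in>{..<i}. torus_dist n (x i) (x j) \<le> torus_dist n (x i) (x k))"
    using ex_is_arg_min_if_finite[of "{..<i}" "\<lambda>j. torus_dist n (x i) (x j)"] assms
    by (auto simp: is_arg_min_linorder)
  then obtain j where "j < i \<and> (\<forall>k<i. torus_dist n (x i) (x j) \<le> torus_dist n (x i) (x k))"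
    by auto
  from LeastI[of "\<lambda>j. j < i \<and> (\<forall>k<i. torus_dist n (x i) (x j) \<le> torus_dist n (x i) (x k))", OF this]
  show "nn_parent n x i < i"
    and "k < i \<Longrightarrow> torus_dist n (x i) (x (nn_parent n x i)) \<le> torus_dist n (x i) (x k)"
    unfolding nn_parent_def by auto
qed

lemma sym_nn_tree: "sym (nn_tree n x)"
  by (auto simp: nn_tree_def sym_def)

lemma nn_tree_connected_root: "i < n \<Longrightarrow> (i, 0) \<in> (nn_tree n x)\<^sup>*"
proof (induction i rule: less_induct)
  case (less i)
  show ?case
  proof (cases "i = 0")
    case False
    then have "nn_parent n x i < i" by (simp add: nn_parent)
    moreover from this have "(nn_parent n x i, 0) \<in> (nn_tree n x)\<^sup>*" using less by simp
    moreover have "(i, nn_parent n x i) \<in> nn_tree n x"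
      using False less.prems by (auto simp: nn_tree_def)
    ultimately show ?thesis by (meson converse_rtrancl_into_rtrancl)
  qed simp
qed

lemma graph_dist_nn_tree:
  assumes "u < n" "v < n"
  shows "(u, v) \<in> nn_tree n x ^^ graph_dist (nn_tree n x) u v"
proof -
  have "(0, v) \<in> (nn_tree n x)\<^sup>*"
    using nn_tree_connected_root[OF assms(2)] sym_rtrancl[OF sym_nn_tree] by (meson symD)
  then have "(u, v) \<in> (nn_tree n x)\<^sup>*"
    using nn_tree_connected_root[OF assms(1)] by (meson rtrancl_trans)
  then obtain k where "(u, v) \<in> nn_tree n x ^^ k" by (auto simp: rtrancl_power)
  then show ?thesis unfolding graph_dist_def by (rule LeastI)
qed

end

theory Submission
  imports Defs "HOL-Real_Asymp.Real_Asymp"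
begin

text \<open>
  Let a path from v be revealed one vertex at a time. When it has reached a, the balls seen so far
  contain no point with index below a, and given this information the points \<open>0, \<dots>, a - 1\<close> are
  still exchangeable. So the parent of a is uniform on \<open>{..<a}\<close>, and a decreasing list is an initial
  segment of an ancestral path with probability exactly \<open>\<Prod> 1 / a\<close>, as in the random recursive tree.
  The generating function of the depths follows from this, and Markov's inequality gives (i) and the
  upper bound in (ii).

  For the lower bound on the diameter, two paths are revealed together, always moving the one with
  the larger current vertex. Exchangeability holds again, except that the current vertex of the
  other path is at an exposed location. Thus disjoint pairs of paths have at most about the
  product probability. A merger at a vertex near a forces the starting points to be within
  distance \<open>(n / a)\<^sup>1\<^sup>/\<^sup>d\<close> up to logarithmic factors, as edges at vertices above a are short; this has
  probability \<open>1 / a\<close> up to logarithmic factors. The second moment method, applied to paths with a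
  prescribed number of vertices in each geometric block of indices, then yields two disjoint paths
  of length almost \<open>e ln n\<close> whose common ancestors have small index.
\<close>

text \<open>Origin of \<open>e\<close>: a block \<open>{lo..<lo * M}\<close> of indices multiplies
  the expected number of paths with \<open>k\<close> vertices in it by about
  \<open>(ln M) ^ k / k!\<close>. By Stirling this stays above 1 while \<open>k\<close> is below
  about \<open>e * ln M\<close>, and there are about \<open>ln n / ln M\<close> blocks.

  A mean just above 1 per block leaves no room for pairs that merge. The room comes from the cutoff
  \<open>m\<close>, about \<open>n ^ \<delta>\<close>: below it a path has a single vertex, free
  among \<open>m\<close> values, so the mean number of paths is at least \<open>m\<close>, whereas
  two merged paths share that vertex. Merged pairs thus lose a factor \<open>m\<close>, which beats
  all powers of \<open>ln n\<close> produced by lengths of paths and edges, while the cutoff costs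
  only a fraction \<open>\<delta>\<close> of the path length.

  The step into the meeting vertex is not governed by exchangeability, as its target is already
  exposed. The closeness of the starting points, of probability \<open>1 / a\<close> up to
  logarithms, takes over its factor \<open>1 / a\<close>.\<close>

section \<open>Distances in trees\<close>

text \<open>Source of all lower bounds on graph distances: a potential that changes by at most 1
  along edges cannot vary by more than the length of a walk. The potentials used below count
  ancestors in fixed sets of vertices.\<close>

lemma relpow_potential_le:
  fixes \<phi> :: "'a \<Rightarrow> int"
  assumes "(u, w) \<in> E ^^ k" and "\<And>a b. (a, b) \<in> E \<Longrightarrow> \<bar>\<phi> a - \<phi> b\<bar> \<le> 1"
  shows "\<bar>\<phi> u - \<phi> w\<bar> \<le> int k"
  using assms(1)
proof (induction k arbitrary: w)
  case (Suc k)
  then obtain v where "(u, v) \<in> E ^^ k" "(v, w) \<in> E" by auto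
  then show ?case using Suc.IH[of v] assms(2)[of v w] by simp
qed simp

lemma sym_relpow: "sym E \<Longrightarrow> (u, v) \<in> E ^^ k \<Longrightarrow> (v, u) \<in> E ^^ k"
proof (induction k arbitrary: v)
  case (Suc k)
  then obtain w where "(u, w) \<in> E ^^ k" "(w, v) \<in> E" by auto
  then show ?case using Suc by (intro relpow_Suc_I2) (auto dest: symD)
qed simp

lemma graph_dist_le: "(u, v) \<in> E ^^ k \<Longrightarrow> graph_dist E u v \<le> k"
  unfolding graph_dist_def by (rule Least_le)

text \<open>Any two vertices are joined by a walk through the root. This holds for every placement
  of the points, so the middle inequality of (ii) costs no probability.\<close>

lemma graph_diam_nn_tree_le:
  assumes "0 < n"
  shows "graph_diam {..<n} (nn_tree n x) \<le> 2 * tree_height {..<n} (nn_tree n x) 0"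
proof -
  let ?h = "tree_height {..<n} (nn_tree n x) 0"
  have h: "graph_dist (nn_tree n x) v 0 \<le> ?h" if "v < n" for v
    unfolding tree_height_def using that by (intro Max_ge) auto
  have "graph_dist (nn_tree n x) u v \<le> 2 * ?h" if uv: "u < n" "v < n" for u v
  proof -
    have "(u, 0) \<in> nn_tree n x ^^ graph_dist (nn_tree n x) u 0"
      and "(v, 0) \<in> nn_tree n x ^^ graph_dist (nn_tree n x) v 0"
      using uv by (auto intro!: graph_dist_nn_tree)
    then have "(u, v) \<in> nn_tree n x ^^ (graph_dist (nn_tree n x) u 0 + graph_dist (nn_tree n x) v 0)"
      by (auto simp: relpow_add dest!: sym_relpow[OF sym_nn_tree, of v])
    then show ?thesis using graph_dist_le h[OF uv(1)] h[OF uv(2)] by fastforce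
  qed
  then show ?thesis
    unfolding graph_diam_def using assms by (subst Max_le_iff) auto
qed

section \<open>Ancestors and distances along chains\<close>

lemma sorted_wrt_greater_distinct: "sorted_wrt (>) (s :: nat list) \<Longrightarrow> distinct s"
  by (induction s) auto

text \<open>The reflexive closure makes \<open>v\<close> its own ancestor.\<close>

definition ancestors :: "nat \<Rightarrow> (nat \<Rightarrow> real ^ 'd::finite) \<Rightarrow> nat \<Rightarrow> nat set" where
  "ancestors n x v = {w. (v, w) \<in> {(i, nn_parent n x i) |i. 1 \<le> i \<and> i < n}\<^sup>*}"

lemma ancestors_parent:
  assumes "1 \<le> v" "v < n"
  shows "ancestors n x v = insert v (ancestors n x (nn_parent n x v))"
proof -
  let ?R = "{(i, nn_parent n x i) |i. 1 \<le> i \<and> i < n}"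
  have R: "(v, nn_parent n x v) \<in> ?R" using assms by auto
  have "(v, w) \<in> ?R\<^sup>* \<longleftrightarrow> w = v \<or> (nn_parent n x v, w) \<in> ?R\<^sup>*" for w
  proof
    assume "(v, w) \<in> ?R\<^sup>*"
    then show "w = v \<or> (nn_parent n x v, w) \<in> ?R\<^sup>*" by (rule converse_rtranclE) auto
  next
    assume "w = v \<or> (nn_parent n x v, w) \<in> ?R\<^sup>*"
    then show "(v, w) \<in> ?R\<^sup>*" using R by (meson converse_rtrancl_into_rtrancl rtrancl.rtrancl_refl)
  qed
  then show ?thesis unfolding ancestors_def by blast
qed

lemma ancestors_root: "ancestors n x 0 = {0}"
proof -
  have "w = 0" if "(0, w) \<in> {(i, nn_parent n x i) |i. 1 \<le> i \<and> i < n}\<^sup>*" for w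
    using that by (rule converse_rtranclE) auto
  then show ?thesis unfolding ancestors_def by auto
qed

lemma ancestors_le: "w \<in> ancestors n x v \<Longrightarrow> w \<le> v"
  unfolding ancestors_def mem_Collect_eq
proof (induction rule: rtrancl_induct)
  case (step y z)
  then show ?case using nn_parent(1)[of y n x] by auto
qed simp

lemma finite_ancestors [simp]: "finite (ancestors n x v)"
  by (rule finite_subset[of _ "{..v}"]) (auto dest: ancestors_le)

text \<open>Moving to the parent removes exactly \<open>v\<close>, so for every set \<open>B\<close>
  the number of ancestors in \<open>B\<close> is a potential for
  \<open>relpow_potential_le\<close>.\<close>

lemma card_ancestors_parent:
  assumes "1 \<le> v" "v < n"
  shows "card (ancestors n x v \<inter> B) = card (ancestors n x (nn_parent n x v) \<inter> B) + of_bool (v \<in> B)"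
proof -
  have "v \<notin> ancestors n x (nn_parent n x v)"
    using nn_parent(1)[of v n x] assms ancestors_le[of v n x "nn_parent n x v"] by auto
  then show ?thesis
    unfolding ancestors_parent[OF assms] by (auto simp: Int_insert_left)
qed

lemma ancestors_chain:
  assumes "successively (\<lambda>a b. nn_parent n x a = b) s" "s \<noteq> []" "sorted_wrt (>) s" "set s \<subseteq> {..<n}"
  shows "ancestors n x (hd s) = set s \<union> ancestors n x (last s)"
  using assms
proof (induction s)
  case (Cons a s)
  show ?case
  proof (cases "s = []")
    case True
    then show ?thesis by (auto simp: ancestors_def)
  next
    case False
    then have "hd s < a" "nn_parent n x a = hd s" "a < n"
      using Cons.prems by (auto simp: successively_Cons)
    then show ?thesis
      using ancestors_parent[of a n x] Cons False by (auto simp: successively_Cons)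
  qed
qed simp

lemma relpow_chain:
  assumes "successively (\<lambda>a b. nn_parent n x a = b) s" "s \<noteq> []" "sorted_wrt (>) s" "set s \<subseteq> {..<n}"
  shows "(hd s, last s) \<in> nn_tree n x ^^ (length s - 1)"
  using assms
proof (induction s)
  case (Cons a s)
  show ?case
  proof (cases "s = []")
    case False
    then have "hd s < a" "nn_parent n x a = hd s" "a < n"
      using Cons.prems by (auto simp: successively_Cons)
    then have "(a, hd s) \<in> nn_tree n x" by (auto simp: nn_tree_def)
    moreover have "(hd s, last s) \<in> nn_tree n x ^^ (length s - 1)"
      using Cons False by (auto simp: successively_Cons)
    ultimately have "(a, last s) \<in> nn_tree n x ^^ Suc (length s - 1)"
      by (rule relpow_Suc_I2)
    then show ?thesis using False by (simp del: relpow.simps)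
  qed simp
qed simp

text \<open>The potential counts the ancestors other than the root, that is, it is the depth. It
  falls from \<open>length s - 1\<close> at the head of the chain to 0 at the root.\<close>

lemma graph_dist_chain:
  assumes s: "successively (\<lambda>a b. nn_parent n x a = b) s" "s \<noteq> []" "sorted_wrt (>) s" "set s \<subseteq> {..<n}"
    and "last s = 0"
  shows "graph_dist (nn_tree n x) (hd s) 0 = length s - 1"
proof (rule antisym)
  have hd: "hd s < n" using s by (auto simp: subset_iff)
  then have n: "0 < n" by simp
  show "graph_dist (nn_tree n x) (hd s) 0 \<le> length s - 1"
    using relpow_chain[OF s] assms(5) by (auto intro: graph_dist_le)
  define \<phi> where "\<phi> v = int (card (ancestors n x v \<inter> {1..}))" for v
  have "\<bar>\<phi> a - \<phi> b\<bar> \<le> 1" if "(a, b) \<in> nn_tree n x" for a b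
    using that by (auto simp: nn_tree_def \<phi>_def card_ancestors_parent)
  from relpow_potential_le[of _ _ _ _ \<phi>, OF graph_dist_nn_tree[OF hd n] this]
  have le: "\<bar>\<phi> (hd s) - \<phi> 0\<bar> \<le> int (graph_dist (nn_tree n x) (hd s) 0)" .
  obtain t where t: "s = t @ [0]" using s(2) assms(5) by (cases s rule: rev_cases) auto
  have "set s \<inter> {1..} = set t" using s(3) by (force simp: t sorted_wrt_append)
  moreover have "distinct t" using sorted_wrt_greater_distinct[OF s(3)] by (simp add: t)
  ultimately have "card (set s \<inter> {1..}) = length s - 1" by (simp add: distinct_card t)
  then have "\<phi> (hd s) = int (length s - 1)" "\<phi> 0 = 0"
    using ancestors_chain[OF s] assms(5) by (auto simp: \<phi>_def ancestors_root Int_Un_distrib2)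
  then show "length s - 1 \<le> graph_dist (nn_tree n x) (hd s) 0" using le by linarith
qed

text \<open>
  Along an edge, the number of ancestors (including the vertex itself) in \<open>butlast s\<close> and the number
  of those in \<open>butlast s'\<close> change by at most 1 in total, and their difference drops from K to -K.
\<close>

lemma graph_dist_disjoint_chains:
  assumes s: "successively (\<lambda>a b. nn_parent n x a = b) s" "s \<noteq> []" "sorted_wrt (>) s" "set s \<subseteq> {..<n}"
    and s': "successively (\<lambda>a b. nn_parent n x a = b) s'" "s' \<noteq> []" "sorted_wrt (>) s'" "set s' \<subseteq> {..<n}"
    and disj: "set s \<inter> set s' = {}"
    and m: "last s < m" "last s' < m" "\<forall>a\<in>set (butlast s) \<union> set (butlast s'). m \<le> a"
  shows "(length s - 1) + (length s' - 1) \<le> graph_dist (nn_tree n x) (hd s) (hd s')"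
proof -
  define B where "B = set (butlast s)"
  define B' where "B' = set (butlast s')"
  have hd: "hd s < n" "hd s' < n" using s s' by (auto simp: subset_iff)
  define \<phi> where "\<phi> v = int (card (ancestors n x v \<inter> B)) - int (card (ancestors n x v \<inter> B'))" for v
  have BB: "B \<inter> B' = {}" using disj by (auto simp: B_def B'_def dest: in_set_butlastD)
  have \<phi>: "\<bar>\<phi> a - \<phi> b\<bar> \<le> 1" if "(a, b) \<in> nn_tree n x" for a b
    using that BB by (auto simp: nn_tree_def \<phi>_def card_ancestors_parent)
  from relpow_potential_le[of _ _ _ _ \<phi>, OF graph_dist_nn_tree[OF hd] this]
  have le: "\<bar>\<phi> (hd s) - \<phi> (hd s')\<bar> \<le> int (graph_dist (nn_tree n x) (hd s) (hd s'))" .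
  have *: "ancestors n x (hd t) \<inter> set (butlast t) = set (butlast t)"
     "ancestors n x (hd t) \<inter> set (butlast t') = {}" "card (set (butlast t)) = length t - 1"
    if t: "successively (\<lambda>a b. nn_parent n x a = b) t" "t \<noteq> []" "sorted_wrt (>) t" "set t \<subseteq> {..<n}"
      "last t < m" "\<forall>a\<in>set (butlast t'). m \<le> a" "set t \<inter> set t' = {}"
    for t t' :: "nat list"
  proof -
    have "distinct t" using t(3) by (rule sorted_wrt_greater_distinct)
    then show "card (set (butlast t)) = length t - 1" by (simp add: distinct_card distinct_butlast)
    show "ancestors n x (hd t) \<inter> set (butlast t) = set (butlast t)"
      using ancestors_chain[OF t(1-4)] by (auto dest: in_set_butlastD)
    show "ancestors n x (hd t) \<inter> set (butlast t') = {}"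
      using ancestors_chain[OF t(1-4)] t ancestors_le[of _ n x "last t"] by (fastforce dest: in_set_butlastD)
  qed
  have "\<phi> (hd s) = int (length s - 1)" "\<phi> (hd s') = - int (length s' - 1)"
    using *[of s s'] *[of s' s] s s' disj Int_commute[of "set s" "set s'"] m by (auto simp: \<phi>_def B_def B'_def)
  then show ?thesis using le by linarith
qed

section \<open>Exchangeability along ancestral paths\<close>

text \<open>The inequality is strict because the tie-breaking of \<open>nn_parent\<close> depends on
  the indices and would spoil the symmetry under swaps of points. Almost surely every positive index
  has a nearest one (\<open>AE_ex_nearest\<close>), and it is then the parent
  (\<open>nn_parent_nearest\<close>).\<close>

definition nearest :: "('a \<Rightarrow> 'a \<Rightarrow> real) \<Rightarrow> (nat \<Rightarrow> 'a) \<Rightarrow> nat \<Rightarrow> nat \<Rightarrow> bool" where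
  "nearest D x a b \<longleftrightarrow> b < a \<and> (\<forall>k<a. k \<noteq> b \<longrightarrow> D (x a) (x b) < D (x a) (x k))"

lemma nearest_less: "nearest D x a b \<Longrightarrow> b < a"
  by (simp add: nearest_def)

lemma nearest_unique: "nearest D x a b \<Longrightarrow> nearest D x a c \<Longrightarrow> b = c"
  unfolding nearest_def by (metis less_asym)

text \<open>Path probabilities see the geometry only through these two properties of
  \<open>D\<close>. That spheres are null excludes ties.\<close>

locale iid_points = U: prob_space U for U :: "'a measure" +
  fixes n :: nat and D :: "'a \<Rightarrow> 'a \<Rightarrow> real"
  assumes measurable_D [measurable]: "case_prod D \<in> borel_measurable (U \<Otimes>\<^sub>M U)"
    and no_atoms: "\<And>y r. y \<in> space U \<Longrightarrow> measure U {z \<in> space U. D y z = r} = 0"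
begin

definition P :: "(nat \<Rightarrow> 'a) measure" where
  "P = (\<Pi>\<^sub>M i\<in>{..<n}. U)"

sublocale P: prob_space P
  unfolding P_def by (intro prob_space_PiM U.prob_space_axioms)

lemma space_PD: "x \<in> space P \<Longrightarrow> i < n \<Longrightarrow> x i \<in> space U"
  by (auto simp: P_def space_PiM)

lemma space_P_upd: "x \<in> space P \<Longrightarrow> i < n \<Longrightarrow> z \<in> space U \<Longrightarrow> x(i := z) \<in> space P"
  by (auto simp: P_def space_PiM PiE_def extensional_def)

lemma measurable_coord [measurable]: "i < n \<Longrightarrow> (\<lambda>x. x i) \<in> measurable P U"
  unfolding P_def by (rule measurable_component_singleton) simp

lemma measurable_D_coord [measurable]:
  assumes "i < n" "j < n"
  shows "(\<lambda>x. D (x i) (x j)) \<in> borel_measurable P"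
proof -
  have "(\<lambda>x. (x i, x j)) \<in> measurable P (U \<Otimes>\<^sub>M U)"
    using assms by measurable
  from measurable_compose[OF this measurable_D] show ?thesis by simp
qed

lemma pred_nearest [measurable]:
  assumes "a < n"
  shows "Measurable.pred P (\<lambda>x. nearest D x a b)"
proof (cases "b < a")
  case True
  have "Measurable.pred P (\<lambda>x. \<forall>k\<in>{..<a}. k \<noteq> b \<longrightarrow> D (x a) (x b) < D (x a) (x k))"
  proof (intro pred_intros_finite finite_lessThan)
    fix k assume k: "k \<in> {..<a}"
    have "Measurable.pred P (\<lambda>x. D (x a) (x b) < D (x a) (x k))"
      using assms True k by (intro borel_measurable_pred_less measurable_D_coord) auto
    then show "Measurable.pred P (\<lambda>x. k \<noteq> b \<longrightarrow> D (x a) (x b) < D (x a) (x k))"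
      by (cases "k = b") auto
  qed
  moreover have "nearest D x a b \<longleftrightarrow> (\<forall>k\<in>{..<a}. k \<noteq> b \<longrightarrow> D (x a) (x b) < D (x a) (x k))" for x
    using True by (auto simp: nearest_def)
  ultimately show ?thesis by presburger
qed (simp add: nearest_def)

definition Path :: "nat list \<Rightarrow> (nat \<Rightarrow> 'a) set" where
  "Path s = {x \<in> space P. successively (nearest D x) s}"

lemma sets_nearest: "a < n \<Longrightarrow> {x \<in> space P. nearest D x a b} \<in> sets P"
  using pred_nearest[of a b] by (simp add: pred_def)

lemma Path_singleton [simp]: "Path [i] = space P"
  by (simp add: Path_def)

lemma Path_snoc:
  "s \<noteq> [] \<Longrightarrow> Path (s @ [b]) = Path s \<inter> {x \<in> space P. nearest D x (last s) b}"
  by (auto simp: Path_def successively_append_iff)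

lemma Path_subset_space: "Path s \<subseteq> space P"
  by (auto simp: Path_def)

lemma sets_Path [measurable]: "set s \<subseteq> {..<n} \<Longrightarrow> Path s \<in> sets P"
proof (induction s rule: rev_induct)
  case (snoc b s)
  then show ?case
    by (cases "s = []") (use last_in_set[of s] in \<open>auto simp: Path_snoc subset_iff intro!: sets.Int sets_nearest\<close>)
qed (simp add: Path_def)

lemma distr_upd:
  assumes "i < n"
  shows "distr (U \<Otimes>\<^sub>M (\<Pi>\<^sub>M j\<in>{..<n} - {i}. U)) P (\<lambda>(z, X). X(i := z)) = P"
  using distr_pair_PiM_eq_PiM[of "{..<n} - {i}" "\<lambda>_. U" i] assms U.prob_space_axioms
  by (simp add: P_def insert_absorb)

text \<open>Fubini in coordinate \<open>i\<close>, in the role of a conditional probability: whether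
  \<open>F\<close> holds does not depend on the point \<open>i\<close>, and given all other points
  \<open>E\<close> has probability at most \<open>\<beta>\<close>.\<close>

lemma prob_slice:
  assumes i: "i < n" and E: "E \<in> sets P" and F: "F \<in> sets P" and EF: "E \<subseteq> F"
    and indep: "\<And>x z. x \<in> space P \<Longrightarrow> z \<in> space U \<Longrightarrow> x(i := z) \<in> F \<longleftrightarrow> x \<in> F"
    and bound: "\<And>x. x \<in> F \<Longrightarrow> measure U {z \<in> space U. x(i := z) \<in> E} \<le> \<beta>"
    and \<beta>: "0 \<le> \<beta>"
  shows "P.prob E \<le> \<beta> * P.prob F"
proof -
  define I where "I = (\<Pi>\<^sub>M j\<in>{..<n} - {i}. U)"
  interpret I: prob_space I
    unfolding I_def by (intro prob_space_PiM U.prob_space_axioms)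
  interpret UI: pair_prob_space U I ..
  have upd [measurable]: "(\<lambda>(z, X). X(i := z)) \<in> measurable (U \<Otimes>\<^sub>M I) P"
    unfolding I_def P_def using i
    by (auto simp: case_prod_beta' intro!: measurable_fun_upd[where J="{..<n} - {i}"])
  have em: "emeasure P A = (\<integral>\<^sup>+X. emeasure U {z \<in> space U. X(i := z) \<in> A} \<partial>I)" if A: "A \<in> sets P" for A
  proof -
    have "emeasure P A = emeasure (distr (U \<Otimes>\<^sub>M I) P (\<lambda>(z, X). X(i := z))) A"
      using distr_upd[OF i] by (simp add: I_def)
    also have "\<dots> = emeasure (U \<Otimes>\<^sub>M I) ((\<lambda>(z, X). X(i := z)) -` A \<inter> space (U \<Otimes>\<^sub>M I))"
      using A upd by (rule emeasure_distr[rotated])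
    also have "\<dots> = (\<integral>\<^sup>+X. emeasure U ((\<lambda>z. (z, X)) -` ((\<lambda>(z, X). X(i := z)) -` A \<inter> space (U \<Otimes>\<^sub>M I))) \<partial>I)"
      using A upd by (intro UI.emeasure_pair_measure_alt2 measurable_sets)
    also have "\<dots> = (\<integral>\<^sup>+X. emeasure U {z \<in> space U. X(i := z) \<in> A} \<partial>I)"
      by (intro nn_integral_cong arg_cong[where f="emeasure U"]) (auto simp: space_pair_measure)
    finally show ?thesis .
  qed
  have meas: "(\<lambda>X. emeasure U {z \<in> space U. X(i := z) \<in> A}) \<in> borel_measurable I" if A: "A \<in> sets P" for A
  proof -
    have "(\<lambda>X. emeasure U ((\<lambda>z. (z, X)) -` ((\<lambda>(z, X). X(i := z)) -` A \<inter> space (U \<Otimes>\<^sub>M I)))) \<in> borel_measurable I"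
      using A upd by (intro UI.measurable_emeasure_Pair2 measurable_sets)
    also have "?this \<longleftrightarrow> ?thesis"
      by (intro measurable_cong arg_cong[where f="emeasure U"]) (auto simp: space_pair_measure)
    finally show ?thesis .
  qed
  obtain z0 where z0: "z0 \<in> space U" using U.not_empty by auto
  have "emeasure P E \<le> (\<integral>\<^sup>+X. ennreal \<beta> * emeasure U {z \<in> space U. X(i := z) \<in> F} \<partial>I)"
    unfolding em[OF E]
  proof (intro nn_integral_mono)
    fix X assume X: "X \<in> space I"
    have x0: "X(i := z0) \<in> space P"
      using measurable_space[OF upd, of "(z0, X)"] X z0 by (auto simp: space_pair_measure)
    show "emeasure U {z \<in> space U. X(i := z) \<in> E} \<le> ennreal \<beta> * emeasure U {z \<in> space U. X(i := z) \<in> F}"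
    proof (cases "X(i := z0) \<in> F")
      case True
      then have "{z \<in> space U. X(i := z) \<in> F} = space U"
        using indep[OF x0] by auto
      moreover have "measure U {z \<in> space U. X(i := z) \<in> E} \<le> \<beta>"
        using bound[OF True] by simp
      ultimately show ?thesis
        by (simp add: U.emeasure_eq_measure U.prob_space ennreal_leI)
    next
      case False
      then have "{z \<in> space U. X(i := z) \<in> E} = {}"
        using indep[OF x0] EF by auto
      then show ?thesis by (simp only: emeasure_empty zero_le)
    qed
  qed
  also have "\<dots> = ennreal \<beta> * emeasure P F"
    using meas[OF F] by (simp add: em[OF F] nn_integral_cmult)
  finally have "ennreal (P.prob E) \<le> ennreal (\<beta> * P.prob F)"
    using \<beta> by (simp add: P.emeasure_eq_measure ennreal_mult')
  then show ?thesis using \<beta> by (subst (asm) ennreal_le_iff) auto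
qed

text \<open>With all points except \<open>j\<close> fixed, a tie puts point \<open>j\<close> on a
  fixed sphere around \<open>x i\<close>, which is null.\<close>

lemma AE_no_tie:
  assumes "i < n" "j < n" "k < n" "i \<noteq> j" "i \<noteq> k" "j \<noteq> k"
  shows "AE x in P. D (x i) (x j) \<noteq> D (x i) (x k)"
proof -
  let ?E = "{x \<in> space P. D (x i) (x j) = D (x i) (x k)}"
  have E: "?E \<in> sets P" using assms by measurable
  have "P.prob ?E \<le> 0 * P.prob (space P)"
  proof (rule prob_slice[OF assms(2) E])
    fix x assume x: "x \<in> space P"
    then have "{z \<in> space U. x(j := z) \<in> ?E} = {z \<in> space U. D (x i) z = D (x i) (x k)}"
      using assms by (auto simp: space_P_upd)
    then show "measure U {z \<in> space U. x(j := z) \<in> ?E} \<le> 0"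
      using no_atoms[OF space_PD[OF x assms(1)]] by simp
  qed (use assms in \<open>auto simp: space_P_upd\<close>)
  then have "P.prob ?E = 0" by (simp add: measure_le_0_iff)
  then show ?thesis using E by (subst (asm) P.prob_eq_0) (auto elim!: eventually_mono)
qed

lemma AE_ex_nearest:
  "AE x in P. \<forall>a\<in>{1..<n}. \<exists>b<a. nearest D x a b"
proof -
  have "AE x in P. \<forall>t\<in>{(i, j, k). i < n \<and> j < n \<and> k < n \<and> i \<noteq> j \<and> i \<noteq> k \<and> j \<noteq> k}.
      case t of (i, j, k) \<Rightarrow> D (x i) (x j) \<noteq> D (x i) (x k)"
    using AE_no_tie by (subst AE_ball_countable) (auto intro: countable_subset[OF subset_UNIV])
  then show ?thesis
  proof eventually_elim
    case (elim x)
    show ?case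
    proof
      fix a assume a: "a \<in> {1..<n}"
      obtain b where b: "b \<in> {..<a}" "\<forall>k\<in>{..<a}. D (x a) (x b) \<le> D (x a) (x k)"
        using ex_is_arg_min_if_finite[of "{..<a}" "\<lambda>j. D (x a) (x j)"] a
        by (auto simp: is_arg_min_linorder)
      have "D (x a) (x b) < D (x a) (x k)" if "k < a" "k \<noteq> b" for k
        using bspec[OF elim, of "(a, b, k)"] that a b by (auto simp: less_le)
      then show "\<exists>b<a. nearest D x a b" using b by (auto simp: nearest_def)
    qed
  qed
qed

text \<open>The restriction to \<open>{..<n}\<close> keeps the result extensional, as points of the
  product space are.\<close>

definition swp :: "nat \<Rightarrow> nat \<Rightarrow> (nat \<Rightarrow> 'a) \<Rightarrow> nat \<Rightarrow> 'a" where
  "swp j j' x = (\<lambda>i\<in>{..<n}. x (Transposition.transpose j j' i))"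

lemma
  assumes "j < n" "j' < n"
  shows measurable_swp [measurable]: "swp j j' \<in> measurable P P"
    and distr_swp: "distr P P (swp j j') = P"
proof -
  have inj: "inj_on (Transposition.transpose j j') {..<n}"
    by (metis inj_onI transpose_involutory)
  have into: "Transposition.transpose j j' \<in> {..<n} \<rightarrow> {..<n}"
    using assms by (auto simp: Transposition.transpose_def)
  show "swp j j' \<in> measurable P P"
    unfolding swp_def P_def using into
    by (intro measurable_restrict measurable_component_singleton) auto
  show "distr P P (swp j j') = P"
    using distr_PiM_reindex[of "{..<n}" "\<lambda>_. U", OF _ inj into] U.prob_space_axioms
    by (simp add: swp_def[abs_def] P_def)
qed

text \<open>Both swapped indices are below \<open>a\<close>, so \<open>x a\<close> stays in place
  and the set of candidate positions is unchanged; only the name of the nearest one changes.\<close>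

lemma nearest_swp:
  assumes "j < a" "j' < a" "a < n"
  shows "nearest D (swp j j' x) a b \<longleftrightarrow> nearest D x a (Transposition.transpose j j' b)"
proof -
  have *: "Transposition.transpose j j' k < a \<longleftrightarrow> k < a" for k
    using assms by (auto simp: Transposition.transpose_def)
  have a: "swp j j' x a = x a" and k: "k < a \<Longrightarrow> swp j j' x k = x (Transposition.transpose j j' k)" for k
    using assms by (auto simp: swp_def Transposition.transpose_def)
  show ?thesis
  proof
    assume L: "nearest D (swp j j' x) a b"
    then have b: "b < a" by (rule nearest_less)
    show "nearest D x a (Transposition.transpose j j' b)"
      unfolding nearest_def
    proof (intro conjI allI impI)
      fix k assume k': "k < a" "k \<noteq> Transposition.transpose j j' b"
      then have "Transposition.transpose j j' k < a" "Transposition.transpose j j' k \<noteq> b" by (auto simp: *)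
      then have "D (swp j j' x a) (swp j j' x b) < D (swp j j' x a) (swp j j' x (Transposition.transpose j j' k))"
        using L by (simp add: nearest_def)
      then show "D (x a) (x (Transposition.transpose j j' b)) < D (x a) (x k)"
        using b k' by (simp add: a k *)
    qed (simp add: * b)
  next
    assume R: "nearest D x a (Transposition.transpose j j' b)"
    then have b: "b < a" using nearest_less[OF R] by (simp add: *)
    show "nearest D (swp j j' x) a b"
      unfolding nearest_def
    proof (intro conjI allI impI)
      fix k' assume k': "k' < a" "k' \<noteq> b"
      then have "Transposition.transpose j j' k' < a" "Transposition.transpose j j' k' \<noteq> Transposition.transpose j j' b"
        by (auto simp: * transpose_eq_iff)
      then show "D (swp j j' x a) (swp j j' x b) < D (swp j j' x a) (swp j j' x k')"
        using R b k' by (simp add: nearest_def a k)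
    qed (simp add: b)
  qed
qed

text \<open>Replaces conditioning: the event carries no information that distinguishes the points
  with indices in \<open>V\<close>, so given the event they are still exchangeable.\<close>

definition swap_inv :: "nat set \<Rightarrow> (nat \<Rightarrow> 'a) set \<Rightarrow> bool" where
  "swap_inv V E \<longleftrightarrow> (\<forall>j\<in>V. \<forall>j'\<in>V. \<forall>x\<in>space P. swp j j' x \<in> E \<longleftrightarrow> x \<in> E)"

lemma swap_inv_Int: "swap_inv V E \<Longrightarrow> swap_inv V F \<Longrightarrow> swap_inv V (E \<inter> F)"
  by (auto simp: swap_inv_def)

lemma swap_inv_mono: "swap_inv V E \<Longrightarrow> W \<subseteq> V \<Longrightarrow> swap_inv W E"
  by (auto simp: swap_inv_def)

lemma swap_inv_space: "V \<subseteq> {..<n} \<Longrightarrow> swap_inv V (space P)"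
  by (simp add: swap_inv_def subset_iff measurable_space[OF measurable_swp])

text \<open>A step from \<open>c\<close> to \<open>b\<close> compares \<open>b\<close> with all
  points below \<open>c\<close>. Swapping two points below \<open>c\<close>, neither of them
  \<open>b\<close>, does not affect it. Only the tail of \<open>s\<close> has to avoid
  \<open>V\<close>, because the head is the target of no step.\<close>

lemma swap_inv_Path:
  assumes "set s \<subseteq> {..<n}" "V \<subseteq> {..<n}" "V \<inter> set (tl s) = {}" "\<forall>c\<in>set (butlast s). \<forall>v\<in>V. v < c"
  shows "swap_inv V (Path s)"
  using assms
proof (induction s rule: rev_induct)
  case Nil
  then show ?case using swap_inv_space by (simp add: Path_def)
next
  case (snoc b s)
  show ?case
  proof (cases "s = []")
    case False
    have "swap_inv V {x \<in> space P. nearest D x (last s) b}"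
      unfolding swap_inv_def
    proof (intro ballI)
      fix j j' x assume *: "j \<in> V" "j' \<in> V" "x \<in> space P"
      have "last s \<in> set s" using False by simp
      then have "b \<noteq> j" "b \<noteq> j'" "j < last s" "j' < last s" "last s < n" "j < n" "j' < n"
        using * snoc.prems by (auto simp: tl_append subset_iff split: list.splits)
      then show "swp j j' x \<in> {x \<in> space P. nearest D x (last s) b} \<longleftrightarrow> x \<in> {x \<in> space P. nearest D x (last s) b}"
        using * measurable_space[OF measurable_swp, of j j' x] by (simp add: nearest_swp)
    qed
    moreover have "swap_inv V (Path s)"
      using snoc False by (intro snoc.IH) (auto simp: tl_append dest: in_set_butlastD split: list.splits)
    ultimately show ?thesis using False by (simp add: Path_snoc swap_inv_Int)
  qed (use snoc in \<open>simp add: swap_inv_space\<close>)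
qed

text \<open>
  Swapping the points j and j' of V preserves E and turns a nearest neighbour j of a into j'.
\<close>

lemma
  assumes a: "a < n" and V: "V \<subseteq> {..<a}" and E [measurable]: "E \<in> sets P"
    and inv: "swap_inv V E" and b: "b \<in> V"
  shows prob_nearest_le:
      "P.prob (E \<inter> {x \<in> space P. nearest D x a b}) * real (card V) \<le> P.prob E"
    and prob_nearest_eq:
      "V = {..<a} \<Longrightarrow> P.prob (E \<inter> {x \<in> space P. nearest D x a b}) * real (card V) = P.prob E"
proof -
  define N where "N j = E \<inter> {x \<in> space P. nearest D x a j}" for j
  have fin: "finite V" using V finite_subset by blast
  have N: "N j \<in> sets P" for j using a sets_nearest by (auto simp: N_def)
  have eq: "P.prob (N j) = P.prob (N b)" if j: "j \<in> V" for j
  proof -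
    have jb: "j < n" "b < n" "j < a" "b < a" using j b V a by auto
    have "swp j b -` N b \<inter> space P = N j"
      using measurable_space[OF measurable_swp[OF jb(1,2)]] inv j b jb a
      by (auto simp: N_def swap_inv_def nearest_swp)
    then show ?thesis
      using measure_distr[OF measurable_swp[OF jb(1,2)] N, of b] by (simp add: distr_swp[OF jb(1,2)])
  qed
  have disj: "disjoint_family_on N V"
    by (auto simp: disjoint_family_on_def N_def dest: nearest_unique)
  have sum: "P.prob (\<Union>j\<in>V. N j) = P.prob (N b) * real (card V)"
    using P.finite_measure_finite_Union[OF fin _ disj] N eq by (simp add: image_subset_iff)
  have sub: "(\<Union>j\<in>V. N j) \<subseteq> E" by (auto simp: N_def)
  show "P.prob (E \<inter> {x \<in> space P. nearest D x a b}) * real (card V) \<le> P.prob E"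
    using P.finite_measure_mono[OF sub E] sum by (simp add: N_def)
  show "P.prob (E \<inter> {x \<in> space P. nearest D x a b}) * real (card V) = P.prob E" if V': "V = {..<a}"
  proof -
    have UN: "(\<Union>j\<in>V. N j) \<in> sets P" using N fin by auto
    have "P.prob E = P.prob (\<Union>j\<in>V. N j)"
    proof (rule P.finite_measure_eq_AE[OF _ E UN])
      show "AE x in P. x \<in> E \<longleftrightarrow> x \<in> (\<Union>j\<in>V. N j)"
        using AE_ex_nearest AE_space
      proof eventually_elim
        case (elim x)
        obtain b' where "b' < a" "nearest D x a b'"
          using elim(1) a b V by (metis atLeastLessThan_iff gr_implies_not0 lessThan_iff less_one linorder_not_less subset_iff)
        then show ?case using elim(2) V' sub by (auto simp: N_def)
      qed
    qed
    then show ?thesis using sum by (simp add: N_def)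
  qed
qed

end

section \<open>Probabilities of single paths and of pairs of paths\<close>

lemma prod_list_butlast_last:
  fixes f :: "'a \<Rightarrow> 'b::comm_monoid_mult"
  shows "s \<noteq> [] \<Longrightarrow> (\<Prod>a\<leftarrow>s. f a) = (\<Prod>a\<leftarrow>butlast s. f a) * f (last s)"
  by (cases s rule: rev_cases) auto

lemma sorted_wrt_greater_last:
  fixes s :: "nat list"
  assumes "sorted_wrt (>) s"
  shows last_less_butlast: "c \<in> set (butlast s) \<Longrightarrow> last s < c"
    and last_le: "c \<in> set s \<Longrightarrow> last s \<le> c"
  using assms by (cases s rule: rev_cases; force simp: sorted_wrt_append)+

context iid_points begin

text \<open>Equality holds because no earlier step has exposed a point below \<open>last s\<close>:
  the swaps range over all candidates for the next vertex.\<close>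

lemma prob_Path:
  assumes "s \<noteq> []" "sorted_wrt (>) s" "set s \<subseteq> {..<n}"
  shows "P.prob (Path s) = (\<Prod>a\<leftarrow>butlast s. 1 / real a)"
  using assms
proof (induction s rule: rev_induct)
  case (snoc b s)
  show ?case
  proof (cases "s = []")
    case False
    then have l: "last s \<in> set s" by simp
    have sorted: "sorted_wrt (>) s" using snoc.prems by (simp add: sorted_wrt_append)
    have desc: "v < c" if "c \<in> set (butlast s)" "v < last s" for c v
      using last_less_butlast[OF sorted that(1)] that(2) by simp
    have tl: "{..<last s} \<inter> set (tl s) = {}"
      using last_le[OF sorted] False by (fastforce dest: list.set_sel(2))
    have b: "b < last s" "last s < n" using snoc.prems l by (auto simp: sorted_wrt_append)
    have "P.prob (Path (s @ [b])) * real (card {..<last s}) = P.prob (Path s)"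
      unfolding Path_snoc[OF False] using snoc.prems b desc tl
      by (intro prob_nearest_eq) (auto intro!: swap_inv_Path)
    moreover note prod_list_butlast_last[OF False, of "\<lambda>a. 1 / real a"]
    ultimately have "P.prob (Path (s @ [b])) * real (last s) = (\<Prod>a\<leftarrow>s. 1 / real a) * real (last s)"
      using snoc b(2) False gr_implies_not0[OF b(1)] by (simp add: sorted_wrt_append)
    then show ?thesis using b by simp
  qed (simp add: P.prob_space)
qed simp

text \<open>The current vertex of the other path may lie below \<open>last s\<close>. It is exposed,
  as the target of a step or as a starting point, and has to be left out of \<open>V\<close>. One
  candidate is lost, hence the \<open>- 1\<close>. The assumption on \<open>butlast s'\<close> says
  that all steps of the other path start above \<open>last s\<close>, so they are symmetric in the
  remaining points. The event \<open>C\<close> may depend on the two starting points; it will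
  express that they are close.\<close>

lemma prob_snoc_disjoint:
  assumes s: "s \<noteq> []" "sorted_wrt (>) (s @ [b])" "set s \<subseteq> {..<n}"
    and s': "s' \<noteq> []" "sorted_wrt (>) s'" "set s' \<subseteq> {..<n}" "b \<notin> set s'"
    and less: "\<forall>c\<in>set (butlast s'). last s < c" and l: "2 \<le> last s" and l': "last s \<notin> set s'"
    and C: "C \<in> sets P" "swap_inv ({..<n} - {hd s, hd s'}) C"
  shows "P.prob (C \<inter> Path (s @ [b]) \<inter> Path s') \<le> P.prob (C \<inter> Path s \<inter> Path s') / (real (last s) - 1)"
proof -
  define V where "V = {..<last s} - {last s'}"
  have ls: "last s \<in> set s" and b: "b < last s" using s by (auto simp: sorted_wrt_append)
  have lsn: "last s < n" using ls s(3) by blast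
  have Vn: "V \<subseteq> {..<n}" using lsn by (auto simp: V_def)
  have ge: "last s \<le> c" if "c \<in> set s" for c
    using that s(2) by (intro last_le) (auto simp: sorted_wrt_append)
  have inv: "swap_inv V (Path s)"
  proof (rule swap_inv_Path[OF s(3) Vn])
    show "V \<inter> set (tl s) = {}"
      using ge s(1) by (force simp: V_def dest: list.set_sel(2))
    show "\<forall>c\<in>set (butlast s). \<forall>v\<in>V. v < c"
      using ge by (force simp: V_def dest: in_set_butlastD)
  qed
  have gt': "c = last s' \<or> last s < c" if "c \<in> set s'" for c
    using that less s' by (cases s' rule: rev_cases) auto
  have inv': "swap_inv V (Path s')"
  proof (rule swap_inv_Path[OF s'(3) Vn])
    show "V \<inter> set (tl s') = {}"
      using gt' s'(1) by (force simp: V_def dest: list.set_sel(2))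
    show "\<forall>c\<in>set (butlast s'). \<forall>v\<in>V. v < c"
      using less by (force simp: V_def)
  qed
  have "hd s \<notin> V" using ge[of "hd s"] s(1) by (auto simp: V_def)
  moreover have "hd s' \<notin> V" using gt'[of "hd s'"] s'(1) by (auto simp: V_def)
  ultimately have "swap_inv V C"
    using C(2) Vn by (elim swap_inv_mono) auto
  then have invE: "swap_inv V (C \<inter> Path s \<inter> Path s')" using inv inv' by (intro swap_inv_Int)
  have "real (last s) - 1 \<le> real (card V)"
    using l by (simp add: V_def card_Diff_singleton_if)
  then have "P.prob (C \<inter> Path (s @ [b]) \<inter> Path s') * (real (last s) - 1)
      \<le> P.prob (C \<inter> Path (s @ [b]) \<inter> Path s') * real (card V)"
    by (intro mult_left_mono) auto
  also have "\<dots> = P.prob ((C \<inter> Path s \<inter> Path s') \<inter> {x \<in> space P. nearest D x (last s) b}) * real (card V)"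
    using s(1) by (simp add: Path_snoc Int_ac)
  also have "\<dots> \<le> P.prob (C \<inter> Path s \<inter> Path s')"
    using s' s b C lsn invE by (intro prob_nearest_le) (auto simp: V_def)
  finally show ?thesis using l by (simp add: pos_le_divide_eq)
qed

lemma prob_disjoint_Paths:
  assumes "s \<noteq> []" "sorted_wrt (>) s" "set s \<subseteq> {..<n}"
    and "s' \<noteq> []" "sorted_wrt (>) s'" "set s' \<subseteq> {..<n}" "set s \<inter> set s' = {}"
    and "\<forall>a\<in>set (butlast s) \<union> set (butlast s'). 2 \<le> a"
    and "C \<in> sets P" "swap_inv ({..<n} - {hd s, hd s'}) C"
  shows "P.prob (C \<inter> Path s \<inter> Path s')
    \<le> P.prob C * (\<Prod>a\<leftarrow>butlast s. 1 / (real a - 1)) * (\<Prod>a\<leftarrow>butlast s'. 1 / (real a - 1))"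
  using assms
proof (induction "length s + length s'" arbitrary: s s' rule: less_induct)
  case less
  have step: "P.prob (C \<inter> Path (u @ [b]) \<inter> Path t)
      \<le> P.prob C * (\<Prod>a\<leftarrow>u. 1 / (real a - 1)) * (\<Prod>a\<leftarrow>butlast t. 1 / (real a - 1))"
    if u: "u \<noteq> []" "sorted_wrt (>) (u @ [b])" "set u \<subseteq> {..<n}" "\<forall>a\<in>set u. 2 \<le> a"
      and t: "t \<noteq> []" "sorted_wrt (>) t" "set t \<subseteq> {..<n}" "set (u @ [b]) \<inter> set t = {}"
      and C: "C \<in> sets P" "swap_inv ({..<n} - {hd u, hd t}) C"
      and lt: "\<forall>c\<in>set (butlast t). last u < c"
      and IH: "P.prob (C \<inter> Path u \<inter> Path t)
          \<le> P.prob C * (\<Prod>a\<leftarrow>butlast u. 1 / (real a - 1)) * (\<Prod>a\<leftarrow>butlast t. 1 / (real a - 1))"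
    for u t b
  proof -
    have lu: "last u \<in> set u" using u by simp
    then have l2: "2 \<le> last u" and lt': "last u \<notin> set t" using u(4) t(4) by auto
    note pr = prod_list_butlast_last[OF u(1), of "\<lambda>a. 1 / (real a - 1)"]
    have "P.prob (C \<inter> Path (u @ [b]) \<inter> Path t) \<le> P.prob (C \<inter> Path u \<inter> Path t) / (real (last u) - 1)"
      using t by (intro prob_snoc_disjoint u C lt l2 lt' t) auto
    also have "\<dots> \<le> (P.prob C * (\<Prod>a\<leftarrow>butlast u. 1 / (real a - 1)) * (\<Prod>a\<leftarrow>butlast t. 1 / (real a - 1))) / (real (last u) - 1)"
      using l2 by (intro divide_right_mono IH) auto
    finally show ?thesis by (simp add: pr)
  qed
  \<comment> \<open>The step revealed last is the one that starts at the lower of the two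
    penultimate vertices; the induction removes this step.\<close>
  consider i i' where "s = [i]" "s' = [i']"
    | u b where "s = u @ [b]" "u \<noteq> []" "\<forall>c\<in>set (butlast s'). last u < c"
    | u b where "s' = u @ [b]" "u \<noteq> []" "\<forall>c\<in>set (butlast s). last u < c"
  proof -
    obtain u b where u: "s = u @ [b]" using less.prems(1) by (cases s rule: rev_cases) auto
    obtain v c where v: "s' = v @ [c]" using less.prems(4) by (cases s' rule: rev_cases) auto
    have le: "x \<in> set u \<Longrightarrow> last u \<le> x" "x \<in> set v \<Longrightarrow> last v \<le> x" for x
      using less.prems u v by (auto intro: last_le simp: sorted_wrt_append)
    show ?thesis
    proof (cases "u = [] \<or> v = []")
      case True
      then show ?thesis using that u v by fastforce
    next
      case False
      then have "last u \<in> set u" "last v \<in> set v" by auto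
      then have "last u \<noteq> last v" using less.prems(7) u v by auto
      then have "last u < last v \<or> last v < last u" by auto
      then show ?thesis using that(2,3) u v False le by fastforce
    qed
  qed
  then show ?case
  proof cases
    case 1
    then show ?thesis using sets.sets_into_space[OF less.prems(9)] by (simp add: Int_absorb2)
  next
    case (2 u b)
    have "P.prob (C \<inter> Path u \<inter> Path s')
      \<le> P.prob C * (\<Prod>a\<leftarrow>butlast u. 1 / (real a - 1)) * (\<Prod>a\<leftarrow>butlast s'. 1 / (real a - 1))"
      using less.prems 2 by (intro less.hyps) (auto simp: sorted_wrt_append dest: in_set_butlastD)
    then show ?thesis
      using less.prems 2 step[of u b s'] by simp
  next
    case (3 u b)
    have "P.prob (C \<inter> Path s \<inter> Path u)
      \<le> P.prob C * (\<Prod>a\<leftarrow>butlast s. 1 / (real a - 1)) * (\<Prod>a\<leftarrow>butlast u. 1 / (real a - 1))"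
      using less.prems 3 by (intro less.hyps) (auto simp: sorted_wrt_append dest: in_set_butlastD)
    then have "P.prob (C \<inter> Path u \<inter> Path s)
      \<le> P.prob C * (\<Prod>a\<leftarrow>butlast u. 1 / (real a - 1)) * (\<Prod>a\<leftarrow>butlast s. 1 / (real a - 1))"
      by (simp only: Int_assoc Int_commute[of "Path u"] mult.assoc mult.commute[of "\<Prod>a\<leftarrow>butlast u. 1 / (real a - 1)"])
    moreover have "set (u @ [b]) \<inter> set s = {}" "swap_inv ({..<n} - {hd u, hd s}) C"
      using less.prems 3 by (auto simp: insert_commute Int_commute)
    ultimately have "P.prob (C \<inter> Path (u @ [b]) \<inter> Path s)
      \<le> P.prob C * (\<Prod>a\<leftarrow>u. 1 / (real a - 1)) * (\<Prod>a\<leftarrow>butlast s. 1 / (real a - 1))"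
      using less.prems 3 step[of u b s] by simp
    then show ?thesis
      by (simp only: 3(1) butlast_snoc Int_assoc Int_commute[of "Path s"] mult.assoc mult.commute[of "\<Prod>a\<leftarrow>butlast s. 1 / (real a - 1)"])
  qed
qed

text \<open>
  The step that merges the two paths, from the last vertex of \<open>u\<close>, is only bounded by 1; hence the
  correction factor.
\<close>

lemma prob_coalescing_Paths:
  assumes "u \<noteq> []" "u' \<noteq> []" "t \<noteq> []" "sorted_wrt (>) (u @ t)" "sorted_wrt (>) (u' @ t)"
    and "set (u @ t) \<subseteq> {..<n}" "set (u' @ t) \<subseteq> {..<n}" "set u \<inter> set u' = {}" "last u < last u'"
    and "\<forall>a\<in>set u \<union> set u'. 2 \<le> a"
    and "C \<in> sets P" "swap_inv ({..<n} - {hd u, hd u'}) C"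
  shows "P.prob (C \<inter> Path (u @ t) \<inter> Path (u' @ t))
    \<le> P.prob C * (real (last u) - 1) * (\<Prod>a\<leftarrow>u. 1 / (real a - 1)) * (\<Prod>a\<leftarrow>u'. 1 / (real a - 1))
        * (\<Prod>a\<leftarrow>butlast t. 1 / real a)"
  using assms
proof (induction t rule: rev_induct)
  case (snoc b t)
  show ?case
  proof (cases "t = []")
    case True
    have b: "b \<notin> set u" using snoc.prems True by (auto simp: sorted_wrt_append)
    have lu: "2 \<le> last u" using snoc.prems by auto
    note pr = prod_list_butlast_last[OF snoc.prems(1), of "\<lambda>a. 1 / (real a - 1)"]
    have "P.prob (C \<inter> Path (u @ [b]) \<inter> Path (u' @ [b])) \<le> P.prob (C \<inter> Path u \<inter> Path (u' @ [b]))"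
      using snoc.prems True by (intro P.finite_measure_mono sets.Int sets_Path) (auto simp: Path_snoc)
    also have "\<dots> \<le> P.prob C * (\<Prod>a\<leftarrow>butlast u. 1 / (real a - 1)) * (\<Prod>a\<leftarrow>butlast (u' @ [b]). 1 / (real a - 1))"
      using snoc.prems True b
      by (intro prob_disjoint_Paths) (auto simp: sorted_wrt_append dest: in_set_butlastD)
    finally show ?thesis using True lu by (simp add: pr)
  next
    case False
    have desc: "last t < c" if "c \<in> set u \<union> set u' \<union> set (butlast t)" for c
      using that snoc.prems False by (cases t rule: rev_cases) (auto simp: sorted_wrt_append)
    have lt: "last t \<in> set t" using False by simp
    have lastn: "last t < n" "b < last t" using snoc.prems lt by (auto simp: sorted_wrt_append)
    have ge: "last t \<le> c" if "c \<in> set (u @ t) \<union> set (u' @ t)" for c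
      using that desc False by (cases t rule: rev_cases) (auto intro: less_imp_le)
    have inv: "swap_inv {..<last t} (Path (v @ t))" if v: "v = u \<or> v = u'" for v
    proof (rule swap_inv_Path)
      have "set (tl (v @ t)) \<subseteq> set (v @ t)" by (metis list.set_sel(2) subsetI tl_Nil)
      then show "{..<last t} \<inter> set (tl (v @ t)) = {}"
        using ge v by fastforce
      show "\<forall>c\<in>set (butlast (v @ t)). \<forall>w\<in>{..<last t}. w < c"
        using desc v False by (force simp: butlast_append)
    qed (use snoc.prems v lastn in auto)
    note pr = prod_list_butlast_last[OF False, of "\<lambda>a. 1 / real a"]
    have "swap_inv {..<last t} C"
      using snoc.prems(12) by (rule swap_inv_mono)
        (use ge[of "hd u"] ge[of "hd u'"] snoc.prems(1,2) lastn in auto)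
    then have invE: "swap_inv {..<last t} (C \<inter> Path (u @ t) \<inter> Path (u' @ t))"
      using inv by (intro swap_inv_Int) auto
    \<comment> \<open>Below the merger both events prescribe the same step. It is paid for once, and
      by the exact factor \<open>1 / real (last t)\<close>, as no other path exposes a point below
      \<open>last t\<close>.\<close>
    have "C \<inter> Path (u @ t @ [b]) \<inter> Path (u' @ t @ [b]) =
        (C \<inter> Path (u @ t) \<inter> Path (u' @ t)) \<inter> {x \<in> space P. nearest D x (last t) b}"
      using Path_snoc[of "u @ t" b] Path_snoc[of "u' @ t" b] False by auto
    then have "P.prob (C \<inter> Path (u @ t @ [b]) \<inter> Path (u' @ t @ [b])) * real (card {..<last t})
        = P.prob (C \<inter> Path (u @ t) \<inter> Path (u' @ t))"
      using snoc.prems lastn invE by (simp only:) (intro prob_nearest_eq, auto)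
    also have "\<dots> \<le> P.prob C * (real (last u) - 1) * (\<Prod>a\<leftarrow>u. 1 / (real a - 1)) * (\<Prod>a\<leftarrow>u'. 1 / (real a - 1))
        * (\<Prod>a\<leftarrow>butlast t. 1 / real a)"
      using snoc.prems False by (intro snoc.IH) (auto simp: sorted_wrt_append)
    finally show ?thesis
      using False lastn by (simp add: pr field_simps)
  qed
qed simp

end

section \<open>Merging paths and the second moment\<close>

text \<open>Price of replacing \<open>1 / (a - 1)\<close> by \<open>1 / a\<close>: the product of
  \<open>1 / (a - 1)\<close> and \<open>1 - 1 / a\<close> is \<open>1 / a\<close>, and
  \<open>1 - 1 / m\<close> is at most \<open>1 - 1 / a\<close>.\<close>

lemma prod_list_shift_le:
  fixes l :: "nat list"
  assumes "2 \<le> m" "\<forall>a\<in>set l. m \<le> a"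
  shows "(\<Prod>a\<leftarrow>l. 1 / (real a - 1)) * (1 - 1 / real m) ^ length l \<le> (\<Prod>a\<leftarrow>l. 1 / real a)"
    and "0 \<le> (\<Prod>a\<leftarrow>l. 1 / (real a - 1))"
  using assms(2)
proof (induction l)
  case (Cons a l)
  {
    case 1
    then have a: "m \<le> a" "2 \<le> a" using assms(1) by auto
    then have "1 / real a \<le> 1 / real m" using assms(1) by (intro divide_left_mono) auto
    then have "1 / (real a - 1) * (1 - 1 / real m) \<le> 1 / (real a - 1) * (1 - 1 / real a)"
      using a by (intro mult_left_mono) auto
    also have "\<dots> = 1 / real a" using a by (simp add: field_simps)
    finally have "(1 / (real a - 1) * (1 - 1 / real m)) *
        ((\<Prod>a\<leftarrow>l. 1 / (real a - 1)) * (1 - 1 / real m) ^ length l) \<le> 1 / real a * (\<Prod>a\<leftarrow>l. 1 / real a)"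
      using Cons 1 assms(1) a by (intro mult_mono) auto
    then show ?case by (simp add: mult_ac)
  next
    case 2
    then show ?case using Cons assms(1) by simp
  }
qed auto

lemma prod_list_recip_nonneg: "0 \<le> (\<Prod>a\<leftarrow>l. 1 / real a)"
  by (induction l) auto

lemma chains_agree:
  assumes "successively N s" "successively N s'" and N: "\<And>a b c. N a b \<Longrightarrow> N a c \<Longrightarrow> b = c"
    and "s ! r = s' ! r'" "r + j < length s" "r' + j < length s'"
  shows "s ! (r + j) = s' ! (r' + j)"
  using assms(5,6)
proof (induction j)
  case (Suc j)
  then have "N (s ! (r + j)) (s ! (r + Suc j))" "N (s' ! (r' + j)) (s' ! (r' + Suc j))"
    using assms(1,2) by (auto simp: successively_conv_nth)
  then show ?case using Suc N by (metis Suc_lessD add_Suc_right)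
qed (use assms in simp)

text \<open>Both chains reach the range below \<open>m\<close> after exactly \<open>K\<close> steps.
  If they met at positions \<open>r < r'\<close>, the second would arrive below \<open>m\<close>
  while the first, by then at the same vertex, is still at or above \<open>m\<close>.\<close>

lemma chains_same_position:
  assumes "successively N s" "successively N s'" and N: "\<And>a b c. N a b \<Longrightarrow> N a c \<Longrightarrow> b = c"
    and len: "length s = Suc K" "length s' = Suc K"
    and last: "last s < m" "last s' < m" "\<forall>a\<in>set (butlast s) \<union> set (butlast s'). m \<le> (a::nat)"
    and eq: "s ! r = s' ! r'" "r \<le> K" "r' \<le> K"
  shows "r = r'"
proof -
  have *: "\<not> r < r'" if "successively N s" "successively N s'" "length s = Suc K" "length s' = Suc K"
      "last s' < m" "\<forall>a\<in>set (butlast s). m \<le> a" "s ! r = s' ! r'" "r \<le> K" "r' \<le> K" for s s' r r'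
  proof
    assume lt: "r < r'"
    have "s ! (r + (K - r')) = s' ! (r' + (K - r'))"
      using that lt by (intro chains_agree[OF that(1,2) N that(7)]) auto
    moreover have "s' ! (r' + (K - r')) = last s'"
      using that by (subst last_conv_nth) auto
    moreover have "s ! (r + (K - r')) \<in> set (butlast s)"
      using that lt nth_mem[of "r + (K - r')" "butlast s"] by (simp add: nth_butlast)
    ultimately show False using that by fastforce
  qed
  show ?thesis
    using *[of s s' r r'] *[of s' s r' r] assms by (metis UnCI linorder_neqE_nat)
qed

text \<open>Common vertices have equal positions, so \<open>c\<close> can be taken as the least
  common position: below it there is no common vertex, and from it on the chains coincide because
  the next vertex is determined.\<close>

lemma chains_merge:
  assumes "successively N s" "successively N s'" and N: "\<And>a b c. N a b \<Longrightarrow> N a c \<Longrightarrow> b = c"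
    and len: "length s = Suc K" "length s' = Suc K"
    and last: "last s < m" "last s' < m" "\<forall>a\<in>set (butlast s) \<union> set (butlast s'). m \<le> (a::nat)"
    and meet: "set s \<inter> set s' \<noteq> {}"
  obtains c where "c \<le> K" "drop c s = drop c s'" "set (take c s) \<inter> set (take c s') = {}"
proof -
  have same: "r = r'" if "s ! r = s' ! r'" "r \<le> K" "r' \<le> K" for r r'
    by (rule chains_same_position[OF assms(1,2) _ len last that]) (rule N)
  obtain r r' where "s ! r = s' ! r'" "r \<le> K" "r' \<le> K"
    using meet len by (auto simp: in_set_conv_nth less_Suc_eq_le) metis
  then have ex: "\<exists>c. c \<le> K \<and> s ! c = s' ! c" using same[of r r'] by blast
  define c where "c = (LEAST c. c \<le> K \<and> s ! c = s' ! c)"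
  have c: "c \<le> K" "s ! c = s' ! c" using LeastI_ex[OF ex] by (auto simp: c_def)
  have least: "c \<le> r" if "r \<le> K" "s ! r = s' ! r" for r
    using that by (auto simp: c_def intro: Least_le)
  have "drop c s = drop c s'"
  proof (rule nth_equalityI)
    fix i assume "i < length (drop c s)"
    then show "drop c s ! i = drop c s' ! i"
      using chains_agree[OF assms(1,2) _ c(2), of i] N len by auto
  qed (use len in simp)
  moreover have "set (take c s) \<inter> set (take c s') = {}"
  proof (rule ccontr)
    assume "set (take c s) \<inter> set (take c s') \<noteq> {}"
    then obtain r r' where "r < c" "r' < c" "s ! r = s' ! r'"
      using len c by (auto simp: in_set_conv_nth) metis
    then show False using same[of r r'] least[of r] c by auto
  qed
  ultimately show thesis using that c by blast
qed

section \<open>Merging pairs and the second moment method\<close>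

context iid_points begin

text \<open>Up to the merger both paths pay their weights, after it they pay once. The missing
  weight of the merging step leaves a factor \<open>last u\<close>, which the probability that the
  heads are within \<open>R (last u)\<close> reduces to at most \<open>Q\<close>. Only one
  \<open>c\<close> is the merging position, but the sum over all \<open>c\<close> no longer mentions
  it, which allows summation over \<open>s'\<close> for each \<open>c\<close> separately.\<close>

lemma prob_coalescing_pair:
  assumes s: "sorted_wrt (>) s" "length s = Suc K" "set s \<subseteq> {..<n}" "last s < m" "\<forall>a\<in>set (butlast s). m \<le> a"
    and s': "sorted_wrt (>) s'" "length s' = Suc K" "set s' \<subseteq> {..<n}" "last s' < m" "\<forall>a\<in>set (butlast s'). m \<le> a"
    and meet: "set s \<inter> set s' \<noteq> {}" "s \<noteq> s'"
    and m: "2 \<le> m" "2 * K < m" and Bad: "Bad \<in> sets P" and Q: "0 \<le> Q"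
    and close: "\<And>i i' a. i < n \<Longrightarrow> i' < n \<Longrightarrow> i \<noteq> i' \<Longrightarrow> m \<le> a \<Longrightarrow> a < n \<Longrightarrow>
        P.prob {x \<in> space P. D (x i) (x i') \<le> R a} * real a \<le> Q"
    and short: "\<And>x u u' b a. x \<in> space P - Bad \<Longrightarrow> x \<in> Path (u @ [b]) \<Longrightarrow> x \<in> Path (u' @ [b]) \<Longrightarrow>
        u \<noteq> [] \<Longrightarrow> u' \<noteq> [] \<Longrightarrow> length u \<le> K \<Longrightarrow> length u' \<le> K \<Longrightarrow> set u \<union> set u' \<subseteq> {a..<n} \<Longrightarrow> m \<le> a \<Longrightarrow> b < n \<Longrightarrow>
        D (x (hd u)) (x (hd u')) \<le> R a"
  defines "\<rho> \<equiv> 1 / (1 - 2 * real K / real m)"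
  shows "P.prob (Path s \<inter> Path s' - Bad) \<le>
    (\<Sum>c = 1..K. of_bool (drop c s = drop c s') *
        (Q * \<rho> * (\<Prod>a\<leftarrow>butlast s. 1 / real a) * (\<Prod>a\<leftarrow>take c s'. 1 / real a)))"
    (is "_ \<le> (\<Sum>c = 1..K. ?f c)")
proof (cases "Path s \<inter> Path s' - Bad = {}")
  case True
  have "0 \<le> \<rho>" using m by (simp add: \<rho>_def)
  then show ?thesis unfolding True
    using Q by (auto intro!: sum_nonneg mult_nonneg_nonneg prod_list_recip_nonneg)
next
  case False
  then obtain x where x: "x \<in> Path s" "x \<in> Path s'" by auto
  obtain c where c: "c \<le> K" "drop c s = drop c s'" "set (take c s) \<inter> set (take c s') = {}"
  proof (rule chains_merge[of "nearest D x" s s' K m])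
    show "successively (nearest D x) s" "successively (nearest D x) s'"
      using x by (auto simp: Path_def)
    show "\<forall>a\<in>set (butlast s) \<union> set (butlast s'). m \<le> a" using s s' by auto
  qed (use s s' meet in \<open>auto intro: nearest_unique\<close>)
  have c1: "1 \<le> c" using c(2) meet(2) by (cases c) auto
  define u where "u = take c s"
  define u' where "u' = take c s'"
  define t where "t = drop c s"
  have su: "s = u @ t" "s' = u' @ t"
    using append_take_drop_id[of c s] append_take_drop_id[of c s'] c(2) by (simp_all add: u_def u'_def t_def)
  have ne: "u \<noteq> []" "u' \<noteq> []" "t \<noteq> []" using c c1 s s' by (auto simp: u_def u'_def t_def)
  have len: "length u \<le> K" "length u' \<le> K" using c s s' by (auto simp: u_def u'_def)
  have uu: "set u \<inter> set u' = {}" using c by (simp add: u_def u'_def)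
  have ge: "\<forall>a\<in>set u \<union> set u'. m \<le> a"
    using s s' ne by (auto simp: su butlast_append)
  have \<rho>: "(\<Prod>a\<leftarrow>u. 1 / (real a - 1)) * (\<Prod>a\<leftarrow>u'. 1 / (real a - 1))
      \<le> \<rho> * ((\<Prod>a\<leftarrow>u. 1 / real a) * (\<Prod>a\<leftarrow>u'. 1 / real a))" (is "?A \<le> \<rho> * ?B")
  proof -
    have "?A * (1 - 1 / real m) ^ length (u @ u') \<le> ?B"
      using prod_list_shift_le(1)[OF m(1), of "u @ u'"] ge by auto
    \<comment> \<open>At most \<open>2 * K\<close> factors are shifted; Bernoulli's inequality turns
      their joint loss into \<open>\<rho>\<close>.\<close>
    moreover have "1 - 2 * real K / real m \<le> (1 - 1 / real m) ^ length (u @ u')"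
    proof -
      have "real (length (u @ u')) / real m \<le> 2 * real K / real m"
        using len by (intro divide_right_mono) auto
      then show ?thesis
        using Bernoulli_inequality[of "- 1 / real m" "length (u @ u')"] m by simp
    qed
    moreover have "0 \<le> ?A" using prod_list_shift_le(2)[OF m(1)] ge by auto
    ultimately have "?A * (1 - 2 * real K / real m) \<le> ?B"
      by (meson mult_left_mono order_trans)
    moreover have "0 < 1 - 2 * real K / real m" using m by simp
    ultimately show ?thesis by (simp add: \<rho>_def pos_le_divide_eq)
  qed
  have bound: "P.prob (Path (u @ t) \<inter> Path (u' @ t) - Bad)
      \<le> Q * \<rho> * ((\<Prod>a\<leftarrow>u. 1 / real a) * (\<Prod>a\<leftarrow>u'. 1 / real a)) * (\<Prod>a\<leftarrow>butlast t. 1 / real a)"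
    if su: "sorted_wrt (>) (u @ t)" "sorted_wrt (>) (u' @ t)" "set (u @ t) \<subseteq> {..<n}" "set (u' @ t) \<subseteq> {..<n}"
      and ne: "u \<noteq> []" "u' \<noteq> []" and len: "length u \<le> K" "length u' \<le> K"
      and uu: "set u \<inter> set u' = {}" and ge: "\<forall>a\<in>set u \<union> set u'. m \<le> a"
      and \<rho>: "(\<Prod>a\<leftarrow>u. 1 / (real a - 1)) * (\<Prod>a\<leftarrow>u'. 1 / (real a - 1))
        \<le> \<rho> * ((\<Prod>a\<leftarrow>u. 1 / real a) * (\<Prod>a\<leftarrow>u'. 1 / real a))"
      and lt: "last u < last u'"
    for u u' :: "nat list"
  proof -
    \<comment> \<open>\<open>C\<close> takes the place of the complement of \<open>Bad\<close>,
      which involves all points: \<open>C\<close> depends on the two heads only and so is invariant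
      under swaps of all other points.\<close>
    define C where "C = {x \<in> space P. D (x (hd u)) (x (hd u')) \<le> R (last u)}"
    have hd: "hd u \<in> set u" "hd u' \<in> set u'" "last u \<in> set u" using ne by auto
    then have hdn: "hd u < n" "hd u' < n" "last u < n" "hd u \<noteq> hd u'" "m \<le> last u" using su uu ge by auto
    have Cm: "C \<in> sets P" unfolding C_def
      using hdn(1,2) by (intro borel_measurable_le measurable_D_coord) auto
    have inv: "swap_inv ({..<n} - {hd u, hd u'}) C"
      unfolding swap_inv_def
    proof (intro ballI)
      fix j j' x assume *: "j \<in> {..<n} - {hd u, hd u'}" "j' \<in> {..<n} - {hd u, hd u'}" "x \<in> space P"
      then have "swp j j' x \<in> space P" using measurable_space[OF measurable_swp, of j j' x] by auto
      then show "swp j j' x \<in> C \<longleftrightarrow> x \<in> C"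
        using * hdn by (auto simp: C_def swp_def)
    qed
    have "Path (u @ t) \<inter> Path (u' @ t) - Bad \<subseteq> C \<inter> Path (u @ t) \<inter> Path (u' @ t)"
    proof
      fix x assume x: "x \<in> Path (u @ t) \<inter> Path (u' @ t) - Bad"
      obtain b t' where t': "t = b # t'" using \<open>t \<noteq> []\<close> by (cases t) auto
      have x': "x \<in> space P - Bad" "x \<in> Path (u @ [b])" "x \<in> Path (u' @ [b])"
        using x by (auto simp: Path_def t' successively_append_iff)
      have "last u \<le> a" if "a \<in> set u \<union> set u'" for a
        using that lt last_le[of u a] last_le[of u' a] su by (auto simp: sorted_wrt_append)
      then have "D (x (hd u)) (x (hd u')) \<le> R (last u)"
        using su hdn by (intro short[OF x' ne len]) (auto simp: t')
      then show "x \<in> C \<inter> Path (u @ t) \<inter> Path (u' @ t)" using x x' by (auto simp: C_def)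
    qed
    then have "P.prob (Path (u @ t) \<inter> Path (u' @ t) - Bad) \<le> P.prob (C \<inter> Path (u @ t) \<inter> Path (u' @ t))"
      using Cm su by (intro P.finite_measure_mono) auto
    also have "\<dots> \<le> P.prob C * (real (last u) - 1) * (\<Prod>a\<leftarrow>u. 1 / (real a - 1)) * (\<Prod>a\<leftarrow>u'. 1 / (real a - 1))
        * (\<Prod>a\<leftarrow>butlast t. 1 / real a)"
      using ne su uu ge m lt Cm inv \<open>t \<noteq> []\<close> by (intro prob_coalescing_Paths) (auto intro: order_trans)
    also have "\<dots> = P.prob C * (real (last u) - 1) * ((\<Prod>a\<leftarrow>u. 1 / (real a - 1)) * (\<Prod>a\<leftarrow>u'. 1 / (real a - 1)))
        * (\<Prod>a\<leftarrow>butlast t. 1 / real a)"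
      by (simp only: mult.assoc)
    also have "\<dots> \<le> Q * (\<rho> * ((\<Prod>a\<leftarrow>u. 1 / real a) * (\<Prod>a\<leftarrow>u'. 1 / real a))) * (\<Prod>a\<leftarrow>butlast t. 1 / real a)"
    proof (intro mult_right_mono[OF mult_mono[OF _ \<rho>]])
      have "P.prob C * (real (last u) - 1) \<le> P.prob C * real (last u)" by (intro mult_left_mono) auto
      also have "\<dots> \<le> Q" unfolding C_def using hdn by (intro close) auto
      finally show "P.prob C * (real (last u) - 1) \<le> Q" .
      show "0 \<le> (\<Prod>a\<leftarrow>u. 1 / (real a - 1)) * (\<Prod>a\<leftarrow>u'. 1 / (real a - 1))"
        using prod_list_shift_le(2)[OF m(1)] ge by (intro mult_nonneg_nonneg) auto
    qed (auto intro: Q prod_list_recip_nonneg)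
    finally show ?thesis by (simp only: mult.assoc)
  qed
  have neq: "last u \<noteq> last u'" using uu ne by (metis disjoint_iff last_in_set)
  have "P.prob (Path (u @ t) \<inter> Path (u' @ t) - Bad)
      \<le> Q * \<rho> * ((\<Prod>a\<leftarrow>u. 1 / real a) * (\<Prod>a\<leftarrow>u'. 1 / real a)) * (\<Prod>a\<leftarrow>butlast t. 1 / real a)"
  proof (cases "last u" "last u'" rule: linorder_cases)
    case less
    then show ?thesis using s s' ne len uu ge \<rho> by (intro bound) (auto simp: su)
  next
    case greater
    have "P.prob (Path (u' @ t) \<inter> Path (u @ t) - Bad)
      \<le> Q * \<rho> * ((\<Prod>a\<leftarrow>u'. 1 / real a) * (\<Prod>a\<leftarrow>u. 1 / real a)) * (\<Prod>a\<leftarrow>butlast t. 1 / real a)"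
      using s s' ne len uu ge \<rho> greater
      by (intro bound) (auto simp: su mult.commute Int_commute)
    then show ?thesis by (simp add: mult_ac Int_commute)
  qed (use neq in simp)
  also have "\<dots> = ?f c"
  proof -
    have "butlast s = u @ butlast t" using ne by (simp add: su butlast_append)
    moreover have "take c s' = u'" by (simp add: u'_def)
    ultimately show ?thesis using c(2) by (simp add: mult_ac)
  qed
  also have "\<dots> \<le> (\<Sum>c = 1..K. ?f c)"
  proof -
    have "0 \<le> \<rho>" using m by (simp add: \<rho>_def)
    then show ?thesis
      using c c1 Q by (intro member_le_sum) (auto intro!: mult_nonneg_nonneg prod_list_recip_nonneg)
  qed
  finally show ?thesis by (simp add: su)
qed

lemma prob_disjoint_pair:
  assumes s: "sorted_wrt (>) s" "length s = Suc K" "set s \<subseteq> {..<n}" "\<forall>a\<in>set (butlast s). m \<le> a"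
    and s': "sorted_wrt (>) s'" "length s' = Suc K" "set s' \<subseteq> {..<n}" "\<forall>a\<in>set (butlast s'). m \<le> a"
    and disj: "set s \<inter> set s' = {}" and m: "2 \<le> m" "2 * K < m"
  shows "P.prob (Path s \<inter> Path s')
    \<le> 1 / (1 - 2 * real K / real m) * ((\<Prod>a\<leftarrow>butlast s. 1 / real a) * (\<Prod>a\<leftarrow>butlast s'. 1 / real a))"
    (is "_ \<le> _ * ?B")
proof -
  have ne: "s \<noteq> []" "s' \<noteq> []" using s s' by auto
  let ?A = "(\<Prod>a\<leftarrow>butlast s. 1 / (real a - 1)) * (\<Prod>a\<leftarrow>butlast s'. 1 / (real a - 1))"
  have "P.prob (space P \<inter> Path s \<inter> Path s') \<le> P.prob (space P)
      * (\<Prod>a\<leftarrow>butlast s. 1 / (real a - 1)) * (\<Prod>a\<leftarrow>butlast s'. 1 / (real a - 1))"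
    using s s' ne disj m by (intro prob_disjoint_Paths swap_inv_space) auto
  also have "space P \<inter> Path s = Path s" using Path_subset_space by blast
  finally have "P.prob (Path s \<inter> Path s') \<le> ?A" by (simp add: P.prob_space)
  moreover have "?A * (1 - 1 / real m) ^ (2 * K) \<le> ?B"
    using prod_list_shift_le(1)[OF m(1), of "butlast s @ butlast s'"] s s' by (auto simp: mult_2)
  moreover have "1 - 2 * real K / real m \<le> (1 - 1 / real m) ^ (2 * K)"
    using Bernoulli_inequality[of "- 1 / real m" "2 * K"] m by simp
  moreover have "0 \<le> ?A" using prod_list_shift_le(2)[OF m(1)] s s' by auto
  moreover have pos: "0 < 1 - 2 * real K / real m" using m by simp
  ultimately have "P.prob (Path s \<inter> Path s') * (1 - 2 * real K / real m) \<le> ?B"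
    by (meson less_imp_le mult_left_mono mult_right_mono order_trans)
  moreover note pos
  ultimately show ?thesis by (simp add: pos_le_divide_eq)
qed

text \<open>\<open>Z\<close> counts the paths that occur. Its square splits into \<open>Y\<close>,
  the disjoint pairs, and \<open>W\<close>, the pairs that meet. Without a disjoint pair
  \<open>W = Z ^ 2\<close>, and then \<open>(Z - \<mu>) ^ 2 + W\<close> is at least
  \<open>\<mu> ^ 2 / 2\<close>. Its expectation is small compared with \<open>\<mu> ^ 2\<close>,
  since \<open>Y\<close> has mean at most \<open>\<rho> * \<mu> ^ 2\<close> and \<open>W\<close> is
  of lower order off \<open>Bad\<close>.\<close>

lemma second_moment:
  fixes S :: "nat list set"
  assumes fin: "finite S"
    and S: "\<And>s. s \<in> S \<Longrightarrow> sorted_wrt (>) s \<and> length s = Suc K \<and> set s \<subseteq> {..<n} \<and> last s < m \<and> (\<forall>a\<in>set (butlast s). m \<le> a)"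
    and m: "2 \<le> m" "2 * K < m" and Bad: "Bad \<in> sets P" and Q: "0 \<le> Q"
    and heads: "\<And>c. 1 \<le> c \<Longrightarrow> c \<le> K \<Longrightarrow> (\<Sum>h\<in>take c ` S. \<Prod>a\<leftarrow>h. 1 / real a) \<le> G"
    and close: "\<And>i i' a. i < n \<Longrightarrow> i' < n \<Longrightarrow> i \<noteq> i' \<Longrightarrow> m \<le> a \<Longrightarrow> a < n \<Longrightarrow>
        P.prob {x \<in> space P. D (x i) (x i') \<le> R a} * real a \<le> Q"
    and short: "\<And>x u u' b a. x \<in> space P - Bad \<Longrightarrow> x \<in> Path (u @ [b]) \<Longrightarrow> x \<in> Path (u' @ [b]) \<Longrightarrow>
        u \<noteq> [] \<Longrightarrow> u' \<noteq> [] \<Longrightarrow> length u \<le> K \<Longrightarrow> length u' \<le> K \<Longrightarrow> set u \<union> set u' \<subseteq> {a..<n} \<Longrightarrow> m \<le> a \<Longrightarrow> b < n \<Longrightarrow>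
        D (x (hd u)) (x (hd u')) \<le> R a"
  defines "\<rho> \<equiv> 1 / (1 - 2 * real K / real m)"
    and "\<mu> \<equiv> \<Sum>s\<in>S. \<Prod>a\<leftarrow>butlast s. 1 / real a"
  shows "\<mu>\<^sup>2 * P.prob {x \<in> space P. \<forall>s\<in>S. \<forall>s'\<in>S. x \<in> Path s \<longrightarrow> x \<in> Path s' \<longrightarrow> set s \<inter> set s' \<noteq> {}}
    \<le> 4 * (\<rho> - 1) * \<mu>\<^sup>2 + 8 * (\<mu> + Q * \<rho> * real K * \<mu> * G + (real n)\<^sup>2 * P.prob Bad)"
proof -
  let ?w = "\<lambda>s. \<Prod>a\<leftarrow>butlast s. 1 / real a"
  let ?A = "{x \<in> space P. \<forall>s\<in>S. \<forall>s'\<in>S. x \<in> Path s \<longrightarrow> x \<in> Path s' \<longrightarrow> set s \<inter> set s' \<noteq> {}}"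
  define DJ where "DJ = {p \<in> S \<times> S. set (fst p) \<inter> set (snd p) = {}}"
  define CO where "CO = {p \<in> S \<times> S. set (fst p) \<inter> set (snd p) \<noteq> {}}"
  define B where "B p = Path (fst p) \<inter> Path (snd p)" for p
  have finp: "finite DJ" "finite CO" using fin by (auto simp: DJ_def CO_def)
  have Pm: "Path s \<in> sets P" if "s \<in> S" for s using S[OF that] by simp
  have Bm: "B p \<in> sets P" if "p \<in> S \<times> S" for p using Pm that by (auto simp: B_def)
  have DS: "DJ \<subseteq> S \<times> S" "CO \<subseteq> S \<times> S" by (auto simp: DJ_def CO_def)
  have \<rho>0: "0 \<le> \<rho>" using m by (simp add: \<rho>_def)
  define Z where "Z x = (\<Sum>s\<in>S. indicator (Path s) x :: real)" for x
  define Y where "Y x = (\<Sum>p\<in>DJ. indicator (B p) x :: real)" for x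
  define W where "W x = (\<Sum>p\<in>CO. indicator (B p) x :: real)" for x
  define W' where "W' x = (\<Sum>p\<in>CO. indicator (B p - Bad) x :: real)" for x
  have ZZ: "(Z x)\<^sup>2 = Y x + W x" for x
  proof -
    have "(Z x)\<^sup>2 = (\<Sum>p\<in>S \<times> S. indicator (B p) x)"
      unfolding Z_def power2_eq_square sum_product sum.cartesian_product
      by (intro sum.cong) (auto simp: B_def indicator_inter_arith)
    also have "S \<times> S = DJ \<union> CO" by (auto simp: DJ_def CO_def)
    finally show ?thesis
      using finp unfolding Y_def W_def by (subst (asm) sum.union_disjoint) (auto simp: DJ_def CO_def)
  qed
  \<comment> \<open>A path of given length is determined by its head, so at most \<open>n\<close> of
    them occur. This crude bound suffices on \<open>Bad\<close>.\<close>
  have Zn: "Z x \<le> real n" "0 \<le> Z x" for x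
  proof -
    have inj: "inj_on hd {s \<in> S. x \<in> Path s}"
    proof (rule inj_onI)
      fix s s' assume *: "s \<in> {s \<in> S. x \<in> Path s}" "s' \<in> {s \<in> S. x \<in> Path s}" "hd s = hd s'"
      then have l: "length s = Suc K" "length s' = Suc K" using S by auto
      show "s = s'"
      proof (rule nth_equalityI)
        fix i assume "i < length s"
        then show "s ! i = s' ! i"
          using chains_agree[of "nearest D x" s s' 0 0 i, OF _ _ nearest_unique] * l
          by (cases s; cases s') (auto simp: Path_def)
      qed (simp add: l)
    qed
    have "hd ` {s \<in> S. x \<in> Path s} \<subseteq> {..<n}"
      using S by (fastforce simp: length_Suc_conv)
    from card_inj_on_le[OF inj this] have "card {s \<in> S. x \<in> Path s} \<le> n" by simp
    moreover have "Z x = real (card {s \<in> S. x \<in> Path s})"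
      using fin by (simp add: Z_def indicator_def Int_def sum.If_cases)
    ultimately show "Z x \<le> real n" "0 \<le> Z x" by auto
  qed
  have Yn: "0 \<le> Y x" and W0: "0 \<le> W x" for x by (auto simp: Y_def W_def intro!: sum_nonneg)
  have WW': "W x \<le> W' x + (real n)\<^sup>2 * indicator Bad x" for x
  proof (cases "x \<in> Bad")
    case True
    have "W x \<le> (Z x)\<^sup>2" using ZZ[of x] Yn[of x] by simp
    also have "\<dots> \<le> (real n)\<^sup>2" using Zn by (intro power_mono) auto
    finally show ?thesis using True by (simp add: W'_def sum_nonneg add_increasing)
  next
    case False
    then have "W x = W' x" by (auto simp: W_def W'_def indicator_def intro!: sum.cong)
    then show ?thesis using False by simp
  qed
  have EZ: "integrable P Z" "P.expectation Z = \<mu>"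
  proof -
    show "integrable P Z" unfolding Z_def using Pm by (intro Bochner_Integration.integrable_sum integrable_real_indicator) (auto simp: P.emeasure_eq_measure)
    have "P.expectation Z = (\<Sum>s\<in>S. P.prob (Path s))"
      unfolding Z_def using Pm by (subst Bochner_Integration.integral_sum) (auto simp: P.emeasure_eq_measure intro!: sum.cong)
    also have "\<dots> = \<mu>" unfolding \<mu>_def
    proof (intro sum.cong refl)
      fix s assume "s \<in> S"
      then show "P.prob (Path s) = ?w s" using S[of s] by (intro prob_Path) auto
    qed
    finally show "P.expectation Z = \<mu>" .
  qed
  have EY: "integrable P Y" "P.expectation Y \<le> \<rho> * \<mu>\<^sup>2"
  proof -
    show "integrable P Y" unfolding Y_def using Bm DS by (intro Bochner_Integration.integrable_sum integrable_real_indicator) (auto simp: P.emeasure_eq_measure)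
    have "P.expectation Y = (\<Sum>p\<in>DJ. P.prob (B p))"
      unfolding Y_def using Bm DS by (subst Bochner_Integration.integral_sum) (auto simp: P.emeasure_eq_measure intro!: sum.cong)
    also have "\<dots> \<le> (\<Sum>p\<in>DJ. \<rho> * (?w (fst p) * ?w (snd p)))"
    proof (intro sum_mono)
      fix p assume "p \<in> DJ"
      then show "P.prob (B p) \<le> \<rho> * (?w (fst p) * ?w (snd p))"
        unfolding B_def \<rho>_def using S[of "fst p"] S[of "snd p"] m
        by (intro prob_disjoint_pair) (auto simp: DJ_def)
    qed
    also have "\<dots> \<le> (\<Sum>p\<in>S \<times> S. \<rho> * (?w (fst p) * ?w (snd p)))"
      using fin DS \<rho>0 by (intro sum_mono2) (auto intro!: mult_nonneg_nonneg prod_list_recip_nonneg)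
    also have "\<dots> = \<rho> * (\<Sum>s\<in>S. \<Sum>s'\<in>S. ?w s * ?w s')"
      by (simp only: sum.cartesian_product sum_distrib_left[of \<rho>] case_prod_beta')
    also have "\<dots> = \<rho> * \<mu>\<^sup>2"
      by (simp only: \<mu>_def power2_eq_square sum_product)
    finally show "P.expectation Y \<le> \<rho> * \<mu>\<^sup>2" .
  qed
  have EW': "integrable P W'" "P.expectation W' \<le> \<mu> + Q * \<rho> * real K * \<mu> * G"
  proof -
    show "integrable P W'" unfolding W'_def using Bm DS Bad by (intro Bochner_Integration.integrable_sum integrable_real_indicator) (auto simp: P.emeasure_eq_measure)
    let ?f = "\<lambda>s s' c. of_bool (drop c s = drop c s') * (Q * \<rho> * ?w s * (\<Prod>a\<leftarrow>take c s'. 1 / real a))"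
    have f0: "0 \<le> ?f s s' c" for s s' c
      using Q \<rho>0 by (auto intro!: mult_nonneg_nonneg prod_list_recip_nonneg)
    have "P.expectation W' = (\<Sum>p\<in>CO. P.prob (B p - Bad))"
      unfolding W'_def using Bm DS Bad by (subst Bochner_Integration.integral_sum) (auto simp: P.emeasure_eq_measure intro!: sum.cong)
    also have "\<dots> \<le> (\<Sum>p\<in>CO. of_bool (fst p = snd p) * ?w (fst p) + (\<Sum>c = 1..K. ?f (fst p) (snd p) c))"
    proof (intro sum_mono)
      fix p assume p: "p \<in> CO"
      show "P.prob (B p - Bad) \<le> of_bool (fst p = snd p) * ?w (fst p) + (\<Sum>c = 1..K. ?f (fst p) (snd p) c)"
      proof (cases "fst p = snd p")
        case True
        have s: "fst p \<in> S" using p DS by auto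
        have "P.prob (B p - Bad) \<le> P.prob (Path (fst p))"
          using Pm[OF s] by (intro P.finite_measure_mono) (auto simp: B_def)
        also have "\<dots> = ?w (fst p)" using S[OF s] by (intro prob_Path) auto
        finally have "P.prob (B p - Bad) \<le> of_bool (fst p = snd p) * ?w (fst p)"
          using True by simp
        moreover have "0 \<le> (\<Sum>c = 1..K. ?f (fst p) (snd p) c)" by (intro sum_nonneg f0)
        ultimately show ?thesis by linarith
      next
        case False
        have p': "fst p \<in> S" "snd p \<in> S" using p DS by auto
        have "P.prob (Path (fst p) \<inter> Path (snd p) - Bad) \<le> (\<Sum>c = 1..K. ?f (fst p) (snd p) c)"
          unfolding \<rho>_def
        proof (rule prob_coalescing_pair[where m = m and R = R])
          show "set (fst p) \<inter> set (snd p) \<noteq> {}" using p by (auto simp: CO_def)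
          show "D (x (hd u)) (x (hd u')) \<le> R a"
            if "x \<in> space P - Bad" "x \<in> Path (u @ [b])" "x \<in> Path (u' @ [b])" "u \<noteq> []" "u' \<noteq> []"
              "length u \<le> K" "length u' \<le> K" "set u \<union> set u' \<subseteq> {a..<n}" "m \<le> a" "b < n" for x u u' b a
            using that by (rule short)
        qed (use S[OF p'(1)] S[OF p'(2)] False m Bad Q close in auto)
        then show ?thesis using False by (simp add: B_def)
      qed
    qed
    also have "\<dots> \<le> (\<Sum>p\<in>S \<times> S. of_bool (fst p = snd p) * ?w (fst p) + (\<Sum>c = 1..K. ?f (fst p) (snd p) c))"
      using fin DS by (intro sum_mono2 add_nonneg_nonneg sum_nonneg f0 mult_nonneg_nonneg prod_list_recip_nonneg) auto
    also have "\<dots> = (\<Sum>s\<in>S. \<Sum>s'\<in>S. of_bool (s = s') * ?w s + (\<Sum>c = 1..K. ?f s s' c))"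
      by (simp add: sum.cartesian_product case_prod_beta')
    also have "\<dots> \<le> (\<Sum>s\<in>S. ?w s + (\<Sum>c = 1..K. Q * \<rho> * ?w s * G))"
    proof (intro sum_mono)
      fix s assume s: "s \<in> S"
      have "(\<Sum>s'\<in>S. ?f s s' c) \<le> Q * \<rho> * ?w s * G" if c: "c \<in> {1..K}" for c
      proof -
        \<comment> \<open>Once \<open>s\<close> and \<open>c\<close> are fixed, a path with the same
          tail is determined by its first \<open>c\<close> vertices, so the sum runs over heads only
          and is bounded by \<open>G\<close>.\<close>
        define T where "T = {s' \<in> S. drop c s = drop c s'}"
        have inj: "inj_on (take c) T"
          by (rule inj_onI) (auto simp: T_def, metis append_take_drop_id)
        have "(\<Sum>s'\<in>S. ?f s s' c) = (\<Sum>s'\<in>T. Q * \<rho> * ?w s * (\<Prod>a\<leftarrow>take c s'. 1 / real a))"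
          using fin by (intro sum.mono_neutral_cong_right) (auto simp: T_def)
        also have "\<dots> = Q * \<rho> * ?w s * (\<Sum>h\<in>take c ` T. \<Prod>a\<leftarrow>h. 1 / real a)"
          by (simp add: sum.reindex[OF inj] sum_distrib_left)
        also have "\<dots> \<le> Q * \<rho> * ?w s * (\<Sum>h\<in>take c ` S. \<Prod>a\<leftarrow>h. 1 / real a)"
          using fin Q \<rho>0 by (intro mult_left_mono sum_mono2) (auto simp: T_def intro!: mult_nonneg_nonneg prod_list_recip_nonneg)
        also have "\<dots> \<le> Q * \<rho> * ?w s * G"
          using heads[of c] c Q \<rho>0 by (intro mult_left_mono) (auto intro!: mult_nonneg_nonneg prod_list_recip_nonneg)
        finally show ?thesis .
      qed
      then have "(\<Sum>c = 1..K. \<Sum>s'\<in>S. ?f s s' c) \<le> (\<Sum>c = 1..K. Q * \<rho> * ?w s * G)"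
        by (intro sum_mono)
      moreover have "(\<Sum>s'\<in>S. of_bool (s = s') * ?w s) = ?w s"
        using fin s by (subst sum.remove[OF fin s]) (auto intro!: sum.neutral)
      ultimately show "(\<Sum>s'\<in>S. of_bool (s = s') * ?w s + (\<Sum>c = 1..K. ?f s s' c))
          \<le> ?w s + (\<Sum>c = 1..K. Q * \<rho> * ?w s * G)"
        by (subst sum.distrib, subst sum.swap[of _ "{1..K}"]) linarith
    qed
    also have "\<dots> = \<mu> + Q * \<rho> * real K * \<mu> * G"
      by (simp add: \<mu>_def sum.distrib sum_distrib_left sum_distrib_right mult_ac)
    finally show "P.expectation W' \<le> \<mu> + Q * \<rho> * real K * \<mu> * G" .
  qed
  \<comment> \<open>An integrable majorant of \<open>(Z - \<mu>) ^ 2 + W\<close>. The term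
    \<open>W\<close> appears twice, inside \<open>Z ^ 2\<close> and on its own, which accounts for
    the factor 2.\<close>
  define V where "V x = Y x + 2 * (W' x + (real n)\<^sup>2 * indicator Bad x) - 2 * \<mu> * Z x + \<mu>\<^sup>2" for x
  have A: "?A \<in> sets P"
  proof -
    have "?A = space P - (\<Union>p\<in>DJ. B p)" by (auto simp: DJ_def B_def Path_def)
    moreover have "(\<Union>p\<in>DJ. B p) \<in> sets P" using DS Bm finp by (intro sets.finite_UN) auto
    ultimately show ?thesis by (simp only: sets.compl_sets)
  qed
  have intV: "integrable P V" unfolding V_def using EY EW' EZ Bad by (auto simp: P.emeasure_eq_measure)
  have pw: "\<mu>\<^sup>2 * indicator ?A x \<le> 4 * V x" for x
  proof -
    have 1: "(Z x - \<mu>)\<^sup>2 + W x \<le> V x"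
      using WW'[of x] ZZ[of x] W0[of x] by (simp add: V_def power2_diff)
    show ?thesis
    proof (cases "x \<in> ?A")
      case True
      then have "Y x = 0" by (auto simp: Y_def DJ_def B_def indicator_def intro!: sum.neutral)
      then have "W x = (Z x)\<^sup>2" using ZZ by simp
      moreover have "\<mu>\<^sup>2 \<le> 2 * ((Z x - \<mu>)\<^sup>2 + (Z x)\<^sup>2)"
        using zero_le_power2[of "2 * Z x - \<mu>"] by (simp add: power2_eq_square algebra_simps)
      ultimately have "\<mu>\<^sup>2 \<le> 4 * V x" using 1 zero_le_power2[of \<mu>] by argo
      then show ?thesis using True by simp
    next
      case False
      moreover have "0 \<le> V x" using 1 W0[of x] zero_le_power2[of "Z x - \<mu>"] by linarith
      ultimately show ?thesis by simp
    qed
  qed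
  have "\<mu>\<^sup>2 * P.prob ?A = P.expectation (\<lambda>x. \<mu>\<^sup>2 * indicator ?A x)" using A by simp
  also have "\<dots> \<le> P.expectation (\<lambda>x. 4 * V x)"
    using A intV pw by (intro integral_mono) (auto simp: P.emeasure_eq_measure)
  also have "\<dots> = 4 * (P.expectation Y + 2 * (P.expectation W' + (real n)\<^sup>2 * P.prob Bad) - 2 * \<mu> * \<mu> + \<mu>\<^sup>2)"
    using EY EW' EZ Bad by (simp add: V_def P.emeasure_eq_measure P.prob_space)
  also have "\<dots> \<le> 4 * (\<rho> - 1) * \<mu>\<^sup>2 + 8 * (\<mu> + Q * \<rho> * real K * \<mu> * G + (real n)\<^sup>2 * P.prob Bad)"
    using EY(2) EW'(2) by (simp add: algebra_simps power2_eq_square)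
  finally show ?thesis .
qed

end

section \<open>Balls and edges in the torus\<close>

lemma emeasure_lborel_cube:
  fixes a :: "real ^ 'd::finite"
  assumes "0 \<le> t"
  shows "emeasure lborel (cbox a (a + (\<chi> i. t))) = ennreal (t ^ CARD('d))"
    and "emeasure lborel (box a (a + (\<chi> i. t))) = ennreal (t ^ CARD('d))"
proof -
  have *: "(\<chi> i. t) \<bullet> b = t" if "b \<in> Basis" for b :: "real ^ 'd"
    using that by (auto simp: Basis_vec_def inner_axis)
  show "emeasure lborel (cbox a (a + (\<chi> i. t))) = ennreal (t ^ CARD('d))"
    using assms by (subst emeasure_lborel_cbox) (auto simp: inner_add_left * cong: prod.cong)
  show "emeasure lborel (box a (a + (\<chi> i. t))) = ennreal (t ^ CARD('d))"
    using assms by (subst emeasure_lborel_box) (auto simp: inner_add_left * cong: prod.cong)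
qed

locale torus_points =
  fixes n :: nat and d :: "'d::finite itself"
  assumes n_pos: "1 \<le> n"
begin

abbreviation side :: real where "side \<equiv> torus_side d n"

abbreviation shift :: "('d \<Rightarrow> int) \<Rightarrow> real ^ 'd" where
  "shift k \<equiv> side *\<^sub>R (\<chi> i. of_int (k i))"

abbreviation D :: "real ^ 'd \<Rightarrow> real ^ 'd \<Rightarrow> real" where "D \<equiv> torus_dist n"

abbreviation T :: "(real ^ 'd) set" where "T \<equiv> torus n"

definition U :: "(real ^ 'd) measure" where "U = uniform_measure lborel T"

lemma D_eq: "D x y = (INF k. dist x (y + shift k))"
  by (simp add: torus_dist_def torus_side_def)

lemma T_eq: "T = {x. \<forall>i. 0 \<le> x $ i \<and> x $ i < side}"
  by (simp add: torus_def torus_side_def)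

lemma side_pos: "0 < side"
  using n_pos by (simp add: torus_side_def)

lemma side_pow: "side ^ CARD('d) = real n"
  using n_pos by (simp add: torus_side_def)

lemma D_le: "D x y \<le> dist x (y + shift k)"
  unfolding D_eq by (intro cINF_lower bdd_belowI[of _ 0]) auto

text \<open>A shift that is no worse than the zero shift has coordinates bounded by
  \<open>C / side\<close>, so only finitely many compete. Hence a torus distance is always a
  Euclidean distance of two representatives.\<close>

lemma D_attained: "\<exists>k. D x y = dist x (y + shift k)"
proof -
  define f where "f k = dist x (y + shift k)" for k
  define A where "A = {k. f k \<le> f (\<lambda>_. 0)}"
  define C where "C = f (\<lambda>_. 0) + (\<Sum>i\<in>UNIV. \<bar>x $ i - y $ i\<bar>)"
  have "A \<subseteq> (\<Pi>\<^sub>E i\<in>UNIV. {- \<lceil>C / side\<rceil>..\<lceil>C / side\<rceil>})"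
  proof
    fix k assume k: "k \<in> A"
    have "\<bar>of_int (k i)\<bar> \<le> C / side" for i
    proof -
      have "\<bar>(x - (y + shift k)) $ i\<bar> \<le> f k"
        unfolding f_def dist_norm by (rule component_le_norm_cart)
      moreover have "\<bar>x $ i - y $ i\<bar> \<le> (\<Sum>i\<in>UNIV. \<bar>x $ i - y $ i\<bar>)"
        by (intro member_le_sum) auto
      ultimately have "\<bar>side * of_int (k i)\<bar> \<le> C"
        using k by (simp add: A_def C_def)
      then show ?thesis using side_pos by (simp add: field_simps abs_mult)
    qed
    then have "- \<lceil>C / side\<rceil> \<le> k i \<and> k i \<le> \<lceil>C / side\<rceil>" for i
      by (smt (verit, best) le_of_int_ceiling of_int_le_iff of_int_minus)
    then show "k \<in> (\<Pi>\<^sub>E i\<in>UNIV. {- \<lceil>C / side\<rceil>..\<lceil>C / side\<rceil>})" by auto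
  qed
  then have "finite A" by (rule finite_subset) (auto intro: finite_PiE)
  moreover have "(\<lambda>_. 0) \<in> A" by (simp add: A_def)
  ultimately obtain k0 where k0: "k0 \<in> A" "\<forall>k\<in>A. f k0 \<le> f k"
    using ex_is_arg_min_if_finite[of A f] by (auto simp: is_arg_min_linorder)
  have "f k0 \<le> f k" for k
    using k0 by (cases "k \<in> A") (auto simp: A_def)
  then have "(INF k. f k) = f k0"
    by (intro cInf_eq_minimum) auto
  then show ?thesis by (auto simp: D_eq f_def)
qed

lemma D_commute: "D x y = D y x"
proof -
  have "D y x \<le> D x y" for x y
  proof -
    obtain k where "D x y = dist x (y + shift k)" using D_attained by blast
    moreover have "dist y (x + shift (\<lambda>i. - k i)) = dist x (y + shift k)"
    proof -
      have "shift (\<lambda>i. - k i) = - shift k" by (simp add: vec_eq_iff)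
      then show ?thesis by (simp add: dist_norm norm_minus_commute algebra_simps)
    qed
    ultimately show ?thesis using D_le[of y x "\<lambda>i. - k i"] by simp
  qed
  then show ?thesis by (intro antisym)
qed

lemma D_triangle: "D x z \<le> D x y + D y z"
proof -
  obtain k l where k: "D x y = dist x (y + shift k)" and l: "D y z = dist y (z + shift l)"
    using D_attained by blast
  have "shift (\<lambda>i. k i + l i) = shift k + shift l" by (simp add: vec_eq_iff algebra_simps)
  then have "D x z \<le> dist x (z + (shift k + shift l))" using D_le[of x z "\<lambda>i. k i + l i"] by simp
  also have "\<dots> \<le> dist x (y + shift k) + dist (y + shift k) (z + (shift k + shift l))"
    by (rule dist_triangle)
  also have "dist (y + shift k) (z + (shift k + shift l)) = dist y (z + shift l)"
    by (simp add: dist_norm algebra_simps)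
  finally show ?thesis by (simp add: k l)
qed

lemma measurable_D_borel: "case_prod D \<in> borel_measurable (borel \<Otimes>\<^sub>M borel)"
proof -
  have "(\<lambda>p. INF k. dist (fst p) (snd p + shift k)) \<in> borel_measurable (borel \<Otimes>\<^sub>M borel :: ((real ^ 'd) \<times> (real ^ 'd)) measure)"
    by (intro borel_measurable_cINF_real bdd_belowI[of _ 0]) auto
  then show ?thesis by (simp add: D_eq case_prod_beta')
qed

lemma sets_T [measurable]: "T \<in> sets borel"
proof -
  have [measurable]: "(\<lambda>x :: real ^ 'd. x $ i) \<in> borel_measurable borel" for i
    by (intro borel_measurable_continuous_onI continuous_intros)
  have "Measurable.pred borel (\<lambda>x :: real ^ 'd. \<forall>i. 0 \<le> x $ i \<and> x $ i < side)"
    by measurable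
  then show ?thesis by (simp add: T_eq pred_def)
qed

lemma emeasure_T: "emeasure lborel T = ennreal (real n)"
proof (rule antisym)
  have *: "0 \<le> side" using side_pos by simp
  have "T \<subseteq> cbox 0 (0 + (\<chi> i. side))" by (auto simp: T_eq mem_box_cart less_imp_le)
  then have "emeasure lborel T \<le> emeasure lborel (cbox 0 (0 + (\<chi> i. side)) :: (real ^ 'd) set)"
    by (intro emeasure_mono) auto
  also have "\<dots> = ennreal (real n)" unfolding emeasure_lborel_cube(1)[OF *] side_pow ..
  finally show "emeasure lborel T \<le> ennreal (real n)" .
  have "box 0 (0 + (\<chi> i. side)) \<subseteq> T" by (auto simp: T_eq mem_box_cart less_imp_le)
  then have "emeasure lborel (box 0 (0 + (\<chi> i. side)) :: (real ^ 'd) set) \<le> emeasure lborel T"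
    by (intro emeasure_mono) auto
  also have "emeasure lborel (box 0 (0 + (\<chi> i. side)) :: (real ^ 'd) set) = ennreal (real n)"
    unfolding emeasure_lborel_cube(2)[OF *] side_pow ..
  finally show "ennreal (real n) \<le> emeasure lborel T" .
qed

lemma sets_U [measurable_cong, simp]: "sets U = sets borel"
  by (simp add: U_def)

lemma space_U [simp]: "space U = UNIV"
  by (simp add: U_def)

sublocale U: prob_space U
  unfolding U_def using emeasure_T n_pos by (intro prob_space_uniform_measure) auto

lemma measure_U: "A \<in> sets borel \<Longrightarrow> ennreal (measure U A) = emeasure lborel (T \<inter> A) / ennreal (real n)"
  using emeasure_T by (simp add: U.emeasure_eq_measure[symmetric], simp add: U_def)

lemma measure_U_le:
  assumes "A \<in> sets borel" "emeasure lborel (T \<inter> A) \<le> ennreal c" "0 \<le> c"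
  shows "measure U A \<le> c / real n"
proof -
  have "ennreal (measure U A) \<le> ennreal c / ennreal (real n)"
    unfolding measure_U[OF assms(1)] using assms(2) by (intro divide_right_mono_ennreal)
  also have "\<dots> = ennreal (c / real n)" using assms n_pos by (intro divide_ennreal) auto
  finally show ?thesis using assms(3) by (subst (asm) ennreal_le_iff) auto
qed

lemma measure_U_ge:
  assumes "A \<in> sets borel" "ennreal c \<le> emeasure lborel (T \<inter> A)" "0 \<le> c"
  shows "c / real n \<le> measure U A"
proof -
  have "ennreal (c / real n) = ennreal c / ennreal (real n)" using assms n_pos by (intro divide_ennreal[symmetric]) auto
  also have "\<dots> \<le> ennreal (measure U A)"
    unfolding measure_U[OF assms(1)] using assms(2) by (intro divide_right_mono_ennreal)
  finally show ?thesis by (subst (asm) ennreal_le_iff) auto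
qed

lemma sets_D_ball [measurable]: "{z. D y z \<le> R} \<in> sets borel" and sets_D_sphere: "{z. D y z = R} \<in> sets borel"
proof -
  have [measurable]: "D y \<in> borel_measurable borel"
    using measurable_compose[OF measurable_Pair1' measurable_D_borel, of y] by simp
  show "{z. D y z \<le> R} \<in> sets borel" "{z. D y z = R} \<in> sets borel" by measurable
qed

lemma sphere_null: "sphere (c :: real ^ 'd) r \<in> null_sets lborel"
  using negligible_sphere[of c r] by (auto simp: null_sets_completion_iff negligible_iff_null_sets)

sublocale iid_points U n D
proof
  show "case_prod D \<in> borel_measurable (U \<Otimes>\<^sub>M U)"
    using measurable_D_borel by (subst measurable_cong_sets[OF sets_pair_measure_cong[OF sets_U sets_U] refl])
  fix y r
  \<comment> \<open>A torus sphere is covered by Euclidean spheres around the countably many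
    translates of its centre.\<close>
  have "{z. D y z = r} \<subseteq> (\<Union>k. sphere (y - shift k) r)"
  proof
    fix z assume "z \<in> {z. D y z = r}"
    then obtain k where "dist y (z + shift k) = r" using D_attained[of y z] by auto
    then have "z \<in> sphere (y - shift k) r" by (simp add: dist_norm algebra_simps)
    then show "z \<in> (\<Union>k. sphere (y - shift k) r)" by blast
  qed
  moreover have null: "(\<Union>k. sphere (y - shift k) r) \<in> null_sets lborel"
    by (rule null_sets_UN) (rule sphere_null)
  ultimately have "emeasure lborel (T \<inter> {z. D y z = r}) \<le> emeasure lborel (\<Union>k. sphere (y - shift k) r)"
    by (intro emeasure_mono null_setsD2) blast+
  then have "emeasure lborel (T \<inter> {z. D y z = r}) \<le> ennreal 0"
    using null_setsD1[OF null] by simp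
  then have "measure U {z. D y z = r} \<le> 0 / real n"
    by (rule measure_U_le[OF sets_D_sphere]) simp
  then show "measure U {z \<in> space U. D y z = r} = 0" by (simp add: measure_le_0_iff)
qed

text \<open>For \<open>R < side\<close> only shifts with coordinates -1, 0, 1 bring a representative
  within distance \<open>R\<close>. The ball is covered by \<open>3 ^ CARD('d)\<close> cubes with
  edge \<open>2 * R\<close>, whence the 6.\<close>

lemma measure_D_ball_le:
  assumes y: "y \<in> T" and R: "0 \<le> R"
  shows "measure U {z. D y z \<le> R} \<le> (6 * R) ^ CARD('d) / real n"
proof (cases "side \<le> R")
  case True
  have "real n \<le> (6 * R) ^ CARD('d)"
    unfolding side_pow[symmetric] using True side_pos by (intro power_mono) auto
  then have "1 \<le> (6 * R) ^ CARD('d) / real n" using n_pos by simp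
  then show ?thesis using U.prob_le_1 order_trans by blast
next
  case False
  define I where "I = (\<Pi>\<^sub>E i\<in>(UNIV :: 'd set). {-1, 0, 1 :: int})"
  define B where "B k = cbox (y - shift k - (\<chi> i. R)) (y - shift k - (\<chi> i. R) + (\<chi> i. 2 * R))" for k
  have I: "finite I" "card I = 3 ^ CARD('d)"
    by (auto simp: I_def finite_PiE card_PiE numeral_3_eq_3)
  have "T \<inter> {z. D y z \<le> R} \<subseteq> (\<Union>k\<in>I. B k)"
  proof
    fix z assume z: "z \<in> T \<inter> {z. D y z \<le> R}"
    obtain k where k: "D y z = dist y (z + shift k)" using D_attained by blast
    have abs: "\<bar>y $ i - z $ i - side * of_int (k i)\<bar> \<le> R" for i
      using component_le_norm_cart[of "y - (z + shift k)" i] k z by (simp add: dist_norm algebra_simps)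
    have "k i \<in> {-1, 0, 1}" for i
    proof -
      have "0 \<le> y $ i" "y $ i < side" "0 \<le> z $ i" "z $ i < side" using y z by (auto simp: T_eq)
      then have "\<bar>side * of_int (k i)\<bar> < side * 2" using abs[of i] False by linarith
      then have "side * \<bar>of_int (k i)\<bar> < side * 2" by (simp only: abs_mult abs_of_pos[OF side_pos])
      then have "\<bar>of_int (k i) :: real\<bar> < 2" using side_pos by simp
      then have "\<bar>k i\<bar> < 2" by linarith
      then show ?thesis by auto
    qed
    then have "k \<in> I" by (auto simp: I_def)
    moreover have "z \<in> B k"
      unfolding B_def mem_box_cart
    proof
      fix i
      show "(y - shift k - (\<chi> i. R)) $ i \<le> z $ i \<and> z $ i \<le> (y - shift k - (\<chi> i. R) + (\<chi> i. 2 * R)) $ i"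
        using abs[of i] by (simp add: abs_le_iff)
    qed
    ultimately show "z \<in> (\<Union>k\<in>I. B k)" by blast
  qed
  then have "emeasure lborel (T \<inter> {z. D y z \<le> R}) \<le> emeasure lborel (\<Union>k\<in>I. B k)"
    using I by (intro emeasure_mono) (auto simp: B_def)
  also have "\<dots> \<le> (\<Sum>k\<in>I. emeasure lborel (B k))"
    using I by (intro emeasure_subadditive_finite) (auto simp: B_def)
  also have "\<dots> = (\<Sum>k\<in>I. ennreal ((2 * R) ^ CARD('d)))"
    using R by (simp add: B_def emeasure_lborel_cube)
  also have "\<dots> = ennreal (\<Sum>k\<in>I. (2 * R) ^ CARD('d))"
    using R by (subst sum_ennreal) auto
  also have "(\<Sum>k\<in>I. (2 * R) ^ CARD('d)) = (6 * R) ^ CARD('d)"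
    unfolding I of_nat_power sum_constant by (subst power_mult_distrib[symmetric]) simp
  finally show ?thesis using R by (intro measure_U_le) auto
qed

text \<open>The cube with edge \<open>t\<close> extends from \<open>y\<close> towards the middle of
  the torus cube in every coordinate, so it stays in \<open>T\<close> as
  \<open>t \<le> side / 2\<close>. The factor \<open>CARD('d)\<close> comes from bounding the
  Euclidean norm by the sum of the coordinates.\<close>

lemma measure_D_ball_ge:
  assumes y: "y \<in> T" and t: "0 \<le> t" "t \<le> side / 2"
  shows "t ^ CARD('d) / real n \<le> measure U {z. D y z \<le> real CARD('d) * t}"
proof -
  define a where "a = (\<chi> i. if y $ i < side / 2 then y $ i else y $ i - t)"
  have yi: "0 \<le> y $ i" "y $ i < side" for i using y by (auto simp: T_eq)
  have "box a (a + (\<chi> i. t)) \<subseteq> T \<inter> {z. D y z \<le> real CARD('d) * t}"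
  proof
    fix z assume "z \<in> box a (a + (\<chi> i. t))"
    then have z: "a $ i < z $ i \<and> z $ i < a $ i + t" for i by (simp add: mem_box_cart)
    have zi: "0 \<le> z $ i \<and> z $ i < side \<and> \<bar>y $ i - z $ i\<bar> \<le> t" for i
      using z[of i] yi[of i] t by (simp add: a_def split: if_splits)
    have "D y z \<le> dist y (z + shift (\<lambda>_. 0))" by (rule D_le)
    also have "\<dots> = norm (y - z)" by (simp add: dist_norm zero_vec_def[symmetric])
    also have "\<dots> \<le> (\<Sum>i\<in>UNIV. \<bar>(y - z) $ i\<bar>)" by (rule norm_le_l1_cart)
    also have "\<dots> \<le> (\<Sum>i\<in>(UNIV :: 'd set). t)" using zi by (intro sum_mono) simp
    finally show "z \<in> T \<inter> {z. D y z \<le> real CARD('d) * t}" using zi by (simp add: T_eq)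
  qed
  then have "ennreal (t ^ CARD('d)) \<le> emeasure lborel (T \<inter> {z. D y z \<le> real CARD('d) * t})"
    using emeasure_lborel_cube(2)[OF t(1), of a] emeasure_mono[of _ _ lborel]
    by (metis sets.Int sets_D_ball sets_T sets_lborel)
  then show ?thesis using t by (intro measure_U_ge) auto
qed

section \<open>Close pairs of points and long edges\<close>

lemma AE_in_T: "AE x in P. \<forall>i\<in>{..<n}. x i \<in> T"
proof -
  have "AE x in P. x i \<in> T" if i: "i < n" for i
  proof -
    have [measurable]: "(\<lambda>x. x i) \<in> measurable P borel"
      using measurable_coord[OF i] measurable_cong_sets[OF refl sets_U] by blast
    have "P.prob {x \<in> space P. x i \<in> - T} \<le> 0 * P.prob (space P)"
    proof (rule prob_slice[OF i])
      fix x assume "x \<in> space P"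
      then have "{z \<in> space U. x(i := z) \<in> {x \<in> space P. x i \<in> - T}} = - T"
        using i by (auto simp: space_P_upd)
      moreover have "measure U (- T) \<le> 0 / real n"
        by (rule measure_U_le) auto
      ultimately show "measure U {z \<in> space U. x(i := z) \<in> {x \<in> space P. x i \<in> - T}} \<le> 0" by simp
    qed (use i in \<open>auto simp: space_P_upd\<close>)
    then have "P.prob {x \<in> space P. x i \<in> - T} = 0" by (simp add: measure_le_0_iff)
    then show ?thesis by (subst (asm) P.prob_eq_0) (auto elim!: eventually_mono)
  qed
  then show ?thesis by (subst AE_ball_countable) auto
qed

lemma pred_in_T [measurable]: "i < n \<Longrightarrow> {x \<in> space P. x i \<in> T} \<in> sets P"
proof -
  assume i: "i < n"
  have [measurable]: "(\<lambda>x. x i) \<in> measurable P borel"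
    using measurable_coord[OF i] measurable_cong_sets[OF refl sets_U] by blast
  show ?thesis by measurable
qed

lemma prob_close:
  assumes i: "i < n" "i' < n" "i \<noteq> i'" and R: "0 \<le> R"
  shows "P.prob {x \<in> space P. D (x i) (x i') \<le> R} \<le> (6 * R) ^ CARD('d) / real n"
proof -
  define F where "F = {x \<in> space P. x i \<in> T}"
  define E where "E = {x \<in> space P. D (x i) (x i') \<le> R}"
  have F: "F \<in> sets P" unfolding F_def using i by measurable
  have E: "E \<in> sets P" unfolding E_def using i by (intro borel_measurable_le measurable_D_coord) auto
  have "P.prob E = P.prob (F \<inter> E)"
  proof (rule P.finite_measure_eq_AE)
    show "AE x in P. x \<in> E \<longleftrightarrow> x \<in> F \<inter> E"
      using AE_in_T i by (auto elim!: eventually_mono simp: F_def E_def)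
  qed (use E F in auto)
  also have "\<dots> \<le> (6 * R) ^ CARD('d) / real n * P.prob F"
  proof (rule prob_slice[OF i(2)])
    fix x assume x: "x \<in> F"
    then have "{z \<in> space U. x(i' := z) \<in> F \<inter> E} = {z. D (x i) z \<le> R}"
      using i by (auto simp: space_P_upd F_def E_def)
    then show "measure U {z \<in> space U. x(i' := z) \<in> F \<inter> E} \<le> (6 * R) ^ CARD('d) / real n"
      using measure_D_ball_le[OF _ R, of "x i"] x by (simp add: F_def)
  qed (use E F i R in \<open>auto simp: F_def space_P_upd\<close>)
  also have "\<dots> \<le> (6 * R) ^ CARD('d) / real n * 1"
    using R by (intro mult_left_mono) auto
  finally show ?thesis by (simp add: E_def)
qed

text \<open>Given \<open>x j\<close>, each of the \<open>j\<close> earlier points misses the ball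
  around it with probability at most \<open>\<beta>\<close>, independently of the others; finally
  \<open>1 - p \<le> exp (- p)\<close>.\<close>

lemma prob_far:
  assumes j: "j < n" and t: "0 \<le> t" "t \<le> side / 2"
  shows "P.prob {x \<in> space P. x j \<in> T \<and> (\<forall>k<j. real CARD('d) * t < D (x j) (x k))}
    \<le> exp (- real j * (t ^ CARD('d) / real n))"
proof -
  define E where "E l = {x \<in> space P. x j \<in> T \<and> (\<forall>k<l. real CARD('d) * t < D (x j) (x k))}" for l
  define \<beta> where "\<beta> = 1 - t ^ CARD('d) / real n"
  have "t ^ CARD('d) / real n \<le> measure U {z. D (\<chi> i. 0) z \<le> real CARD('d) * t}"
    using side_pos t by (intro measure_D_ball_ge) (auto simp: T_eq)
  then have \<beta>: "0 \<le> \<beta>" using U.prob_le_1 order_trans by (fastforce simp: \<beta>_def)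
  have Em: "E l \<in> sets P" if "l \<le> j" for l
    using that
  proof (induction l)
    case 0
    then show ?case using pred_in_T[OF j] by (simp add: E_def)
  next
    case (Suc l)
    have "{x \<in> space P. real CARD('d) * t < D (x j) (x l)} \<in> sets P"
      using j Suc.prems by (intro borel_measurable_less measurable_D_coord) auto
    moreover have "E (Suc l) = E l \<inter> {x \<in> space P. real CARD('d) * t < D (x j) (x l)}"
      by (auto simp: E_def less_Suc_eq)
    ultimately show ?case using Suc by auto
  qed
  have "P.prob (E l) \<le> \<beta> ^ l" if "l \<le> j" for l
    using that
  proof (induction l)
    case (Suc l)
    have "P.prob (E (Suc l)) \<le> \<beta> * P.prob (E l)"
    proof (rule prob_slice[where i = l])
      fix x z assume "x \<in> space P" "z \<in> space U"
      then show "x(l := z) \<in> E l \<longleftrightarrow> x \<in> E l"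
        using Suc.prems j space_P_upd[of x l z] by (auto simp: E_def)
    next
      fix x assume x: "x \<in> E l"
      then have xT: "x j \<in> T" by (simp add: E_def)
      have "measure U {z \<in> space U. x(l := z) \<in> E (Suc l)} \<le> measure U (space U - {z. D (x j) z \<le> real CARD('d) * t})"
        using x Suc.prems by (intro U.finite_measure_mono) (auto simp: E_def)
      also have "\<dots> = 1 - measure U {z. D (x j) z \<le> real CARD('d) * t}"
        by (intro U.prob_compl) auto
      also have "\<dots> \<le> \<beta>" using measure_D_ball_ge[OF xT t] by (simp add: \<beta>_def)
      finally show "measure U {z \<in> space U. x(l := z) \<in> E (Suc l)} \<le> \<beta>" .
    qed (use Suc.prems Em j \<beta> in \<open>auto simp: E_def\<close>)
    also have "\<dots> \<le> \<beta> * \<beta> ^ l" using Suc \<beta> by (intro mult_left_mono) auto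
    finally show ?case by simp
  qed simp
  then have "P.prob (E j) \<le> \<beta> ^ j" by simp
  also have "\<dots> \<le> exp (- (t ^ CARD('d) / real n)) ^ j"
    using \<beta> exp_ge_add_one_self[of "- (t ^ CARD('d) / real n)"] by (intro power_mono) (auto simp: \<beta>_def)
  also have "\<dots> = exp (- real j * (t ^ CARD('d) / real n))"
    by (simp add: exp_of_nat_mult[symmetric])
  finally show ?thesis by (simp add: E_def)
qed

text \<open>
  The factor 3 makes a given vertex fail with probability at most \<open>n\<^sup>-\<^sup>3\<close>. Some vertex then fails with
  probability at most \<open>n\<^sup>-\<^sup>2\<close>, which offsets the at most \<open>n\<^sup>2\<close> pairs of paths.
\<close>

definition radius :: "nat \<Rightarrow> real" where
  "radius j = root CARD('d) (3 * real n * ln (real n) / real j)"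

lemma radius_nonneg: "0 \<le> radius j"
  using n_pos by (simp add: radius_def)

lemma radius_pow: "radius j ^ CARD('d) = 3 * real n * ln (real n) / real j"
  using n_pos by (simp add: radius_def)

lemma radius_antimono: "0 < a \<Longrightarrow> a \<le> j \<Longrightarrow> radius j \<le> radius a"
  unfolding radius_def using n_pos by (intro real_root_le_mono divide_left_mono) auto

text \<open>This will be the event \<open>Bad\<close> of \<open>second_moment\<close>. It speaks of
  some near earlier point instead of the parent, which is what \<open>prob_far\<close> controls; the
  parent is at least as near.\<close>

definition long_edge :: "nat \<Rightarrow> (nat \<Rightarrow> real ^ 'd) set" where
  "long_edge m = (\<Union>j\<in>{m..<n}. {x \<in> space P. \<not> (x j \<in> T \<and> (\<exists>k<j. D (x j) (x k) \<le> real CARD('d) * radius j))})"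

lemma sets_long_edge: "long_edge m \<in> sets P"
proof -
  have "{x \<in> space P. \<not> (x j \<in> T \<and> (\<exists>k<j. D (x j) (x k) \<le> real CARD('d) * radius j))} \<in> sets P" if j: "j < n" for j
  proof -
    have "{x \<in> space P. D (x j) (x k) \<le> real CARD('d) * radius j} \<in> sets P" if "k < j" for k
      using j that by (intro borel_measurable_le measurable_D_coord) auto
    then have "(\<Union>k\<in>{..<j}. {x \<in> space P. D (x j) (x k) \<le> real CARD('d) * radius j}) \<in> sets P"
      by (intro sets.finite_UN) auto
    moreover have "{x \<in> space P. \<not> (x j \<in> T \<and> (\<exists>k<j. D (x j) (x k) \<le> real CARD('d) * radius j))}
      = space P - ({x \<in> space P. x j \<in> T} \<inter> (\<Union>k\<in>{..<j}. {x \<in> space P. D (x j) (x k) \<le> real CARD('d) * radius j}))"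
      by auto
    ultimately show ?thesis using pred_in_T[OF j] by (simp only:) (intro sets.Diff sets.top sets.Int)
  qed
  then show ?thesis unfolding long_edge_def by (intro sets.finite_UN) auto
qed

lemma prob_long_edge:
  assumes m: "3 * 2 ^ CARD('d) * ln (real n) \<le> real m" "1 \<le> m"
  shows "P.prob (long_edge m) \<le> 1 / (real n)\<^sup>2"
proof -
  let ?A = "\<lambda>j. {x \<in> space P. x j \<in> T \<and> (\<forall>k<j. real CARD('d) * radius j < D (x j) (x k))}"
  have A: "?A j \<in> sets P" "P.prob (?A j) \<le> 1 / real n ^ 3" if j: "j \<in> {m..<n}" for j
  proof -
    have "?A j = {x \<in> space P. x j \<in> T} - (\<Union>k\<in>{..<j}. {x \<in> space P. D (x j) (x k) \<le> real CARD('d) * radius j})"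
      by (auto simp: not_le)
    moreover have "(\<Union>k\<in>{..<j}. {x \<in> space P. D (x j) (x k) \<le> real CARD('d) * radius j}) \<in> sets P"
      using j by (intro sets.finite_UN borel_measurable_le measurable_D_coord) auto
    ultimately show "?A j \<in> sets P" using j by (simp only:) (intro sets.Diff pred_in_T, auto)
    have jp: "0 < real j" using j m by auto
    \<comment> \<open>The lower bound on volumes of balls requires
      \<open>radius j \<le> side / 2\<close>. After taking powers this reads
      \<open>3 * 2 ^ CARD('d) * ln n \<le> j\<close>, the origin of the assumption on
      \<open>m\<close>.\<close>
    have "radius j ^ CARD('d) \<le> (side / 2) ^ CARD('d)"
    proof -
      have "3 * 2 ^ CARD('d) * ln (real n) \<le> real j" using m j by auto
      then have "real n * (3 * 2 ^ CARD('d) * ln (real n)) \<le> real n * real j" by (intro mult_left_mono) auto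
      then show ?thesis
        using jp by (simp add: radius_pow power_divide side_pow field_simps)
    qed
    then have "radius j \<le> side / 2"
      using side_pos by (subst (asm) power_mono_iff) (auto simp: radius_nonneg)
    from prob_far[OF _ radius_nonneg this, of j]
    have "P.prob (?A j) \<le> exp (- real j * (radius j ^ CARD('d) / real n))" using j by auto
    also have "- real j * (radius j ^ CARD('d) / real n) = - (3 * ln (real n))"
      using jp n_pos by (simp add: radius_pow)
    also have "exp (- (3 * ln (real n))) = 1 / real n ^ 3"
      using n_pos exp_of_nat_mult[of 3 "ln (real n)"] by (simp add: exp_minus inverse_eq_divide)
    finally show "P.prob (?A j) \<le> 1 / real n ^ 3" .
  qed
  have UA: "(\<Union>j\<in>{m..<n}. ?A j) \<in> sets P" using A by (intro sets.finite_UN) auto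
  have "P.prob (long_edge m) \<le> P.prob (\<Union>j\<in>{m..<n}. ?A j)"
  proof (rule P.finite_measure_mono_AE[OF _ UA])
    show "AE x in P. x \<in> long_edge m \<longrightarrow> x \<in> (\<Union>j\<in>{m..<n}. ?A j)"
      using AE_in_T by eventually_elim (fastforce simp: long_edge_def not_le)
  qed
  also have "\<dots> \<le> (\<Sum>j\<in>{m..<n}. P.prob (?A j))"
    using A by (intro P.finite_measure_subadditive_finite) auto
  also have "\<dots> \<le> (\<Sum>j\<in>{m..<n}. 1 / real n ^ 3)" by (intro sum_mono A)
  also have "\<dots> \<le> real n * (1 / real n ^ 3)" by simp (intro divide_right_mono, auto)
  also have "\<dots> = 1 / (real n)\<^sup>2" using n_pos by (simp add: power2_eq_square power3_eq_cube)
  finally show ?thesis .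
qed

text \<open>The triangle inequality along the path. Radii decrease with the index, so the lower
  bound \<open>a\<close> on the indices controls every edge.\<close>

lemma path_length_le:
  assumes x: "x \<notin> long_edge m" "x \<in> Path (u @ [b])" and u: "u \<noteq> []" "set u \<subseteq> {a..<n}" "m \<le> a" "1 \<le> a"
  shows "D (x (hd u)) (x b) \<le> real (length u) * (real CARD('d) * radius a)"
  using x(2) u
proof (induction u)
  case (Cons v u)
  have step: "D (x v) (x c) \<le> real CARD('d) * radius a" if c: "nearest D x v c" for c
  proof -
    have v: "a \<le> v" "v < n" using Cons.prems by auto
    have "v \<in> {m..<n}" "x \<in> space P" using v Cons.prems by (auto simp: Path_def)
    then obtain k where k: "k < v" "D (x v) (x k) \<le> real CARD('d) * radius v"
      using x(1) unfolding long_edge_def by blast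
    have "D (x v) (x c) \<le> D (x v) (x k)" using c k by (cases "k = c") (auto simp: nearest_def less_imp_le)
    also note k(2)
    also have "real CARD('d) * radius v \<le> real CARD('d) * radius a"
      using v Cons.prems by (intro mult_left_mono radius_antimono) auto
    finally show ?thesis .
  qed
  show ?case
  proof (cases "u = []")
    case True
    then show ?thesis using Cons.prems step by (simp add: Path_def)
  next
    case False
    have n1: "nearest D x v (hd u)" and P1: "x \<in> Path (u @ [b])"
      using Cons.prems False by (auto simp: Path_def successively_Cons)
    have "D (x v) (x b) \<le> D (x v) (x (hd u)) + D (x (hd u)) (x b)" by (rule D_triangle)
    also have "\<dots> \<le> real CARD('d) * radius a + real (length u) * (real CARD('d) * radius a)"
      using Cons.prems False P1 by (intro add_mono step n1 Cons.IH) auto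
    finally show ?thesis by (simp add: algebra_simps)
  qed
qed simp

text \<open>Two paths with at most \<open>K\<close> edges each, all of length at most
  \<open>CARD('d) * radius a\<close>, connect the heads, hence \<open>R\<close>. In the probability
  that two points are that close, \<open>radius a ^ CARD('d)\<close> yields
  \<open>3 * n * ln n / a\<close>; multiplied by \<open>a / n\<close> this leaves \<open>Q\<close>,
  free of \<open>a\<close> and polylogarithmic when \<open>K\<close> is of order
  \<open>ln n\<close>.\<close>

lemma no_disjoint_pair_le:
  fixes S :: "nat list set"
  assumes fin: "finite S"
    and S: "\<And>s. s \<in> S \<Longrightarrow> sorted_wrt (>) s \<and> length s = Suc K \<and> set s \<subseteq> {..<n} \<and> last s < m \<and> (\<forall>a\<in>set (butlast s). m \<le> a)"
    and m: "2 \<le> m" "2 * K < m" "3 * 2 ^ CARD('d) * ln (real n) \<le> real m"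
    and heads: "\<And>c. 1 \<le> c \<Longrightarrow> c \<le> K \<Longrightarrow> (\<Sum>h\<in>take c ` S. \<Prod>a\<leftarrow>h. 1 / real a) \<le> G"
  defines "\<rho> \<equiv> 1 / (1 - 2 * real K / real m)"
    and "\<mu> \<equiv> \<Sum>s\<in>S. \<Prod>a\<leftarrow>butlast s. 1 / real a"
    and "Q \<equiv> (12 * real K * real CARD('d)) ^ CARD('d) * (3 * ln (real n))"
  shows "\<mu>\<^sup>2 * P.prob {x \<in> space P. \<forall>s\<in>S. \<forall>s'\<in>S. x \<in> Path s \<longrightarrow> x \<in> Path s' \<longrightarrow> set s \<inter> set s' \<noteq> {}}
    \<le> 4 * (\<rho> - 1) * \<mu>\<^sup>2 + 8 * (\<mu> + Q * \<rho> * real K * \<mu> * G + 1)"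
proof -
  define R where "R a = 2 * real K * (real CARD('d) * radius a)" for a
  have R0: "0 \<le> R a" for a by (simp add: R_def radius_nonneg)
  have "\<mu>\<^sup>2 * P.prob {x \<in> space P. \<forall>s\<in>S. \<forall>s'\<in>S. x \<in> Path s \<longrightarrow> x \<in> Path s' \<longrightarrow> set s \<inter> set s' \<noteq> {}}
    \<le> 4 * (\<rho> - 1) * \<mu>\<^sup>2 + 8 * (\<mu> + Q * \<rho> * real K * \<mu> * G + (real n)\<^sup>2 * P.prob (long_edge m))"
    unfolding \<rho>_def \<mu>_def
  proof (rule second_moment[where R = R])
    show "0 \<le> Q" using n_pos by (simp add: Q_def)
    show "P.prob {x \<in> space P. D (x i) (x i') \<le> R a} * real a \<le> Q"
      if i: "i < n" "i' < n" "i \<noteq> i'" "m \<le> a" "a < n" for i i' a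
    proof -
      have "P.prob {x \<in> space P. D (x i) (x i') \<le> R a} * real a \<le> (6 * R a) ^ CARD('d) / real n * real a"
        using i by (intro mult_right_mono prob_close R0) auto
      also have "6 * R a = (12 * real K * real CARD('d)) * radius a" by (simp add: R_def)
      also have "(\<dots>) ^ CARD('d) = (12 * real K * real CARD('d)) ^ CARD('d) * (3 * real n * ln (real n) / real a)"
        by (simp only: power_mult_distrib radius_pow)
      also have "\<dots> / real n * real a = Q" using n_pos i m by (simp add: Q_def)
      finally show ?thesis .
    qed
    show "D (x (hd u)) (x (hd u')) \<le> R a"
      if x: "x \<in> space P - long_edge m" "x \<in> Path (u @ [b])" "x \<in> Path (u' @ [b])" "u \<noteq> []" "u' \<noteq> []"
         "length u \<le> K" "length u' \<le> K" "set u \<union> set u' \<subseteq> {a..<n}" "m \<le> a" "b < n" for x u u' b a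
    proof -
      have "D (x (hd u)) (x b) \<le> real (length u) * (real CARD('d) * radius a)"
        using x m by (intro path_length_le[where m = m]) auto
      also have "\<dots> \<le> real K * (real CARD('d) * radius a)"
        using x by (intro mult_right_mono) (auto simp: radius_nonneg)
      finally have 1: "D (x (hd u)) (x b) \<le> real K * (real CARD('d) * radius a)" .
      have "D (x (hd u')) (x b) \<le> real (length u') * (real CARD('d) * radius a)"
        using x m by (intro path_length_le[where m = m]) auto
      also have "\<dots> \<le> real K * (real CARD('d) * radius a)"
        using x by (intro mult_right_mono) (auto simp: radius_nonneg)
      finally have 2: "D (x b) (x (hd u')) \<le> real K * (real CARD('d) * radius a)" by (simp add: D_commute)
      show ?thesis using D_triangle[of "x (hd u)" "x (hd u')" "x b"] 1 2 by (simp add: R_def)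
    qed
  qed (use fin S m heads sets_long_edge in auto)
  moreover have "(real n)\<^sup>2 * P.prob (long_edge m) \<le> 1"
    using prob_long_edge[OF m(3)] m n_pos by (simp add: field_simps)
  ultimately show ?thesis by argo
qed

end

section \<open>Paths with a prescribed block profile\<close>

definition dec_lists :: "nat \<Rightarrow> nat \<Rightarrow> nat \<Rightarrow> nat list set" where
  "dec_lists k lo hi = {b. sorted_wrt (>) b \<and> length b = k \<and> set b \<subseteq> {lo..<hi}}"

definition path_weight :: "nat list \<Rightarrow> real" where
  "path_weight l = (\<Prod>a\<leftarrow>l. 1 / real a)"

lemma path_weight_simps [simp]:
  "path_weight [] = 1" "path_weight (a # l) = path_weight l / real a"
  "path_weight (l @ l') = path_weight l * path_weight l'"
  by (simp_all add: path_weight_def)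

lemma path_weight_nonneg: "0 \<le> path_weight l"
  by (induction l) auto

lemma finite_dec_lists: "finite (dec_lists k lo hi)"
  by (rule finite_subset[OF _ finite_lists_length_eq[of "{lo..<hi}" k]]) (auto simp: dec_lists_def)

text \<open>Decreasing lists represent \<open>k\<close>-element subsets, so this is the elementary
  symmetric polynomial of degree \<open>k\<close> in the numbers \<open>1 / a\<close> with
  \<open>a\<close> in \<open>{lo..<hi}\<close>.\<close>

definition dec_sum :: "nat \<Rightarrow> nat \<Rightarrow> nat \<Rightarrow> real" where
  "dec_sum k lo hi = (\<Sum>b\<in>dec_lists k lo hi. path_weight b)"

lemma dec_sum_0 [simp]: "dec_sum 0 lo hi = 1"
proof -
  have "dec_lists 0 lo hi = {[]}" by (auto simp: dec_lists_def)
  then show ?thesis by (simp add: dec_sum_def)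
qed

lemma dec_sum_nonneg: "0 \<le> dec_sum k lo hi"
  by (simp add: dec_sum_def sum_nonneg path_weight_nonneg)

lemma dec_sum_mono: "hi \<le> hi' \<Longrightarrow> dec_sum k lo hi \<le> dec_sum k lo hi'"
  unfolding dec_sum_def
  by (intro sum_mono2 finite_dec_lists path_weight_nonneg) (auto simp: dec_lists_def)

lemma dec_sum_Suc: "dec_sum (Suc k) lo hi = (\<Sum>a\<in>{lo..<hi}. dec_sum k lo a / real a)"
proof -
  let ?S = "Sigma {lo..<hi} (dec_lists k lo)"
  have img: "dec_lists (Suc k) lo hi = (\<lambda>(a, b). a # b) ` ?S"
  proof (intro subset_antisym subsetI)
    fix l assume l: "l \<in> dec_lists (Suc k) lo hi"
    then obtain a b where "l = a # b" by (cases l) (auto simp: dec_lists_def)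
    then show "l \<in> (\<lambda>(a, b). a # b) ` ?S"
      using l by (auto simp: dec_lists_def subset_iff intro!: image_eqI[of _ _ "(a, b)"])
  next
    fix l assume "l \<in> (\<lambda>(a, b). a # b) ` ?S"
    then obtain a b where "l = a # b" "a \<in> {lo..<hi}" "b \<in> dec_lists k lo a" by auto
    then show "l \<in> dec_lists (Suc k) lo hi" by (fastforce simp: dec_lists_def)
  qed
  have "inj_on (\<lambda>(a, b). a # b) ?S" by (auto simp: inj_on_def)
  then have "dec_sum (Suc k) lo hi = (\<Sum>(a, b)\<in>?S. path_weight b / real a)"
    unfolding dec_sum_def img by (subst sum.reindex) (auto intro!: sum.cong)
  also have "\<dots> = (\<Sum>a\<in>{lo..<hi}. dec_sum k lo a / real a)"
    using finite_dec_lists by (subst sum.Sigma[symmetric]) (auto simp: dec_sum_def sum_divide_distrib)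
  finally show ?thesis .
qed

lemma dec_sum_le: "dec_sum k lo hi \<le> (\<Sum>a\<in>{lo..<hi}. 1 / real a) ^ k"
proof (induction k)
  case (Suc k)
  have "dec_sum (Suc k) lo hi \<le> (\<Sum>a\<in>{lo..<hi}. dec_sum k lo hi / real a)"
    unfolding dec_sum_Suc by (intro sum_mono divide_right_mono dec_sum_mono) auto
  also have "\<dots> = dec_sum k lo hi * (\<Sum>a\<in>{lo..<hi}. 1 / real a)"
    by (simp add: sum_distrib_left)
  also have "\<dots> \<le> (\<Sum>a\<in>{lo..<hi}. 1 / real a) ^ k * (\<Sum>a\<in>{lo..<hi}. 1 / real a)"
    using Suc by (intro mult_right_mono) (auto intro: sum_nonneg)
  finally show ?case by (simp add: mult.commute)
qed simp

lemma power_Suc_diff_le: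
  fixes x y :: real
  assumes "0 \<le> y" "y \<le> x"
  shows "x ^ Suc k - y ^ Suc k \<le> real (Suc k) * (x - y) * x ^ k"
proof (induction k)
  case (Suc k)
  have "x ^ Suc (Suc k) - y ^ Suc (Suc k) = x * (x ^ Suc k - y ^ Suc k) + (x - y) * y ^ Suc k"
    by (simp add: algebra_simps)
  also have "\<dots> \<le> x * (real (Suc k) * (x - y) * x ^ k) + (x - y) * x ^ Suc k"
    using assms Suc by (intro add_mono mult_left_mono power_mono) auto
  also have "\<dots> = real (Suc (Suc k)) * (x - y) * x ^ Suc k"
    by (simp add: algebra_simps)
  finally show ?case .
qed simp

text \<open>
  The elementary symmetric polynomial of the reciprocals is compared with a power of their sum;
  the shift by \<open>k / lo\<close> pays for the repeated factors, which occur in the power only.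
\<close>

lemma dec_sum_ge:
  assumes lo: "1 \<le> lo" and "lo \<le> hi"
  shows "max 0 ((\<Sum>a\<in>{lo..<hi}. 1 / real a) - real k / real lo) ^ k / fact k \<le> dec_sum k lo hi"
  using assms(2)
proof (induction k arbitrary: hi)
  case (Suc k)
  show ?case
    using Suc.prems
  proof (induction hi rule: dec_induct)
    case base
    then show ?case using dec_sum_nonneg by simp
  next
    case (step hi)
    let ?h = "\<Sum>a\<in>{lo..<hi}. 1 / real a"
    define x where "x = max 0 (?h + 1 / real hi - real (Suc k) / real lo)"
    define y where "y = max 0 (?h - real (Suc k) / real lo)"
    have hl: "1 / real hi \<le> 1 / real lo" using lo step by (intro divide_left_mono) auto
    have "0 \<le> 1 / real hi" by simp
    then have xy: "0 \<le> y" "y \<le> x" "x - y \<le> 1 / real hi" unfolding x_def y_def by linarith+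
    \<comment> \<open>One of the \<open>Suc k\<close> units \<open>1 / lo\<close> in the shift pays
      for the newly added \<open>1 / hi\<close>, which leaves the shift for
      \<open>k\<close>.\<close>
    have xk: "x \<le> max 0 (?h - real k / real lo)"
      using hl by (auto simp: x_def max_def add_divide_distrib)
    have "x ^ Suc k / fact (Suc k) - y ^ Suc k / fact (Suc k) = (x ^ Suc k - y ^ Suc k) / fact (Suc k)"
      by (rule diff_divide_distrib[symmetric])
    also have "\<dots> \<le> (real (Suc k) * (x - y) * x ^ k) / fact (Suc k)"
      using xy by (intro divide_right_mono power_Suc_diff_le) auto
    also have "\<dots> = (x - y) * (x ^ k / fact k)" by simp
    also have "\<dots> \<le> 1 / real hi * (max 0 (?h - real k / real lo) ^ k / fact k)"
      using xy xk by (intro mult_mono divide_right_mono power_mono) auto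
    also have "\<dots> \<le> 1 / real hi * dec_sum k lo hi"
      using Suc.IH step by (intro mult_left_mono) auto
    finally have "x ^ Suc k / fact (Suc k) \<le> y ^ Suc k / fact (Suc k) + dec_sum k lo hi / real hi" by simp
    also have "\<dots> \<le> dec_sum (Suc k) lo hi + dec_sum k lo hi / real hi"
      using step.IH by (simp add: y_def)
    also have "\<dots> = dec_sum (Suc k) lo (Suc hi)"
      using step by (simp add: dec_sum_Suc)
    finally show ?case using step by (simp add: x_def)
  qed
qed simp

lemma sum_recip_ge_ln:
  assumes "1 \<le> lo" "lo \<le> hi"
  shows "ln (real hi) - ln (real lo) \<le> (\<Sum>a\<in>{lo..<hi}. 1 / real a)"
  using assms(2)
proof (induction hi rule: dec_induct)
  case (step hi)
  have hi: "0 < real hi" using assms step(1) by simp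
  then have "real (Suc hi) = (1 + 1 / real hi) * real hi" by (simp add: field_simps)
  then have "ln (real (Suc hi)) - ln (real hi) = ln (1 + 1 / real hi)"
    using hi by (simp only:) (subst ln_mult, auto intro: add_pos_pos)
  also have "\<dots> \<le> 1 / real hi" by (rule ln_add_one_self_le_self) simp
  finally show ?case using step by simp
qed simp

text \<open>Crude compared with \<open>ln M\<close>, but \<open>M\<close> stays fixed as
  \<open>n\<close> grows, so only a constant is lost.\<close>

lemma sum_recip_le:
  assumes "1 \<le> lo"
  shows "(\<Sum>a\<in>{lo..<lo * M}. 1 / real a) \<le> real M"
proof -
  have "(\<Sum>a\<in>{lo..<lo * M}. 1 / real a) \<le> (\<Sum>a\<in>{lo..<lo * M}. 1 / real lo)"
    using assms by (intro sum_mono divide_left_mono) auto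
  also have "\<dots> = real (lo * M - lo) / real lo" by simp
  also have "\<dots> \<le> real (lo * M) / real lo" by (intro divide_right_mono of_nat_mono) auto
  also have "\<dots> = real M" using assms by simp
  finally show ?thesis .
qed

text \<open>
  There are exactly k vertices in each of the blocks \<open>{m * M ^ q..<m * M ^ (q + 1)}\<close>, and one final
  vertex below m. Without such a constraint the second moment is dominated by pairs that share an
  atypically deep ancestor.
\<close>

fun block_paths :: "nat \<Rightarrow> nat \<Rightarrow> nat \<Rightarrow> nat \<Rightarrow> nat list set" where
  "block_paths k M m 0 = (\<lambda>w. [w]) ` {..<m}"
| "block_paths k M m (Suc q) =
    (\<lambda>(b, s). b @ s) ` (dec_lists k (m * M ^ q) (m * M ^ q * M) \<times> block_paths k M m q)"

lemma finite_block_paths: "finite (block_paths k M m L)"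
  by (induction L) (auto intro: finite_dec_lists)

lemma block_paths:
  assumes "s \<in> block_paths k M m L" and "1 \<le> M"
  shows "sorted_wrt (>) s \<and> length s = Suc (k * L) \<and> set s \<subseteq> {..<m * M ^ L} \<and> last s < m
    \<and> (\<forall>a\<in>set (butlast s). m \<le> a)"
  using assms(1)
proof (induction L arbitrary: s)
  case (Suc q)
  obtain b t where s: "s = b @ t" "b \<in> dec_lists k (m * M ^ q) (m * M ^ q * M)" "t \<in> block_paths k M m q"
    using Suc.prems by auto
  note t = Suc.IH[OF s(3)]
  have ne: "t \<noteq> []" using t by auto
  have Mq: "1 \<le> M ^ q" using assms(2) by simp
  have le: "m \<le> m * M ^ q" "m * M ^ q \<le> m * M ^ q * M"
    using mult_le_mono2[OF Mq, of m] mult_le_mono2[OF assms(2), of "m * M ^ q"] by auto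
  have b: "sorted_wrt (>) b" "length b = k" "set b \<subseteq> {m * M ^ q..<m * M ^ q * M}"
    using s by (auto simp: dec_lists_def)
  have "sorted_wrt (>) s" using b t by (force simp: s sorted_wrt_append)
  moreover have "set s \<subseteq> {..<m * M ^ Suc q}"
  proof -
    have "set t \<subseteq> {..<m * M ^ q * M}" using t le(2) by (auto simp: subset_iff intro: less_le_trans)
    then show ?thesis using b by (auto simp: s mult_ac)
  qed
  moreover have "\<forall>a\<in>set (butlast s). m \<le> a"
  proof
    fix a assume "a \<in> set (butlast s)"
    then have "a \<in> set b \<or> a \<in> set (butlast t)" using ne by (auto simp: s butlast_append)
    then show "m \<le> a"
    proof
      assume "a \<in> set b"
      then have "m * M ^ q \<le> a" using b(3) by auto
      then show ?thesis using le(1) by linarith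
    qed (use t in simp)
  qed
  ultimately show ?case using b t ne by (simp add: s)
qed auto

text \<open>Only vertices from which a step is taken carry a weight. The final vertex does not, so
  its \<open>m\<close> choices contribute the factor \<open>m\<close>.\<close>

lemma sum_block_paths:
  assumes "1 \<le> M"
  shows "(\<Sum>s\<in>block_paths k M m L. path_weight (butlast s))
    = real m * (\<Prod>q<L. dec_sum k (m * M ^ q) (m * M ^ q * M))"
proof (induction L)
  case 0
  have "inj_on (\<lambda>w. [w]) {..<m}" by (auto simp: inj_on_def)
  then show ?case by (simp add: sum.reindex)
next
  case (Suc q)
  let ?B = "dec_lists k (m * M ^ q) (m * M ^ q * M)"
  have "inj_on (\<lambda>(b, s). b @ s) (?B \<times> block_paths k M m q)"
    by (auto simp: inj_on_def dec_lists_def)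
  then have "(\<Sum>s\<in>block_paths k M m (Suc q). path_weight (butlast s))
      = (\<Sum>(b, s)\<in>?B \<times> block_paths k M m q. path_weight (butlast (b @ s)))"
    by (simp only: block_paths.simps) (subst sum.reindex, auto intro!: sum.cong)
  also have "\<dots> = (\<Sum>(b, s)\<in>?B \<times> block_paths k M m q. path_weight b * path_weight (butlast s))"
  proof (intro sum.cong refl)
    fix p assume "p \<in> ?B \<times> block_paths k M m q"
    then have "snd p \<noteq> []" using block_paths[OF _ assms, of "snd p" k m q] by auto
    then show "(case p of (b, s) \<Rightarrow> path_weight (butlast (b @ s))) = (case p of (b, s) \<Rightarrow> path_weight b * path_weight (butlast s))"
      by (cases p) (auto simp: butlast_append)
  qed
  also have "\<dots> = dec_sum k (m * M ^ q) (m * M ^ q * M) * (\<Sum>s\<in>block_paths k M m q. path_weight (butlast s))"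
    by (simp add: dec_sum_def sum_product sum.cartesian_product)
  finally show ?case using Suc by (simp add: mult_ac)
qed

text \<open>A prefix fills some blocks and part of at most one more. Full blocks contribute their
  \<open>dec_sum\<close>, the partial one at most \<open>M ^ k\<close>, and blocks not reached can
  be inserted because their \<open>dec_sum\<close> is at least 1. The final vertex is never in the
  prefix, so in contrast to \<open>sum_block_paths\<close> there is no factor
  \<open>m\<close>.\<close>

lemma sum_take_block_paths:
  assumes M: "1 \<le> M" and m: "1 \<le> m" and c: "c \<le> k * L"
    and ge: "\<And>q. 1 \<le> dec_sum k (m * M ^ q) (m * M ^ q * M)"
  shows "(\<Sum>h\<in>take c ` block_paths k M m L. path_weight h)
    \<le> real M ^ k * (\<Prod>q<L. dec_sum k (m * M ^ q) (m * M ^ q * M))"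
  using c
proof (induction L arbitrary: c)
  case 0
  then have "take c ` block_paths k M m 0 = {[]}" using m by (auto simp: image_constant_conv lessThan_empty_iff)
  then show ?case using M by simp
next
  case (Suc q)
  let ?e = "\<lambda>q. dec_sum k (m * M ^ q) (m * M ^ q * M)"
  let ?B = "dec_lists k (m * M ^ q) (m * M ^ q * M)"
  have lo: "1 \<le> m * M ^ q" using M m by simp
  have pr: "1 \<le> (\<Prod>q<L. ?e q)" for L using ge by (intro prod_ge_1) auto
  show ?case
  proof (cases "c \<le> k")
    case True
    have "take c ` block_paths k M m (Suc q) \<subseteq> dec_lists c (m * M ^ q) (m * M ^ q * M)"
    proof -
      have "take c (b @ t) \<in> dec_lists c (m * M ^ q) (m * M ^ q * M)" if "b \<in> ?B" for b t
        using that True by (auto simp: dec_lists_def sorted_wrt_take dest: in_set_takeD)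
      then show ?thesis by auto
    qed
    then have "(\<Sum>h\<in>take c ` block_paths k M m (Suc q). path_weight h) \<le> dec_sum c (m * M ^ q) (m * M ^ q * M)"
      unfolding dec_sum_def by (intro sum_mono2 finite_dec_lists path_weight_nonneg)
    also have "\<dots> \<le> real M ^ c"
      using sum_recip_le[OF lo, of M] by (intro order_trans[OF dec_sum_le] power_mono) (auto intro: sum_nonneg)
    also have "\<dots> \<le> real M ^ k" using True M by (intro power_increasing) auto
    also have "\<dots> \<le> real M ^ k * (\<Prod>q<Suc q. ?e q)"
      using mult_left_mono[OF pr[of "Suc q"], of "real M ^ k"] by simp
    finally show ?thesis .
  next
    case False
    let ?T = "take (c - k) ` block_paths k M m q"
    have sub: "take c ` block_paths k M m (Suc q) \<subseteq> (\<lambda>(b, s). b @ s) ` (?B \<times> ?T)"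
    proof
      fix h assume "h \<in> take c ` block_paths k M m (Suc q)"
      then obtain b s where bs: "b \<in> ?B" "s \<in> block_paths k M m q" "h = take c (b @ s)" by auto
      then have "h = b @ take (c - k) s" using False by (simp add: dec_lists_def)
      then show "h \<in> (\<lambda>(b, s). b @ s) ` (?B \<times> ?T)" using bs by auto
    qed
    have inj: "inj_on (\<lambda>(b, s). b @ s) (?B \<times> ?T)"
      by (auto simp: inj_on_def dec_lists_def)
    have "(\<Sum>h\<in>take c ` block_paths k M m (Suc q). path_weight h)
        \<le> (\<Sum>h\<in>(\<lambda>(b, s). b @ s) ` (?B \<times> ?T). path_weight h)"
      using sub by (intro sum_mono2 path_weight_nonneg finite_imageI finite_cartesian_product finite_dec_lists finite_block_paths)
    also have "\<dots> = (\<Sum>(b, s)\<in>?B \<times> ?T. path_weight b * path_weight s)"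
      by (subst sum.reindex[OF inj]) (auto intro!: sum.cong)
    also have "\<dots> = ?e q * (\<Sum>s\<in>?T. path_weight s)"
      by (simp add: dec_sum_def sum_product sum.cartesian_product)
    also have "\<dots> \<le> ?e q * (real M ^ k * (\<Prod>q<q. ?e q))"
      using Suc.prems False by (intro mult_left_mono Suc.IH dec_sum_nonneg) (auto simp: algebra_simps)
    finally show ?thesis by (simp add: mult_ac)
  qed
qed

text \<open>The condition \<open>k \<le> lo\<close> makes the shift in \<open>dec_sum_ge\<close> at
  most 1, whence \<open>ln M - 1\<close>.\<close>

lemma dec_sum_block_ge_1:
  assumes "1 \<le> lo" "k \<le> lo" "fact k \<le> (ln (real M) - 1) ^ k" "1 \<le> ln (real M)" "1 \<le> M"
  shows "1 \<le> dec_sum k lo (lo * M)"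
proof -
  have "real k / real lo \<le> 1" using assms by simp
  moreover have "ln (real M) \<le> (\<Sum>a\<in>{lo..<lo * M}. 1 / real a)"
    using sum_recip_ge_ln[of lo "lo * M"] assms by (simp add: ln_mult)
  ultimately have "ln (real M) - 1 \<le> max 0 ((\<Sum>a\<in>{lo..<lo * M}. 1 / real a) - real k / real lo)" by linarith
  then have "(ln (real M) - 1) ^ k \<le> max 0 ((\<Sum>a\<in>{lo..<lo * M}. 1 / real a) - real k / real lo) ^ k"
    using assms by (intro power_mono) auto
  then have "1 \<le> max 0 ((\<Sum>a\<in>{lo..<lo * M}. 1 / real a) - real k / real lo) ^ k / fact k"
    using assms(3) by (simp add: le_divide_eq)
  also have "\<dots> \<le> dec_sum k lo (lo * M)" using assms by (intro dec_sum_ge) auto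
  finally show ?thesis .
qed

text \<open>A weak form of Stirling's formula, equivalent by induction to
  \<open>(1 + 1 / k) ^ (k + 1)\<close> being at least \<open>e\<close>. The extra factor
  \<open>k\<close> disappears under the \<open>k\<close>-th root.\<close>

lemma fact_le_power:
  assumes "1 \<le> k"
  shows "fact k \<le> real k ^ Suc k * exp (1 - real k)"
  using assms
proof (induction k rule: dec_induct)
  case (step k)
  have e: "exp 1 * real k ^ Suc k \<le> real (Suc k) ^ Suc k"
  proof -
    have "1 / real (Suc k) \<le> ln (1 + 1 / real k)"
    proof -
      have "ln (1 / (1 + 1 / real k)) \<le> 1 / (1 + 1 / real k) - 1"
        using step by (intro ln_le_minus_one) (auto intro: add_pos_nonneg)
      moreover have "1 / (1 + 1 / real k) - 1 = - 1 / real (Suc k)" using step by (simp add: field_simps)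
      moreover have "ln (1 / (1 + 1 / real k)) = - ln (1 + 1 / real k)" by (simp add: ln_div add_pos_nonneg)
      ultimately show ?thesis by simp
    qed
    then have "1 \<le> real (Suc k) * ln (1 + 1 / real k)" by (simp add: field_simps)
    then have "exp 1 \<le> exp (real (Suc k) * ln (1 + 1 / real k))" by simp
    also have "\<dots> = (1 + 1 / real k) ^ Suc k"
      by (subst exp_of_nat_mult) (simp add: add_pos_nonneg)
    finally have "exp 1 * real k ^ Suc k \<le> (1 + 1 / real k) ^ Suc k * real k ^ Suc k"
      by (intro mult_right_mono) auto
    also have "(1 + 1 / real k) ^ Suc k * real k ^ Suc k = ((1 + 1 / real k) * real k) ^ Suc k"
      by (simp only: power_mult_distrib)
    also have "(1 + 1 / real k) * real k = real (Suc k)"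
      using step(1) by (simp add: field_simps)
    finally show ?thesis .
  qed
  have "fact (Suc k) = real (Suc k) * fact k" by simp
  also have "\<dots> \<le> real (Suc k) * (real k ^ Suc k * exp (1 - real k))"
    using step by (intro mult_left_mono) auto
  also have "\<dots> = real (Suc k) * exp (- real k) * (exp 1 * real k ^ Suc k)"
    by (simp add: exp_diff exp_minus field_simps)
  also have "\<dots> \<le> real (Suc k) * exp (- real k) * real (Suc k) ^ Suc k"
    using e by (intro mult_left_mono) auto
  also have "\<dots> = real (Suc k) ^ Suc (Suc k) * exp (1 - real (Suc k))" by simp
  finally show ?case .
qed simp

section \<open>Depths\<close>

definition root_paths :: "nat \<Rightarrow> nat list set" where
  "root_paths v = {s. s \<noteq> [] \<and> sorted_wrt (>) s \<and> hd s = v \<and> last s = 0}"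

lemma root_paths_0: "root_paths 0 = {[0]}"
proof -
  have "s = [0]" if "s \<in> root_paths 0" for s
    using that by (cases s) (auto simp: root_paths_def)
  then show ?thesis by (auto simp: root_paths_def)
qed

lemma root_paths_rec:
  assumes "0 < v"
  shows "root_paths v = (\<lambda>(w, s). v # s) ` (SIGMA w:{..<v}. root_paths w)"
proof (intro subset_antisym subsetI)
  fix l assume l: "l \<in> root_paths v"
  then obtain s where s: "l = v # s" by (cases l) (auto simp: root_paths_def)
  then have "s \<noteq> []" using l assms by (auto simp: root_paths_def)
  then show "l \<in> (\<lambda>(w, s). v # s) ` (SIGMA w:{..<v}. root_paths w)"
    using l s by (auto simp: root_paths_def intro!: image_eqI[of _ _ "(hd s, s)"])
next
  fix l assume "l \<in> (\<lambda>(w, s). v # s) ` (SIGMA w:{..<v}. root_paths w)"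
  then obtain w s where s: "l = v # s" "w < v" "s \<in> root_paths w" by auto
  then obtain t where "s = w # t" by (cases s) (auto simp: root_paths_def)
  then show "l \<in> root_paths v" using s by (auto simp: root_paths_def)
qed

lemma finite_root_paths: "finite (root_paths v)"
proof (induction v rule: less_induct)
  case (less v)
  then show ?case
    by (cases "v = 0") (auto simp: root_paths_0 root_paths_rec intro!: finite_imageI finite_SigmaI)
qed

lemma root_paths_le: "s \<in> root_paths v \<Longrightarrow> a \<in> set s \<Longrightarrow> a \<le> v"
  by (cases s) (auto simp: root_paths_def)

text \<open>By \<open>prob_Path\<close>, the sum of \<open>t ^ depth\<close> over all possible
  ancestral paths of \<open>v\<close>, weighted by their probabilities: the probability generating
  function of the depth of \<open>v\<close>, as in the random recursive tree.\<close>

definition depth_gf :: "real \<Rightarrow> nat \<Rightarrow> real" where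
  "depth_gf t v = (\<Sum>s\<in>root_paths v. t ^ (length s - 1) * path_weight (butlast s))"

lemma depth_gf_0: "depth_gf t 0 = 1"
  by (simp add: depth_gf_def root_paths_0)

lemma depth_gf_rec:
  assumes "0 < v"
  shows "depth_gf t v = t / real v * (\<Sum>w<v. depth_gf t w)"
proof -
  let ?S = "SIGMA w:{..<v}. root_paths w"
  have inj: "inj_on (\<lambda>(w, s). v # s) ?S" by (auto simp: inj_on_def root_paths_def)
  have "depth_gf t v = (\<Sum>(w, s)\<in>?S. t ^ length s * path_weight (butlast (v # s)))"
    unfolding depth_gf_def root_paths_rec[OF assms] sum.reindex[OF inj] by (intro sum.cong) auto
  also have "\<dots> = (\<Sum>(w, s)\<in>?S. t / real v * (t ^ (length s - 1) * path_weight (butlast s)))"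
  proof (intro sum.cong refl, clarify)
    fix w s assume "s \<in> root_paths w"
    then obtain a u where "s = a # u" by (cases s) (auto simp: root_paths_def)
    then show "t ^ length s * path_weight (butlast (v # s)) = t / real v * (t ^ (length s - 1) * path_weight (butlast s))"
      by simp
  qed
  also have "\<dots> = t / real v * (\<Sum>w<v. depth_gf t w)"
    unfolding depth_gf_def using finite_root_paths
    by (subst sum.Sigma[symmetric]) (auto simp: sum_distrib_left)
  finally show ?thesis .
qed

lemma sum_recip_le_ln:
  assumes "1 \<le> n"
  shows "(\<Sum>j\<in>{1..<Suc n}. 1 / real j) \<le> 1 + ln (real n)"
  using assms
proof (induction n rule: dec_induct)
  case (step n)
  have n: "0 < real n" using step by simp
  have "ln (real n / real (Suc n)) \<le> real n / real (Suc n) - 1" using n by (intro ln_le_minus_one) auto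
  then have "1 / real (Suc n) \<le> ln (real (Suc n)) - ln (real n)"
    using n by (simp add: ln_div field_simps)
  then show ?case using step by simp
qed simp

text \<open>By the recursion, adding vertex \<open>n\<close> multiplies the sum by
  \<open>1 + t / n\<close>, which is at most \<open>exp (t / n)\<close>; the exponents add up to a
  harmonic sum.\<close>

lemma sum_depth_gf_le:
  assumes "0 < t" "1 \<le> n"
  shows "(\<Sum>v<n. depth_gf t v) \<le> exp t * real n powr t"
proof -
  have *: "0 \<le> (\<Sum>v<n. depth_gf t v) \<and> (\<Sum>v<n. depth_gf t v) \<le> exp (t * (\<Sum>j\<in>{1..<n}. 1 / real j))"
    using assms(2)
  proof (induction n rule: dec_induct)
    case base
    then show ?case by (simp add: depth_gf_0)
  next
    case (step n)
    let ?A = "\<Sum>v<n. depth_gf t v"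
    have eq: "(\<Sum>v<Suc n. depth_gf t v) = ?A * (1 + t / real n)"
      using step by (simp add: depth_gf_rec algebra_simps)
    have "?A * (1 + t / real n) \<le> exp (t * (\<Sum>j\<in>{1..<n}. 1 / real j)) * exp (t / real n)"
      using step assms exp_ge_add_one_self[of "t / real n"] by (intro mult_mono) auto
    also have "\<dots> = exp (t * (\<Sum>j\<in>{1..<Suc n}. 1 / real j))"
      using step by (simp add: exp_add[symmetric] algebra_simps)
    finally show ?case unfolding eq using step assms by simp
  qed
  have "(\<Sum>v<n. depth_gf t v) \<le> exp (t * (\<Sum>j\<in>{1..<n}. 1 / real j))" using * by simp
  also have "\<dots> \<le> exp (t * (1 + ln (real n)))"
  proof -
    have "(\<Sum>j\<in>{1..<n}. 1 / real j) \<le> (\<Sum>j\<in>{1..<Suc n}. 1 / real j)" by (intro sum_mono2) auto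
    also have "\<dots> \<le> 1 + ln (real n)" by (rule sum_recip_le_ln) fact
    finally show ?thesis using assms by simp
  qed
  also have "\<dots> = exp t * real n powr t"
    using assms by (simp add: exp_add[symmetric] powr_def algebra_simps)
  finally show ?thesis by simp
qed

section \<open>Depth tails in the nearest neighbour tree\<close>

context torus_points begin

lemma nn_parent_nearest:
  assumes "nearest D x a b"
  shows "nn_parent n x a = b"
  unfolding nn_parent_def
proof (rule Least_equality)
  show "b < a \<and> (\<forall>k<a. D (x a) (x b) \<le> D (x a) (x k))"
    using assms unfolding nearest_def by (metis less_imp_le order_refl)
  fix j assume j: "j < a \<and> (\<forall>k<a. D (x a) (x j) \<le> D (x a) (x k))"
  have "j = b"
    using assms j by (metis nearest_def not_le)
  then show "b \<le> j" by simp
qed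

lemma successively_nn_parent:
  "x \<in> Path s \<Longrightarrow> successively (\<lambda>a b. nn_parent n x a = b) s"
  unfolding Path_def mem_Collect_eq by (elim conjE, erule successively_mono) (rule nn_parent_nearest)

lemma ex_root_path:
  assumes "\<forall>a\<in>{1..<n}. \<exists>b<a. nearest D x a b" "v < n"
  shows "\<exists>s\<in>root_paths v. successively (nearest D x) s"
  using assms(2)
proof (induction v rule: less_induct)
  case (less v)
  show ?case
  proof (cases "v = 0")
    case True
    then show ?thesis by (simp add: root_paths_0)
  next
    case False
    then have "v \<in> {1..<n}" using less.prems by auto
    then obtain b where b: "b < v" "nearest D x v b" using assms(1) by blast
    then obtain s where s: "s \<in> root_paths b" "successively (nearest D x) s"
      using less by (meson less_trans)
    then have "v # s \<in> root_paths v" using b False by (force simp: root_paths_rec)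
    moreover have "successively (nearest D x) (v # s)"
      using s b by (auto simp: successively_Cons root_paths_def)
    ultimately show ?thesis by blast
  qed
qed

lemma prob_depth_le:
  assumes v: "v < n"
  shows "P.prob {x \<in> space P. graph_dist (nn_tree n x) v 0 \<in> H}
    \<le> (\<Sum>s\<in>{s \<in> root_paths v. length s - 1 \<in> H}. path_weight (butlast s))"
proof -
  let ?S = "{s \<in> root_paths v. length s - 1 \<in> H}"
  have fin: "finite ?S" using finite_root_paths by simp
  have sub: "set s \<subseteq> {..<n}" "s \<noteq> []" "sorted_wrt (>) s" "hd s = v" "last s = 0" if "s \<in> root_paths v" for s
    using that root_paths_le[OF that] v by (auto simp: root_paths_def) (meson le_less_trans)
  have m: "Path s \<in> sets P" if "s \<in> ?S" for s using that sub by auto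
  have "P.prob {x \<in> space P. graph_dist (nn_tree n x) v 0 \<in> H} \<le> P.prob (\<Union>s\<in>?S. Path s)"
  proof (rule P.finite_measure_mono_AE)
    show "AE x in P. x \<in> {x \<in> space P. graph_dist (nn_tree n x) v 0 \<in> H} \<longrightarrow> x \<in> (\<Union>s\<in>?S. Path s)"
      using AE_ex_nearest
    proof eventually_elim
      case (elim x)
      obtain s where s: "s \<in> root_paths v" "successively (nearest D x) s"
        using ex_root_path[OF elim v] by auto
      show ?case
      proof
        assume x: "x \<in> {x \<in> space P. graph_dist (nn_tree n x) v 0 \<in> H}"
        then have "x \<in> Path s" using s by (simp add: Path_def)
        moreover from this have "graph_dist (nn_tree n x) (hd s) 0 = length s - 1"
          using sub[OF s(1)] by (intro graph_dist_chain successively_nn_parent) auto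
        ultimately show "x \<in> (\<Union>s\<in>?S. Path s)" using x s sub[OF s(1)] by auto
      qed
    qed
  qed (use m fin in \<open>auto intro!: sets.finite_UN\<close>)
  also have "\<dots> \<le> (\<Sum>s\<in>?S. P.prob (Path s))"
    using fin m by (intro P.finite_measure_subadditive_finite) auto
  also have "\<dots> = (\<Sum>s\<in>?S. path_weight (butlast s))"
    using sub by (intro sum.cong refl) (auto simp: prob_Path path_weight_def)
  finally show ?thesis .
qed

text \<open>Exponential Markov inequality for both tails at once: the assumption on \<open>H\<close>
  holds for depths above \<open>h\<close> if \<open>t \<ge> 1\<close> and for depths below
  \<open>h\<close> if \<open>t \<le> 1\<close>.\<close>

lemma sum_prob_depth_le:
  assumes t: "0 < t" and H: "\<And>l. l \<in> H \<Longrightarrow> t powr h \<le> t ^ l"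
  shows "(\<Sum>v<n. P.prob {x \<in> space P. graph_dist (nn_tree n x) v 0 \<in> H}) \<le> exp t * (real n powr t * t powr (- h))"
proof -
  have "(\<Sum>v<n. P.prob {x \<in> space P. graph_dist (nn_tree n x) v 0 \<in> H}) \<le> (\<Sum>v<n. t powr (- h) * depth_gf t v)"
  proof (intro sum_mono)
    fix v assume "v \<in> {..<n}"
    then have "P.prob {x \<in> space P. graph_dist (nn_tree n x) v 0 \<in> H}
      \<le> (\<Sum>s\<in>{s \<in> root_paths v. length s - 1 \<in> H}. path_weight (butlast s))"
      by (intro prob_depth_le) simp
    also have "\<dots> \<le> (\<Sum>s\<in>{s \<in> root_paths v. length s - 1 \<in> H}. t powr (- h) * (t ^ (length s - 1) * path_weight (butlast s)))"
    proof (intro sum_mono)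
      fix s assume "s \<in> {s \<in> root_paths v. length s - 1 \<in> H}"
      then have "t powr h \<le> t ^ (length s - 1)" by (intro H) simp
      then have "1 \<le> t powr (- h) * t ^ (length s - 1)"
        using t by (simp add: powr_minus field_simps)
      then show "path_weight (butlast s) \<le> t powr (- h) * (t ^ (length s - 1) * path_weight (butlast s))"
        using mult_right_mono[of 1 "t powr (- h) * t ^ (length s - 1)", OF _ path_weight_nonneg, of "butlast s"]
        by (simp only: mult.assoc mult_1_left)
    qed
    also have "\<dots> \<le> (\<Sum>s\<in>root_paths v. t powr (- h) * (t ^ (length s - 1) * path_weight (butlast s)))"
      using t by (intro sum_mono2 finite_root_paths) (auto simp: path_weight_nonneg)
    finally show "P.prob {x \<in> space P. graph_dist (nn_tree n x) v 0 \<in> H} \<le> t powr (- h) * depth_gf t v"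
      by (simp add: depth_gf_def sum_distrib_left)
  qed
  also have "\<dots> = t powr (- h) * (\<Sum>v<n. depth_gf t v)" by (simp add: sum_distrib_left)
  also have "\<dots> \<le> t powr (- h) * (exp t * real n powr t)"
    using t n_pos by (intro mult_left_mono sum_depth_gf_le) auto
  finally show ?thesis by (simp add: mult_ac)
qed

text \<open>The tree depends on the positions only through a finite list of parents. Such lists form
  a countable set, and the positions yielding a given list form a measurable set, whatever
  \<open>Q\<close> is.\<close>

lemma sets_parent_event:
  assumes "\<And>x y. (\<And>i. i \<in> {1..<n} \<Longrightarrow> nn_parent n x i = nn_parent n y i) \<Longrightarrow> Q x = Q y"
  shows "{x \<in> space P. Q x} \<in> sets P"
proof -
  define g where "g x = map (nn_parent n x) [1..<n]" for x :: "nat \<Rightarrow> real ^ 'd"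
  have par: "(\<lambda>x. nn_parent n x i) \<in> measurable P (count_space UNIV)" if i: "i < n" for i
  proof -
    have "Measurable.pred P (\<lambda>x. j < i \<and> (\<forall>k\<in>{..<i}. D (x i) (x j) \<le> D (x i) (x k)))" for j
    proof (cases "j < i")
      case True
      have "Measurable.pred P (\<lambda>x. \<forall>k\<in>{..<i}. D (x i) (x j) \<le> D (x i) (x k))"
      proof (intro pred_intros_finite finite_lessThan)
        fix k assume "k \<in> {..<i}"
        then have "{x \<in> space P. D (x i) (x j) \<le> D (x i) (x k)} \<in> sets P"
          using i True by (intro borel_measurable_le measurable_D_coord) auto
        then show "Measurable.pred P (\<lambda>x. D (x i) (x j) \<le> D (x i) (x k))" by (simp add: pred_def)
      qed
      then show ?thesis using True by simp
    qed simp
    then have "(\<lambda>x. LEAST j. j < i \<and> (\<forall>k\<in>{..<i}. D (x i) (x j) \<le> D (x i) (x k))) \<in> measurable P (count_space UNIV)"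
      by (rule measurable_Least)
    moreover have "nn_parent n x i = (LEAST j. j < i \<and> (\<forall>k\<in>{..<i}. D (x i) (x j) \<le> D (x i) (x k)))" for x
      by (simp add: nn_parent_def Ball_def)
    ultimately show ?thesis by presburger
  qed
  have lev: "{x \<in> space P. g x = l} \<in> sets P" for l
  proof (cases "length l = n - 1")
    case True
    have "{x \<in> space P. g x = l} = {x \<in> space P. \<forall>i\<in>{..<n - 1}. nn_parent n x (Suc i) = l ! i}"
      using True by (auto simp: g_def list_eq_iff_nth_eq)
    also have "\<dots> \<in> sets P"
    proof (intro sets.sets_Collect_finite_All)
      fix i assume "i \<in> {..<n - 1}"
      then have "(\<lambda>x. nn_parent n x (Suc i)) -` {l ! i} \<inter> space P \<in> sets P"
        by (intro measurable_sets[OF par]) auto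
      then show "{x \<in> space P. nn_parent n x (Suc i) = l ! i} \<in> sets P"
        by (simp add: vimage_def Int_def conj_commute)
    qed simp
    finally show ?thesis .
  next
    case False
    then have "{x \<in> space P. g x = l} = {}" by (auto simp: g_def)
    then show ?thesis by (simp only: sets.empty_sets)
  qed
  have eq: "{x \<in> space P. Q x} = (\<Union>l\<in>g ` {x \<in> space P. Q x}. {x \<in> space P. g x = l})"
  proof (intro subset_antisym subsetI)
    fix x assume "x \<in> (\<Union>l\<in>g ` {x \<in> space P. Q x}. {x \<in> space P. g x = l})"
    then obtain y where y: "Q y" "x \<in> space P" "g x = g y" by auto
    have "nn_parent n x i = nn_parent n y i" if "i \<in> {1..<n}" for i
      using y(3) that by (auto simp: g_def)
    then show "x \<in> {x \<in> space P. Q x}" using assms[of x y] y by simp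
  qed auto
  show ?thesis
  proof (subst eq, rule sets.countable_UN')
    show "countable (g ` {x \<in> space P. Q x})" by (rule countable_subset[OF subset_UNIV]) simp
  qed (rule image_subsetI, rule lev)
qed

lemma nn_tree_cong:
  "(\<And>i. i \<in> {1..<n} \<Longrightarrow> nn_parent n x i = nn_parent n y i) \<Longrightarrow> nn_tree n x = nn_tree n y"
  unfolding nn_tree_def by (rule SUP_cong) simp_all

lemma sets_tree_event: "{x \<in> space P. Q (nn_tree n x)} \<in> sets P"
proof (rule sets_parent_event)
  fix x y :: "nat \<Rightarrow> real ^ 'd"
  assume "\<And>i. i \<in> {1..<n} \<Longrightarrow> nn_parent n x i = nn_parent n y i"
  then have "nn_tree n x = nn_tree n y" by (rule nn_tree_cong)
  then show "Q (nn_tree n x) = Q (nn_tree n y)" by simp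
qed

lemma nn_space_eq: "nn_space n = P \<Otimes>\<^sub>M uniform_count_measure {..<n}"
  by (simp only: nn_space_def P_def) (simp only: U_def)

text \<open>Turns the uniformly chosen vertex into an average over fixed vertices, which is how the
  tail sums are used. For an event about the tree alone, all \<open>n\<close> terms agree.\<close>

lemma measure_nn_space:
  "measure (nn_space n :: ((nat \<Rightarrow> real ^ 'd) \<times> nat) measure) {p \<in> space (nn_space n). case p of (x, v) \<Rightarrow> Q (nn_tree n x) v}
    = (\<Sum>v<n. P.prob {x \<in> space P. Q (nn_tree n x) v}) / real n"
proof -
  let ?C = "uniform_count_measure {..<n}"
  interpret C: prob_space ?C
    using n_pos by (intro prob_space_uniform_count_measure) (auto simp: lessThan_empty_iff)
  interpret PC: pair_prob_space P ?C ..
  define A where "A v = {x \<in> space P. Q (nn_tree n x) v} \<times> {v}" for v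
  have A: "A v \<in> sets (P \<Otimes>\<^sub>M ?C)" if "v < n" for v
    unfolding A_def using that by (intro pair_measureI sets_tree_event) (auto simp: sets_uniform_count_measure)
  have mA: "measure (P \<Otimes>\<^sub>M ?C) (A v) = P.prob {x \<in> space P. Q (nn_tree n x) v} / real n" if v: "v < n" for v
  proof -
    have "emeasure (P \<Otimes>\<^sub>M ?C) (A v) = emeasure P {x \<in> space P. Q (nn_tree n x) v} * emeasure ?C {v}"
      unfolding A_def using v by (intro C.emeasure_pair_measure_Times sets_tree_event) (auto simp: sets_uniform_count_measure)
    also have "emeasure ?C {v} = ennreal (1 / real n)"
      using v n_pos by (subst emeasure_uniform_count_measure) (auto simp: divide_ennreal)
    finally have "emeasure (P \<Otimes>\<^sub>M ?C) (A v) = ennreal (P.prob {x \<in> space P. Q (nn_tree n x) v} / real n)"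
      by (simp add: P.emeasure_eq_measure ennreal_mult'[symmetric])
    then show ?thesis by (rule measure_eq_emeasure_eq_ennreal[rotated]) simp
  qed
  have "{p \<in> space (nn_space n :: ((nat \<Rightarrow> real ^ 'd) \<times> nat) measure). case p of (x, v) \<Rightarrow> Q (nn_tree n x) v} = (\<Union>v\<in>{..<n}. A v)"
    by (auto simp: nn_space_eq space_pair_measure space_uniform_count_measure A_def)
  moreover have "measure (P \<Otimes>\<^sub>M ?C) (\<Union>v\<in>{..<n}. A v) = (\<Sum>v<n. measure (P \<Otimes>\<^sub>M ?C) (A v))"
    using A by (intro PC.P.finite_measure_finite_Union) (auto simp: disjoint_family_on_def A_def)
  ultimately show ?thesis
    using mA by (simp add: nn_space_eq sum_divide_distrib)
qed

end

section \<open>Asymptotics\<close>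

text \<open>Positivity of the Poisson rate function \<open>t * ln t - t + 1\<close> away from 1: the
  exponent of \<open>n\<close> in the tail bounds for the typical depth is negative.\<close>

lemma ln_gt_recip:
  fixes t :: real
  assumes "0 < t" "t \<noteq> 1"
  shows "t - 1 < t * ln t"
proof -
  have "ln (1 / t) \<noteq> 1 / t - 1" using ln_eq_minus_one[of "1 / t"] assms by auto
  moreover have "ln (1 / t) \<le> 1 / t - 1" using assms by (intro ln_le_minus_one) auto
  ultimately have "ln (1 / t) < 1 / t - 1" by simp
  then have "- ln t < 1 / t - 1" using assms by (simp add: ln_div)
  then have "t * (- ln t) < t * (1 / t - 1)" using assms by (intro mult_strict_left_mono) auto
  then show ?thesis using assms by (simp add: algebra_simps)
qed

text \<open>As \<open>k\<close> grows, \<open>y k\<close> is asymptotic to \<open>k / e\<close>.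
  Since \<open>ln M\<close> lies between \<open>y k + 1\<close> and \<open>y k + 2\<close>, the
  ratio \<open>k / ln M\<close> comes arbitrarily close to \<open>e\<close>, while each block still
  has expected count at least 1.\<close>

lemma ex_block_profile:
  assumes "c < exp 1"
  shows "\<exists>k M. 1 \<le> k \<and> 1 \<le> M \<and> 1 \<le> ln (real M) \<and> fact k \<le> (ln (real M) - 1) ^ k \<and> c * ln (real M) < real k"
proof -
  \<comment> \<open>Chosen such that \<open>y k ^ k\<close> is exactly the bound of
    \<open>fact_le_power\<close>.\<close>
  define y where "y k = real k / exp 1 * exp ((1 + ln (real k)) / real k)" for k :: nat
  have "((\<lambda>k :: nat. real k / (y k + 2)) \<longlongrightarrow> exp 1) sequentially"
    unfolding y_def by real_asymp
  then have "eventually (\<lambda>k. c < real k / (y k + 2)) sequentially"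
    using assms by (rule order_tendstoD)
  then obtain k where k: "1 \<le> k" "c < real k / (y k + 2)"
    using eventually_conj[OF eventually_ge_at_top[of "1 :: nat"]] eventually_happens'[OF sequentially_bot] by blast
  have y0: "0 < y k" using k by (simp add: y_def)
  have yk: "fact k \<le> y k ^ k"
  proof -
    have "y k ^ k = (real k / exp 1) ^ k * exp (1 + ln (real k))"
      using k unfolding y_def power_mult_distrib by (simp add: exp_of_nat_mult[symmetric])
    also have "\<dots> = real k ^ Suc k * exp (1 - real k)"
      using k by (simp add: power_divide exp_of_nat_mult[symmetric] exp_add exp_diff)
    finally show ?thesis using fact_le_power[OF k(1)] by simp
  qed
  define M where "M = nat \<lceil>exp (y k + 1)\<rceil>"
  have M: "exp (y k + 1) \<le> real M" "real M \<le> exp (y k + 1) + 1"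
    by (auto simp: M_def of_nat_nat intro: less_imp_le)
  have e1: "1 \<le> exp (y k + 1)" using y0 by simp
  then have M1: "1 \<le> real M" using M(1) by linarith
  have lM: "y k + 1 \<le> ln (real M)" using M(1) M1 by (subst ln_ge_iff) auto
  have "real M \<le> exp (y k + 1) * exp 1"
  proof -
    have "real M \<le> exp (y k + 1) * 2" using M(2) e1 by linarith
    also have "\<dots> \<le> exp (y k + 1) * exp 1" using exp_ge_add_one_self[of 1] by (intro mult_left_mono) auto
    finally show ?thesis .
  qed
  moreover have "exp (y k + 1) * exp 1 = exp (y k + 2)" by (simp add: exp_add[symmetric])
  ultimately have "ln (real M) \<le> ln (exp (y k + 2))" using M1 by (subst ln_le_cancel_iff) auto
  then have uM: "ln (real M) \<le> y k + 2" by simp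
  have "y k ^ k \<le> (ln (real M) - 1) ^ k" using lM y0 by (intro power_mono) auto
  moreover have "c * ln (real M) < real k"
  proof (cases "0 \<le> c")
    case True
    then have "c * ln (real M) \<le> c * (y k + 2)" using uM by (intro mult_left_mono) auto
    also have "\<dots> < real k" using k(2) y0 by (simp add: pos_less_divide_eq)
    finally show ?thesis .
  next
    case False
    then have "c * ln (real M) \<le> 0" using lM y0 by (intro mult_nonpos_nonneg) auto
    then show ?thesis using k by simp
  qed
  moreover have "1 \<le> M" "1 \<le> ln (real M)" using M1 lM y0 by auto
  ultimately show ?thesis using k(1) yk order_trans by blast
qed

context torus_points begin

lemma sum_depth_upper_tail:
  assumes "1 \<le> t"
  shows "(\<Sum>v<n. P.prob {x \<in> space P. h < real (graph_dist (nn_tree n x) v 0)}) \<le> exp t * (real n powr t * t powr (- h))"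
proof -
  have "t powr h \<le> t ^ l" if "l \<in> {l. h < real l}" for l
    using that assms powr_realpow[of t l] powr_mono[of h "real l" t] by simp
  then show ?thesis using sum_prob_depth_le[of t "{l. h < real l}" h] assms by simp
qed

lemma sum_depth_lower_tail:
  assumes "0 < t" "t \<le> 1"
  shows "(\<Sum>v<n. P.prob {x \<in> space P. real (graph_dist (nn_tree n x) v 0) < h}) \<le> exp t * (real n powr t * t powr (- h))"
proof -
  have "t powr h \<le> t ^ l" if "l \<in> {l. real l < h}" for l
    using that assms powr_realpow[of t l] powr_mono'[of "real l" h t] by simp
  then show ?thesis using sum_prob_depth_le[of t "{l. real l < h}" h] assms by simp
qed

lemma prob_neg: "P.prob {x \<in> space P. \<not> Q (nn_tree n x)} = 1 - P.prob {x \<in> space P. Q (nn_tree n x)}"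
  by (rule P.prob_neg) (rule sets_tree_event)

text \<open>For the threshold \<open>t * ln n\<close> the best parameter of the generating function
  is \<open>t\<close> itself; this is the resulting bound, averaged over the \<open>n\<close>
  vertices.\<close>

definition tail_bound :: "real \<Rightarrow> real" where
  "tail_bound t = exp t * real n powr (t - 1 - t * ln t)"

lemma tail_bound_eq:
  assumes "0 < t"
  shows "exp t * (real n powr t * t powr (- (t * ln (real n)))) / real n = tail_bound t"
proof -
  have n: "real n powr (- 1) = 1 / real n" using n_pos by (simp add: powr_minus_divide)
  have "t powr (- (t * ln (real n))) = real n powr (- (t * ln t))"
    using assms n_pos by (simp add: powr_def mult_ac)
  moreover have "tail_bound t = exp t * (real n powr t * real n powr (-1) * real n powr (- (t * ln t)))"
    unfolding tail_bound_def powr_add[symmetric] by simp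
  ultimately show ?thesis by (simp add: n)
qed

text \<open>The case distinction arises since for \<open>\<epsilon> \<ge> 1\<close> the lower bound
  on the depth is not positive and holds trivially, while the parameter
  \<open>1 - \<epsilon>\<close> is no longer admissible.\<close>

lemma prob_typical_depth_ge:
  assumes "0 < \<epsilon>"
  shows "1 - (tail_bound (1 + \<epsilon>) + (if \<epsilon> < 1 then tail_bound (1 - \<epsilon>) else 0)) \<le>
    measure (nn_space n :: ((nat \<Rightarrow> real ^ 'd) \<times> nat) measure) {p \<in> space (nn_space n). case p of (x, v) \<Rightarrow>
      (1 - \<epsilon>) * ln (real n) \<le> real (graph_dist (nn_tree n x) v 0) \<and>
      real (graph_dist (nn_tree n x) v 0) \<le> (1 + \<epsilon>) * ln (real n)}"
proof -
  let ?g = "\<lambda>x v. real (graph_dist (nn_tree n x) v 0)"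
  let ?a = "(1 - \<epsilon>) * ln (real n)" and ?b = "(1 + \<epsilon>) * ln (real n)"
  let ?L = "\<lambda>v. P.prob {x \<in> space P. ?g x v < ?a}" and ?R = "\<lambda>v. P.prob {x \<in> space P. ?b < ?g x v}"
  have R: "(\<Sum>v<n. ?R v) / real n \<le> tail_bound (1 + \<epsilon>)"
    unfolding tail_bound_eq[of "1 + \<epsilon>", symmetric, OF add_pos_pos[OF zero_less_one assms]]
    using assms by (intro divide_right_mono sum_depth_upper_tail) auto
  have L: "(\<Sum>v<n. ?L v) / real n \<le> (if \<epsilon> < 1 then tail_bound (1 - \<epsilon>) else 0)"
  proof (cases "\<epsilon> < 1")
    case True
    have "(\<Sum>v<n. ?L v) / real n \<le> tail_bound (1 - \<epsilon>)"
      using True assms by (subst tail_bound_eq[symmetric]) (auto intro!: divide_right_mono sum_depth_lower_tail)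
    then show ?thesis using True by simp
  next
    case False
    then have "?a \<le> 0" using n_pos by (intro mult_nonpos_nonneg) auto
    then have "\<not> ?g x v < ?a" for x :: "nat \<Rightarrow> real ^ 'd" and v by (simp add: not_less order_trans[OF _ of_nat_0_le_iff])
    then show ?thesis using False by simp
  qed
  have ge: "1 - (?L v + ?R v) \<le> P.prob {x \<in> space P. ?a \<le> ?g x v \<and> ?g x v \<le> ?b}" for v
  proof -
    have "1 - P.prob {x \<in> space P. ?a \<le> ?g x v \<and> ?g x v \<le> ?b} = P.prob {x \<in> space P. \<not> (?a \<le> ?g x v \<and> ?g x v \<le> ?b)}"
      by (rule prob_neg[symmetric])
    also have "\<dots> \<le> P.prob ({x \<in> space P. ?g x v < ?a} \<union> {x \<in> space P. ?b < ?g x v})"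
      by (intro P.finite_measure_mono sets.Un sets_tree_event) auto
    also have "\<dots> \<le> ?L v + ?R v"
      by (intro measure_Un_le sets_tree_event)
    finally show ?thesis by simp
  qed
  have "1 - (tail_bound (1 + \<epsilon>) + (if \<epsilon> < 1 then tail_bound (1 - \<epsilon>) else 0))
      \<le> 1 - ((\<Sum>v<n. ?L v) / real n + (\<Sum>v<n. ?R v) / real n)" using L R by linarith
  also have "\<dots> = (\<Sum>v<n. 1 - (?L v + ?R v)) / real n"
    using n_pos by (simp add: sum_subtractf sum.distrib field_simps)
  also have "\<dots> \<le> (\<Sum>v<n. P.prob {x \<in> space P. ?a \<le> ?g x v \<and> ?g x v \<le> ?b}) / real n"
    by (intro divide_right_mono sum_mono ge) auto
  also note measure_nn_space[of "\<lambda>E v. ?a \<le> real (graph_dist E v 0) \<and> real (graph_dist E v 0) \<le> ?b", symmetric]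
  finally show ?thesis .
qed

text \<open>Union bound over all vertices with parameter \<open>e\<close>, where the powers
  \<open>n ^ e\<close> from the generating function and \<open>n ^ (- e)\<close> from the threshold
  cancel.\<close>

lemma prob_height_gt_le:
  "P.prob {x \<in> space P. (exp 1 + \<epsilon>) * ln (real n) < real (tree_height {..<n} (nn_tree n x) 0)}
    \<le> exp (exp 1) * real n powr (- \<epsilon>)"
proof -
  let ?h = "(exp 1 + \<epsilon>) * ln (real n)"
  have "{x \<in> space P. ?h < real (tree_height {..<n} (nn_tree n x) 0)}
    \<subseteq> (\<Union>v\<in>{..<n}. {x \<in> space P. ?h < real (graph_dist (nn_tree n x) v 0)})"
  proof clarify
    fix x assume x: "x \<in> space P" "?h < real (tree_height {..<n} (nn_tree n x) 0)"
    have "tree_height {..<n} (nn_tree n x) 0 \<in> (\<lambda>v. graph_dist (nn_tree n x) v 0) ` {..<n}"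
      unfolding tree_height_def using n_pos by (intro Max_in) (auto simp: lessThan_empty_iff)
    then show "x \<in> (\<Union>v\<in>{..<n}. {x \<in> space P. ?h < real (graph_dist (nn_tree n x) v 0)})" using x by auto
  qed
  then have "P.prob {x \<in> space P. ?h < real (tree_height {..<n} (nn_tree n x) 0)}
      \<le> P.prob (\<Union>v\<in>{..<n}. {x \<in> space P. ?h < real (graph_dist (nn_tree n x) v 0)})"
    by (intro P.finite_measure_mono sets.finite_UN sets_tree_event) auto
  also have "\<dots> \<le> (\<Sum>v<n. P.prob {x \<in> space P. ?h < real (graph_dist (nn_tree n x) v 0)})"
    by (intro P.finite_measure_subadditive_finite) (auto intro: sets_tree_event)
  also have "\<dots> \<le> exp (exp 1) * (real n powr exp 1 * exp 1 powr (- ?h))"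
    using exp_ge_add_one_self[of 1] by (intro sum_depth_upper_tail) simp
  also have "real n powr exp 1 * exp 1 powr (- ?h) = real n powr (- \<epsilon>)"
    using n_pos by (simp add: powr_def exp_add[symmetric] algebra_simps)
  finally show ?thesis .
qed

lemma prob_diam_lt_le:
  assumes k: "1 \<le> k" "k \<le> m" "fact k \<le> (ln (real M) - 1) ^ k" and M: "1 \<le> M" "1 \<le> ln (real M)"
    and m: "2 \<le> m" "2 * (k * L) < m" "3 * 2 ^ CARD('d) * ln (real n) \<le> real m" "m * M ^ L \<le> n"
  defines "K \<equiv> k * L"
  defines "\<rho> \<equiv> 1 / (1 - 2 * real K / real m)"
    and "Q \<equiv> (12 * real K * real CARD('d)) ^ CARD('d) * (3 * ln (real n))"
  shows "P.prob {x \<in> space P. graph_diam {..<n} (nn_tree n x) < 2 * K}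
    \<le> 4 * (\<rho> - 1) + 8 * (1 / real m + Q * \<rho> * real K * real M ^ k / real m + 1 / (real m)\<^sup>2)"
proof -
  define S where "S = block_paths k M m L"
  define \<pi> where "\<pi> = (\<Prod>q<L. dec_sum k (m * M ^ q) (m * M ^ q * M))"
  define \<mu> where "\<mu> = (\<Sum>s\<in>S. \<Prod>a\<leftarrow>butlast s. 1 / real a)"
  have S: "sorted_wrt (>) s \<and> length s = Suc K \<and> set s \<subseteq> {..<n} \<and> last s < m \<and> (\<forall>a\<in>set (butlast s). m \<le> a)"
    if "s \<in> S" for s
    using block_paths[OF that[unfolded S_def] M(1)] m(4) by (auto simp: K_def)
  have e: "1 \<le> dec_sum k (m * M ^ q) (m * M ^ q * M)" for q
  proof (rule dec_sum_block_ge_1)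
    have "m \<le> m * M ^ q" using M by simp
    then show "1 \<le> m * M ^ q" "k \<le> m * M ^ q" using m(1) k(2) by linarith+
  qed (use k M in auto)
  have \<pi>1: "1 \<le> \<pi>" unfolding \<pi>_def by (intro prod_ge_1 e)
  have \<mu>: "\<mu> = real m * \<pi>"
    using sum_block_paths[OF M(1), of k m L] by (simp add: \<mu>_def S_def \<pi>_def path_weight_def)
  have \<mu>m: "real m \<le> \<mu>" using \<pi>1 mult_left_mono[of 1 \<pi> "real m"] by (simp add: \<mu>)
  have \<mu>0: "0 < \<mu>" using \<mu>m m by linarith
  let ?A = "{x \<in> space P. \<forall>s\<in>S. \<forall>s'\<in>S. x \<in> Path s \<longrightarrow> x \<in> Path s' \<longrightarrow> set s \<inter> set s' \<noteq> {}}"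
  have "\<mu>\<^sup>2 * P.prob ?A \<le> 4 * (\<rho> - 1) * \<mu>\<^sup>2 + 8 * (\<mu> + Q * \<rho> * real K * \<mu> * (real M ^ k * \<pi>) + 1)"
    unfolding \<mu>_def \<rho>_def Q_def
  proof (rule no_disjoint_pair_le)
    show "finite S" by (simp add: S_def finite_block_paths)
    show "(\<Sum>h\<in>take c ` S. \<Prod>a\<leftarrow>h. 1 / real a) \<le> real M ^ k * \<pi>" if "1 \<le> c" "c \<le> K" for c
      using sum_take_block_paths[OF M(1), of m c k L] e that m
      by (simp add: S_def \<pi>_def path_weight_def K_def)
  qed (use S m in \<open>auto simp: K_def\<close>)
  then have "P.prob ?A \<le> (4 * (\<rho> - 1) * \<mu>\<^sup>2 + 8 * (\<mu> + Q * \<rho> * real K * \<mu> * (real M ^ k * \<pi>) + 1)) / \<mu>\<^sup>2"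
    using \<mu>0 by (simp add: pos_le_divide_eq mult.commute)
  also have "\<dots> = 4 * (\<rho> - 1) + 8 * (1 / \<mu> + Q * \<rho> * real K * real M ^ k * (\<pi> / \<mu>) + 1 / \<mu>\<^sup>2)"
    using \<mu>0 by (simp add: add_divide_distrib power2_eq_square)
  \<comment> \<open>The gain from merging pairs: their heads contribute \<open>\<pi>\<close> without
    the factor \<open>m\<close> of the free final vertex.\<close>
  also have "\<pi> / \<mu> = 1 / real m" using \<pi>1 by (simp add: \<mu>)
  finally have A: "P.prob ?A \<le> 4 * (\<rho> - 1) + 8 * (1 / \<mu> + Q * \<rho> * real K * real M ^ k * (1 / real m) + 1 / \<mu>\<^sup>2)" .
  have "1 / \<mu> \<le> 1 / real m" using \<mu>m m by (intro divide_left_mono) auto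
  moreover have "1 / \<mu>\<^sup>2 \<le> 1 / (real m)\<^sup>2" using \<mu>m m \<mu>0 by (intro divide_left_mono power_mono) auto
  ultimately have "P.prob ?A \<le> 4 * (\<rho> - 1) + 8 * (1 / real m + Q * \<rho> * real K * real M ^ k / real m + 1 / (real m)\<^sup>2)"
    using A by simp
  moreover have "P.prob {x \<in> space P. graph_diam {..<n} (nn_tree n x) < 2 * K} \<le> P.prob ?A"
  proof (rule P.finite_measure_mono)
    have "?A = space P - (\<Union>s\<in>S. \<Union>s'\<in>{s' \<in> S. set s \<inter> set s' = {}}. Path s \<inter> Path s')"
      by (auto simp: Path_def)
    moreover have "(\<Union>s\<in>S. \<Union>s'\<in>{s' \<in> S. set s \<inter> set s' = {}}. Path s \<inter> Path s') \<in> sets P"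
      using S by (intro sets.finite_UN sets.Int sets_Path) (auto simp: S_def finite_block_paths)
    ultimately show "?A \<in> sets P" by (simp only: sets.compl_sets)
    show "{x \<in> space P. graph_diam {..<n} (nn_tree n x) < 2 * K} \<subseteq> ?A"
    proof (clarify)
      fix x s s' assume x: "x \<in> space P" "graph_diam {..<n} (nn_tree n x) < 2 * K"
        and s: "s \<in> S" "s' \<in> S" "x \<in> Path s" "x \<in> Path s'" and disj: "set s \<inter> set s' = {}"
      have ne: "s \<noteq> []" "s' \<noteq> []" using S[OF s(1)] S[OF s(2)] by auto
      have "(length s - 1) + (length s' - 1) \<le> graph_dist (nn_tree n x) (hd s) (hd s')"
        using S[OF s(1)] S[OF s(2)] ne disj
        by (intro graph_dist_disjoint_chains[where m = m] successively_nn_parent s) auto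
      also have "\<dots> \<le> graph_diam {..<n} (nn_tree n x)"
        unfolding graph_diam_def
      proof (rule Max_ge)
        have "hd s \<in> {..<n}" "hd s' \<in> {..<n}" using S[OF s(1)] S[OF s(2)] ne by (auto dest: hd_in_set)
        then show "graph_dist (nn_tree n x) (hd s) (hd s')
            \<in> (\<lambda>(u, v). graph_dist (nn_tree n x) u v) ` ({..<n} \<times> {..<n})"
          by (intro image_eqI[of _ _ "(hd s, hd s')"]) auto
      qed simp
      finally show False using x S[OF s(1)] S[OF s(2)] by simp
    qed
  qed
  ultimately show ?thesis by linarith
qed

lemma P_eq: "P = (\<Pi>\<^sub>M i\<in>{..<n}. uniform_measure lborel (torus n))"
  by (simp only: P_def) (simp only: U_def)

lemma prob_space_nn_space: "prob_space (nn_space n :: ((nat \<Rightarrow> real ^ 'd) \<times> nat) measure)"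
proof -
  interpret C: prob_space "uniform_count_measure {..<n}"
    using n_pos by (intro prob_space_uniform_count_measure) (auto simp: lessThan_empty_iff)
  interpret PC: pair_prob_space P "uniform_count_measure {..<n}" ..
  show ?thesis unfolding nn_space_eq by unfold_locales
qed

lemma prob_diam_height_ge:
  assumes K: "(2 * exp 1 - \<epsilon>) * ln (real n) \<le> real (2 * K)"
    and B: "P.prob {x \<in> space P. graph_diam {..<n} (nn_tree n x) < 2 * K} \<le> B"
  shows "1 - (B + exp (exp 1) * real n powr (- (\<epsilon> / 2))) \<le>
    measure (nn_space n :: ((nat \<Rightarrow> real ^ 'd) \<times> nat) measure) {p \<in> space (nn_space n). case p of (x, v) \<Rightarrow>
      (2 * exp 1 - \<epsilon>) * ln (real n) \<le> real (graph_diam {..<n} (nn_tree n x)) \<and>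
      graph_diam {..<n} (nn_tree n x) \<le> 2 * tree_height {..<n} (nn_tree n x) 0 \<and>
      2 * real (tree_height {..<n} (nn_tree n x) 0) \<le> (2 * exp 1 + \<epsilon>) * ln (real n)}"
proof -
  let ?Q = "\<lambda>E. (2 * exp 1 - \<epsilon>) * ln (real n) \<le> real (graph_diam {..<n} E) \<and>
      graph_diam {..<n} E \<le> 2 * tree_height {..<n} E 0 \<and>
      2 * real (tree_height {..<n} E 0) \<le> (2 * exp 1 + \<epsilon>) * ln (real n)"
  let ?D = "{x \<in> space P. graph_diam {..<n} (nn_tree n x) < 2 * K}"
  let ?H = "{x \<in> space P. (exp 1 + \<epsilon> / 2) * ln (real n) < real (tree_height {..<n} (nn_tree n x) 0)}"
  have "{x \<in> space P. \<not> ?Q (nn_tree n x)} \<subseteq> ?D \<union> ?H"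
  proof
    fix x assume x: "x \<in> {x \<in> space P. \<not> ?Q (nn_tree n x)}"
    show "x \<in> ?D \<union> ?H"
    proof (rule ccontr)
      assume "x \<notin> ?D \<union> ?H"
      then have le: "2 * K \<le> graph_diam {..<n} (nn_tree n x)"
          "real (tree_height {..<n} (nn_tree n x) 0) \<le> (exp 1 + \<epsilon> / 2) * ln (real n)"
        using x by auto
      have "real (2 * K) \<le> real (graph_diam {..<n} (nn_tree n x))" using le(1) by (rule of_nat_mono)
      moreover have "graph_diam {..<n} (nn_tree n x) \<le> 2 * tree_height {..<n} (nn_tree n x) 0"
        using n_pos by (intro graph_diam_nn_tree_le) simp
      ultimately show False using x K le(2) by (simp add: algebra_simps)
    qed
  qed
  then have "P.prob {x \<in> space P. \<not> ?Q (nn_tree n x)} \<le> P.prob (?D \<union> ?H)"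
    by (intro P.finite_measure_mono sets.Un sets_tree_event)
  also have "\<dots> \<le> P.prob ?D + P.prob ?H" by (intro measure_Un_le sets_tree_event)
  also have "\<dots> \<le> B + exp (exp 1) * real n powr (- (\<epsilon> / 2))"
    by (intro add_mono B prob_height_gt_le)
  finally have "1 - (B + exp (exp 1) * real n powr (- (\<epsilon> / 2))) \<le> P.prob {x \<in> space P. ?Q (nn_tree n x)}"
    using prob_neg[of ?Q] by linarith
  also have "\<dots> = (\<Sum>v<n. P.prob {x \<in> space P. ?Q (nn_tree n x)}) / real n" using n_pos by simp
  also note measure_nn_space[of "\<lambda>E v. ?Q E", symmetric]
  finally show ?thesis .
qed

end

section \<open>Choice of the scales and passage to the limit\<close>

lemma ln_power_times_powr_tendsto_0:
  assumes "0 < \<delta>"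
  shows "(\<lambda>n. ln (real n) ^ p * real n powr (- \<delta>)) \<longlonglongrightarrow> 0"
proof -
  have "filterlim (\<lambda>n. \<delta> * ln (real n)) at_top sequentially" using assms by real_asymp
  from filterlim_compose[OF tendsto_power_div_exp_0 this]
  have "(\<lambda>n. (\<delta> * ln (real n)) ^ p / exp (\<delta> * ln (real n))) \<longlonglongrightarrow> 0" .
  then have "(\<lambda>n. (1 / \<delta> ^ p) * ((\<delta> * ln (real n)) ^ p / exp (\<delta> * ln (real n)))) \<longlonglongrightarrow> 0"
    by (rule tendsto_mult_right_zero)
  then show ?thesis
  proof (rule Lim_transform_eventually)
    show "eventually (\<lambda>n. (1 / \<delta> ^ p) * ((\<delta> * ln (real n)) ^ p / exp (\<delta> * ln (real n)))
        = ln (real n) ^ p * real n powr (- \<delta>)) sequentially"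
      using eventually_gt_at_top[of 0]
      by eventually_elim (use assms in \<open>simp add: powr_def exp_minus power_mult_distrib field_simps\<close>)
  qed
qed

text \<open>Replaces the rounded quantities \<open>K\<close> and \<open>m\<close> by smooth
  functions \<open>\<kappa>\<close> and \<open>r\<close> of \<open>n\<close>, for which the limit is
  easy.\<close>

lemma diam_bound_mono:
  fixes K \<kappa> r m l c :: real
  assumes "0 \<le> K" "K \<le> \<kappa>" "0 < r" "r \<le> m" "1 \<le> m" "2 * \<kappa> / r < 1" "0 \<le> l" "0 \<le> c" "0 \<le> d"
  shows "4 * (1 / (1 - 2 * K / m) - 1) + 8 * (1 / m + (12 * K * d) ^ p * l * (1 / (1 - 2 * K / m)) * K * c / m + 1 / m\<^sup>2)
    \<le> 4 * (1 / (1 - 2 * \<kappa> / r) - 1) + 8 * (1 / r + (12 * \<kappa> * d) ^ p * l * (1 / (1 - 2 * \<kappa> / r)) * \<kappa> * c / r + 1 / r)"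
proof -
  have 1: "1 / m \<le> 1 / r" using assms by (intro divide_left_mono) auto
  have "1 / m\<^sup>2 \<le> 1 / m" using assms by (intro divide_left_mono) (auto simp: power2_eq_square)
  then have 2: "1 / m\<^sup>2 \<le> 1 / r" using 1 by linarith
  have fr: "2 * K / m \<le> 2 * \<kappa> / r" using assms by (intro frac_le) auto
  then have 3: "1 / (1 - 2 * K / m) \<le> 1 / (1 - 2 * \<kappa> / r)" "0 \<le> 1 / (1 - 2 * K / m)"
    using assms by (auto intro!: divide_left_mono mult_pos_pos)
  have 4: "(12 * K * d) ^ p * l * (1 / (1 - 2 * K / m)) * K * c / m
      \<le> (12 * \<kappa> * d) ^ p * l * (1 / (1 - 2 * \<kappa> / r)) * \<kappa> * c / r"
    using assms fr 3(2) by (intro frac_le mult_mono power_mono mult_right_mono mult_nonneg_nonneg) auto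
  show ?thesis
    by (intro add_mono mult_left_mono diff_right_mono 1 2 3(1) 4) simp_all
qed

text \<open>The scales: \<open>k\<close> and \<open>M\<close> are fixed with
  \<open>\<kappa> = k / ln M\<close> above \<open>e - \<epsilon> / 4\<close>, the cutoff
  \<open>m\<close> is about \<open>n ^ \<delta>\<close>, and about
  \<open>(1 - \<delta>) * ln n / ln M\<close> blocks fit between \<open>m\<close> and
  \<open>n\<close>. The path length is then about
  \<open>\<kappa> * (1 - \<delta>) * ln n\<close>.\<close>

lemma diam_lower_bound:
  assumes "0 < \<epsilon>"
  obtains B where "B \<longlonglongrightarrow> 0"
    and "eventually (\<lambda>n. \<exists>K. (2 * exp 1 - \<epsilon>) * ln (real n) \<le> real (2 * K) \<and>
      measure (\<Pi>\<^sub>M i\<in>{..<n}. uniform_measure lborel (torus n))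
        {x \<in> space (\<Pi>\<^sub>M i\<in>{..<n}. uniform_measure lborel (torus n)).
          graph_diam {..<n} (nn_tree n (x :: nat \<Rightarrow> real ^ 'd::finite)) < 2 * K} \<le> B n) sequentially"
proof -
  obtain k M where kM: "1 \<le> k" "1 \<le> M" "1 \<le> ln (real M)" "fact k \<le> (ln (real M) - 1) ^ k"
      "(exp 1 - \<epsilon> / 4) * ln (real M) < real k"
    using ex_block_profile[of "exp 1 - \<epsilon> / 4"] assms by auto
  have "M \<noteq> 1" using kM(3) by auto
  then have M1: "1 < M" using kM(2) by simp
  define \<kappa> where "\<kappa> = real k / ln (real M)"
  have \<kappa>: "0 < \<kappa>" "exp 1 - \<epsilon> / 4 < \<kappa>" using kM(1,5) order_less_le_trans[OF zero_less_one kM(3)]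
    by (simp_all add: \<kappa>_def pos_less_divide_eq)
  \<comment> \<open>The second entry limits the loss \<open>\<delta> * \<kappa>\<close> from the
    cutoff to \<open>\<epsilon> / 4\<close>; the first one ensures that \<open>m n\<close> stays
    below \<open>n\<close>.\<close>
  define \<delta> where "\<delta> = min (1 / 2) (\<epsilon> / (4 * \<kappa>))"
  have \<delta>: "0 < \<delta>" "\<delta> \<le> 1 / 2" using assms \<kappa> by (auto simp: \<delta>_def)
  have "\<delta> * \<kappa> \<le> \<epsilon> / (4 * \<kappa>) * \<kappa>" using \<kappa> by (intro mult_right_mono) (auto simp: \<delta>_def)
  then have \<delta>\<kappa>: "exp 1 - \<epsilon> / 2 < \<kappa> * (1 - \<delta>)" using \<kappa> by (simp add: algebra_simps)
  \<comment> \<open>The slack that absorbs rounding: \<open>\<kappa> * ln 2\<close> for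
    \<open>m\<close> and \<open>k\<close> for one incomplete block, both negligible against
    \<open>c * ln n\<close>.\<close>
  define c where "c = \<kappa> * (1 - \<delta>) - (exp 1 - \<epsilon> / 2)"
  have c: "0 < c" using \<delta>\<kappa> by (simp add: c_def)
  let ?d = "CARD('d)"
  define u where "u n = 2 * (real k * ln (real n)) / real n powr \<delta>" for n
  define B where "B n = 4 * (1 / (1 - u n) - 1) + 8 * (1 / real n powr \<delta>
      + (12 * (real k * ln (real n)) * real ?d) ^ ?d * (3 * ln (real n)) * (1 / (1 - u n)) * (real k * ln (real n)) * real M ^ k / real n powr \<delta>
      + 1 / real n powr \<delta>)" for n
  have p: "(\<lambda>n. ln (real n) ^ p / real n powr \<delta>) \<longlonglongrightarrow> 0" for p
    using ln_power_times_powr_tendsto_0[OF \<delta>(1), of p] by (simp add: powr_minus divide_inverse)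
  have u0: "u \<longlonglongrightarrow> 0"
    using tendsto_mult_right_zero[OF p[of 1], of "2 * real k"] by (simp add: u_def[abs_def] mult.assoc)
  have "B \<longlonglongrightarrow> 4 * (1 / (1 - 0) - 1) + 8 * (0 + 0 * (1 / (1 - 0)) + 0)"
  proof -
    have "B = (\<lambda>n. 4 * (1 / (1 - u n) - 1) + 8 * (ln (real n) ^ 0 / real n powr \<delta>
        + ((12 * real k * real ?d) ^ ?d * 3 * real k * real M ^ k * (ln (real n) ^ (?d + 2) / real n powr \<delta>)) * (1 / (1 - u n))
        + ln (real n) ^ 0 / real n powr \<delta>))"
      by (rule ext) (simp add: B_def power_mult_distrib power_add power2_eq_square mult_ac)
    then show ?thesis
      by (simp only:) (intro tendsto_intros tendsto_mult_right_zero p u0; simp)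
  qed
  then have B0: "B \<longlonglongrightarrow> 0" by simp
  define m where "m n = nat \<lceil>real n powr \<delta>\<rceil>" for n
  \<comment> \<open>As many blocks as fit under the constraint
    \<open>m * M ^ L \<le> n\<close>.\<close>
  define L where "L n = nat \<lfloor>(ln (real n) - ln (real (m n))) / ln (real M)\<rfloor>" for n
  have small: "eventually (\<lambda>n. C * (ln (real n) ^ p / real n powr \<delta>) < 1) sequentially" for C p
    using order_tendstoD(2)[OF tendsto_mult_right_zero[OF p[of p], of C]] by simp
  have ev: "eventually (\<lambda>n. real k * (ln (real n) ^ 0 / real n powr \<delta>) < 1
      \<and> 2 * (ln (real n) ^ 0 / real n powr \<delta>) < 1 \<and> u n < 1
      \<and> 3 * 2 ^ ?d * (ln (real n) ^ 1 / real n powr \<delta>) < 1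
      \<and> \<kappa> * ln 2 + real k \<le> c * ln (real n) \<and> 4 \<le> n) sequentially"
  proof (intro eventually_conj small)
    show "eventually (\<lambda>n. u n < 1) sequentially" using order_tendstoD(2)[OF u0] by simp
    show "eventually (\<lambda>n. \<kappa> * ln 2 + real k \<le> c * ln (real n)) sequentially" using c by real_asymp
  qed (rule eventually_ge_at_top)
  have "eventually (\<lambda>n. \<exists>K. (2 * exp 1 - \<epsilon>) * ln (real n) \<le> real (2 * K) \<and>
      measure (\<Pi>\<^sub>M i\<in>{..<n}. uniform_measure lborel (torus n))
        {x \<in> space (\<Pi>\<^sub>M i\<in>{..<n}. uniform_measure lborel (torus n)).
          graph_diam {..<n} (nn_tree n (x :: nat \<Rightarrow> real ^ 'd::finite)) < 2 * K} \<le> B n) sequentially"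
    using ev
  proof eventually_elim
    case (elim n)
    define r where "r = real n powr \<delta>"
    have n4: "4 \<le> n" using elim by simp
    have r0: "0 < r" using n4 by (simp add: r_def)
    have r: "real k < r" "2 < r" "3 * 2 ^ ?d * ln (real n) < r" "2 * (real k * ln (real n)) < r"
      using elim r0 by (auto simp: u_def pos_divide_less_eq simp flip: r_def)
    have m: "r \<le> real (m n)" "real (m n) \<le> r + 1"
      using r0 by (auto simp: m_def of_nat_nat r_def[symmetric] intro: less_imp_le)
    have lnm: "ln (real (m n)) \<le> \<delta> * ln (real n) + ln 2"
    proof -
      have "ln (real (m n)) \<le> ln (r * 2)" using m r by (subst ln_le_cancel_iff) auto
      also have "\<dots> = ln r + ln 2" using r0 by (simp add: ln_mult)
      also have "ln r = \<delta> * ln (real n)" using n4 by (simp add: r_def ln_powr)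
      finally show ?thesis .
    qed
    have ln4: "2 * ln 2 \<le> ln (real n)"
    proof -
      have "2 * ln 2 = ln ((2 :: real) ^ 2)" by (subst ln_realpow) auto
      also have "\<dots> \<le> ln (real n)" using n4 by (subst ln_le_cancel_iff) auto
      finally show ?thesis .
    qed
    have "\<delta> * ln (real n) \<le> 1 / 2 * ln (real n)" using \<delta> n4 by (intro mult_right_mono) auto
    then have lnmn: "ln (real (m n)) \<le> ln (real n)" using lnm ln4 by linarith
    define q where "q = (ln (real n) - ln (real (m n))) / ln (real M)"
    have q0: "0 \<le> q" using lnmn kM by (simp add: q_def)
    have L: "real (L n) \<le> q" "q - 1 \<le> real (L n)"
      using q0 by (auto simp: L_def q_def[symmetric] of_nat_nat)
    have m1: "1 \<le> real (m n)" using m r by linarith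
    have Lln: "real (L n) \<le> ln (real n)"
    proof -
      have "q \<le> ln (real n) / ln (real M)" using kM m1 by (simp add: q_def divide_right_mono)
      also have "\<dots> \<le> ln (real n) / 1" using kM n4 M1 by (intro divide_left_mono) auto
      finally show ?thesis using L by simp
    qed
    have K: "real (k * L n) \<le> real k * ln (real n)" using Lln by (simp add: mult_left_mono)
    have mM: "m n * M ^ L n \<le> n"
    proof -
      have "real (L n) * ln (real M) \<le> ln (real n) - ln (real (m n))"
        using L(1) kM M1 by (simp add: q_def pos_le_divide_eq)
      then have "ln (real (m n * M ^ L n)) \<le> ln (real n)"
        using m1 kM by (simp add: ln_mult ln_realpow)
      then have "real (m n * M ^ L n) \<le> real n"
        using m1 kM n4 by (subst (asm) ln_le_cancel_iff) auto
      then show ?thesis by (simp only: of_nat_le_iff)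
    qed
    interpret torus_points n "TYPE('d)" using n4 by unfold_locales simp
    have "real (2 * (k * L n)) < real (m n)" using K r m by simp
    then have K2: "2 * (k * L n) < m n" by (simp only: of_nat_less_iff)
    have "P.prob {x \<in> space P. graph_diam {..<n} (nn_tree n x) < 2 * (k * L n)}
      \<le> 4 * (1 / (1 - 2 * real (k * L n) / real (m n)) - 1) + 8 * (1 / real (m n)
        + (12 * real (k * L n) * real ?d) ^ ?d * (3 * ln (real n)) * (1 / (1 - 2 * real (k * L n) / real (m n)))
          * real (k * L n) * real M ^ k / real (m n) + 1 / (real (m n))\<^sup>2)"
    proof (rule prob_diam_lt_le)
      have "real k \<le> real (m n)" "real 2 \<le> real (m n)" using r m by auto
      then show "k \<le> m n" "2 \<le> m n" by (simp_all only: of_nat_le_iff)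
    qed (use kM r m mM K2 in auto)
    also have "\<dots> \<le> B n"
      unfolding B_def u_def r_def[symmetric]
      using K r0 m m1 r n4 by (intro diam_bound_mono) auto
    finally have 1: "P.prob {x \<in> space P. graph_diam {..<n} (nn_tree n x) < 2 * (k * L n)} \<le> B n" .
    have "(exp 1 - \<epsilon> / 2) * ln (real n) \<le> real (k * L n)"
    proof -
      have "(exp 1 - \<epsilon> / 2) * ln (real n) = \<kappa> * (1 - \<delta>) * ln (real n) - c * ln (real n)"
        by (simp add: c_def algebra_simps)
      also have "\<dots> \<le> \<kappa> * (ln (real n) - (\<delta> * ln (real n) + ln 2)) - real k"
        using elim by (simp add: algebra_simps)
      also have "\<dots> \<le> \<kappa> * (ln (real n) - ln (real (m n))) - real k"
        using lnm \<kappa> by (intro diff_right_mono mult_left_mono) auto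
      also have "\<dots> = real k * (q - 1)" by (simp add: \<kappa>_def q_def algebra_simps diff_divide_distrib)
      also have "\<dots> \<le> real k * real (L n)" using L by (intro mult_left_mono) auto
      finally show ?thesis by simp
    qed
    then have "(2 * exp 1 - \<epsilon>) * ln (real n) \<le> real (2 * (k * L n))"
      by (simp add: algebra_simps)
    with 1 show ?case unfolding P_eq by (intro exI conjI)
  qed
  then show thesis using that B0 by blast
qed

lemma tendsto_powr_neg: "c < 0 \<Longrightarrow> (\<lambda>n. C * real n powr c) \<longlonglongrightarrow> 0"
  by (intro tendsto_mult_right_zero tendsto_neg_powr filterlim_real_sequentially)

lemma prob_tendsto_1I:
  fixes f b :: "nat \<Rightarrow> real"
  assumes "eventually (\<lambda>n. 1 - b n \<le> f n) sequentially" "eventually (\<lambda>n. f n \<le> 1) sequentially" "b \<longlonglongrightarrow> 0"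
  shows "f \<longlonglongrightarrow> 1"
proof (rule tendsto_sandwich[OF assms(1,2)])
  show "(\<lambda>n. 1 - b n) \<longlonglongrightarrow> 1" using tendsto_diff[OF tendsto_const assms(3), of 1] by simp
qed simp

theorem theorem1p7:
  fixes \<epsilon> :: real
  assumes "\<epsilon> > 0"
  shows
    "((\<lambda>n. \<P>((x, v) in (nn_space n :: ((nat \<Rightarrow> real ^ 'd::finite) \<times> nat) measure).
         (1 - \<epsilon>) * ln (real n) \<le> real (graph_dist (nn_tree n x) v 0) \<and>
         real (graph_dist (nn_tree n x) v 0) \<le> (1 + \<epsilon>) * ln (real n)))
       \<longlonglongrightarrow> 1) \<and>
     ((\<lambda>n. \<P>((x, v) in (nn_space n :: ((nat \<Rightarrow> real ^ 'd::finite) \<times> nat) measure).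
         (2 * exp 1 - \<epsilon>) * ln (real n) \<le> real (graph_diam {..<n} (nn_tree n x)) \<and>
         graph_diam {..<n} (nn_tree n x) \<le> 2 * tree_height {..<n} (nn_tree n x) 0 \<and>
         2 * real (tree_height {..<n} (nn_tree n x) 0) \<le> (2 * exp 1 + \<epsilon>) * ln (real n)))
       \<longlonglongrightarrow> 1)"
proof (rule conjI)
  have le_1: "eventually (\<lambda>n. measure (nn_space n :: ((nat \<Rightarrow> real ^ 'd) \<times> nat) measure) (A n) \<le> 1) sequentially" for A
    using eventually_ge_at_top[of 1]
  proof eventually_elim
    case (elim n)
    interpret torus_points n "TYPE('d)" using elim by unfold_locales
    show ?case by (rule prob_space.prob_le_1[OF prob_space_nn_space])
  qed
  have set_eq: "{(x, v). (x, v) \<in> space M \<and> Q x v} = {p \<in> space M. case p of (x, v) \<Rightarrow> Q x v}"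
    for M :: "((nat \<Rightarrow> real ^ 'd) \<times> nat) measure" and Q
    by auto
  let ?c = "\<lambda>t :: real. t - 1 - t * ln t"
  let ?t = "\<lambda>t n. exp t * real n powr ?c t"
  show "(\<lambda>n. \<P>((x, v) in (nn_space n :: ((nat \<Rightarrow> real ^ 'd) \<times> nat) measure).
         (1 - \<epsilon>) * ln (real n) \<le> real (graph_dist (nn_tree n x) v 0) \<and>
         real (graph_dist (nn_tree n x) v 0) \<le> (1 + \<epsilon>) * ln (real n))) \<longlonglongrightarrow> 1"
  proof (rule prob_tendsto_1I[OF _ le_1])
    show "eventually (\<lambda>n. 1 - (?t (1 + \<epsilon>) n + (if \<epsilon> < 1 then ?t (1 - \<epsilon>) n else 0)) \<le>
        \<P>((x, v) in (nn_space n :: ((nat \<Rightarrow> real ^ 'd) \<times> nat) measure).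
         (1 - \<epsilon>) * ln (real n) \<le> real (graph_dist (nn_tree n x) v 0) \<and>
         real (graph_dist (nn_tree n x) v 0) \<le> (1 + \<epsilon>) * ln (real n))) sequentially"
      using eventually_ge_at_top[of 1]
    proof eventually_elim
      case (elim n)
      interpret torus_points n "TYPE('d)" using elim by unfold_locales
      show ?case using prob_typical_depth_ge[OF assms] unfolding set_eq tail_bound_def .
    qed
    have "(\<lambda>n. ?t (1 + \<epsilon>) n) \<longlonglongrightarrow> 0"
      using ln_gt_recip[of "1 + \<epsilon>"] assms by (intro tendsto_powr_neg) simp
    moreover have "(\<lambda>n. if \<epsilon> < 1 then ?t (1 - \<epsilon>) n else 0) \<longlonglongrightarrow> 0"
      using ln_gt_recip[of "1 - \<epsilon>"] assms tendsto_powr_neg[of "?c (1 - \<epsilon>)" "exp (1 - \<epsilon>)"]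
      by (cases "\<epsilon> < 1") auto
    ultimately show "(\<lambda>n. ?t (1 + \<epsilon>) n + (if \<epsilon> < 1 then ?t (1 - \<epsilon>) n else 0)) \<longlonglongrightarrow> 0"
      using tendsto_add[of "\<lambda>n. ?t (1 + \<epsilon>) n" 0] by fastforce
  qed
  obtain B where B: "B \<longlonglongrightarrow> 0" "eventually (\<lambda>n. \<exists>K. (2 * exp 1 - \<epsilon>) * ln (real n) \<le> real (2 * K) \<and>
      measure (\<Pi>\<^sub>M i\<in>{..<n}. uniform_measure lborel (torus n))
        {x \<in> space (\<Pi>\<^sub>M i\<in>{..<n}. uniform_measure lborel (torus n)).
          graph_diam {..<n} (nn_tree n (x :: nat \<Rightarrow> real ^ 'd)) < 2 * K} \<le> B n) sequentially"
    using diam_lower_bound[OF assms] by blast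
  show "(\<lambda>n. \<P>((x, v) in (nn_space n :: ((nat \<Rightarrow> real ^ 'd) \<times> nat) measure).
         (2 * exp 1 - \<epsilon>) * ln (real n) \<le> real (graph_diam {..<n} (nn_tree n x)) \<and>
         graph_diam {..<n} (nn_tree n x) \<le> 2 * tree_height {..<n} (nn_tree n x) 0 \<and>
         2 * real (tree_height {..<n} (nn_tree n x) 0) \<le> (2 * exp 1 + \<epsilon>) * ln (real n))) \<longlonglongrightarrow> 1"
  proof (rule prob_tendsto_1I[OF _ le_1])
    show "eventually (\<lambda>n. 1 - (B n + exp (exp 1) * real n powr (- (\<epsilon> / 2))) \<le>
      \<P>((x, v) in (nn_space n :: ((nat \<Rightarrow> real ^ 'd) \<times> nat) measure).
         (2 * exp 1 - \<epsilon>) * ln (real n) \<le> real (graph_diam {..<n} (nn_tree n x)) \<and>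
         graph_diam {..<n} (nn_tree n x) \<le> 2 * tree_height {..<n} (nn_tree n x) 0 \<and>
         2 * real (tree_height {..<n} (nn_tree n x) 0) \<le> (2 * exp 1 + \<epsilon>) * ln (real n))) sequentially"
      using B(2) eventually_ge_at_top[of 1]
    proof eventually_elim
      case (elim n)
      interpret torus_points n "TYPE('d)" using elim(2) by unfold_locales
      obtain K where K: "(2 * exp 1 - \<epsilon>) * ln (real n) \<le> real (2 * K)"
          "P.prob {x \<in> space P. graph_diam {..<n} (nn_tree n x) < 2 * K} \<le> B n"
        using elim(1) unfolding P_eq by (elim exE conjE)
      show ?case using prob_diam_height_ge[OF K] unfolding set_eq .
    qed
    show "(\<lambda>n. B n + exp (exp 1) * real n powr (- (\<epsilon> / 2))) \<longlonglongrightarrow> 0"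
      using tendsto_add[OF B(1) tendsto_powr_neg[of "- (\<epsilon> / 2)" "exp (exp 1)"]] assms by simp
  qed
qed

end
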